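(* Let $\pi\colon(T,X)\to(T,Y)$ be a non-PI extension of minimal compact metric flows. Then there is a residual set $Y_{\mathrm{LY}}\subseteq Y$ such that for every $y\in Y_{\mathrm{LY}}$ there is a residual subset $G_y$ of $\pi^{-1}y$ such that for every $x\in G_y$ there is a residual subset $S[x]$ of $\mathtt M_\infty[x]=\{x':(x,x')\in\mathtt M_\infty\}$ with the property that $(x,x')$ is a Li-Yorke pair for $\pi$ relative to $\mathtt M_\infty$ for each $x'\in S[x]$.
   Context: $T$ is a group acting continuously (regarded as discrete for the Ellis machinery). $\mathtt R_\pi=\{(x_1,x_2):\pi x_1=\pi x_2\}$, $\Delta_X$ the diagonal. For a closed $L$ with $\Delta_X\subsetneq L\subseteq\mathtt R_\pi$, a pair $(x,x')$ is a Li-Yorke pair for $\pi$ rel. $L$ if $(x,x')\in\mathtt R_\pi$ and $L\subseteq\overline{T(x,x')}$. $\pi$ is proximal if $\overline{Tz}\cap\Delta_X\ne\emptyset$ for all $z\in\mathtt R_\pi$; a.p. if there is no $(x,x')\in\mathtt R_\pi\setminus\Delta_X$ with $\overline{T((U\times V)\cap\mathtt R_\pi)}\cap\Delta_X\ne\emptyset$ for all neighborhoods $U\ni x$, $V\ni x'$. $\pi$ is PI if there are a minimal compact flow $X'$ and a proximal extension $\rho\colon X'\to X$ such that $\pi\circ\rho$ admits a PI-tower: an ordinal $\vartheta$, minimal compact flows $Y_\gamma$ ($\gamma\le\vartheta$), $Y_0=Y$, compatible extensions $\pi'_\gamma\colon X'\to Y_\gamma$ ($\pi'_0=\pi\circ\rho$)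 and $\psi_\gamma^{\gamma+1}\colon Y_{\gamma+1}\to Y_\gamma$ each proximal or a.p., inverse limits at limit ordinals, and $\pi'_\vartheta$ an isomorphism. Ellis machinery: $\mathbb I$ a minimal left ideal of $\beta T$, $\mathrm{Aut}(\mathbb I)$ the automorphisms of $(T,\mathbb I)$, $\Gamma[\alpha]=\{(m,\alpha m):m\in\mathbb I\}$; $\alpha_i\to_\tau\alpha$ iff for every $m$ there is a net $m_i\to m$ with $\alpha_im_i\to\alpha m$. For a $\tau$-closed subgroup $\mathbb F$, $\mathbb F'=\{\alpha\in\mathbb F:\exists\delta_i\in\mathbb F,\ \delta_i\to_\tau\alpha,\ \delta_i\to_\tau\mathrm{id}_{\mathbb I}\}$. Fix an extension $\pi_X\colon\mathbb I\to X$, $\pi_Y=\pi\circ\pi_X$, $\mathbb F=\{\alpha:\pi_Y\circ\alpha=\pi_Y\}$; $\mathbb F_0=\mathbb F$, $\mathbb F_{o+1}=\mathbb F_o'$, intersections at limit ordinals; $\mathbb F_\infty$ is the stable value. $\mathtt M_\infty=(\pi_X\times\pi_X)\big(\overline{\bigcup_{\alpha\in\mathbb F_\infty}\Gamma[\alpha]}\big)$. *)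

theory Defs
  imports "HOL-Analysis.Analysis"
begin

definition is_flow :: "'g::topological_group_add topology \<Rightarrow> 'a topology \<Rightarrow> ('g \<Rightarrow> 'a \<Rightarrow> 'a) \<Rightarrow> bool" where
  "is_flow Tt Xt act \<longleftrightarrow>
     (\<forall>x\<in>topspace Xt. act 0 x = x) \<and>
     (\<forall>s t. \<forall>x\<in>topspace Xt. act (s + t) x = act s (act t x)) \<and>
     (\<forall>t. \<forall>x\<in>topspace Xt. act t x \<in> topspace Xt) \<and>
     continuous_map (prod_topology Tt Xt) Xt (\<lambda>(t, x). act t x)"

definition orbit :: "('g \<Rightarrow> 'a \<Rightarrow> 'a) \<Rightarrow> 'a \<Rightarrow> 'a set" where
  "orbit act x = range (\<lambda>t. act t x)"

definition is_minimal_flow :: "'a topology \<Rightarrow> ('g::topological_group_add \<Rightarrow> 'a \<Rightarrow> 'a) \<Rightarrow> bool" where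
  "is_minimal_flow Xt act \<longleftrightarrow> is_flow euclidean Xt act \<and> topspace Xt \<noteq> {} \<and>
     (\<forall>x\<in>topspace Xt. Xt closure_of (orbit act x) = topspace Xt)"

definition is_minimal_compact_flow :: "'a topology \<Rightarrow> ('g::topological_group_add \<Rightarrow> 'a \<Rightarrow> 'a) \<Rightarrow> bool" where
  "is_minimal_compact_flow Xt act \<longleftrightarrow>
     is_minimal_flow Xt act \<and> compact_space Xt \<and> Hausdorff_space Xt"

definition is_hom :: "'a topology \<Rightarrow> ('g \<Rightarrow> 'a \<Rightarrow> 'a) \<Rightarrow> 'b topology \<Rightarrow> ('g \<Rightarrow> 'b \<Rightarrow> 'b) \<Rightarrow> ('a \<Rightarrow> 'b) \<Rightarrow> bool" where
  "is_hom Xt actX Yt actY f \<longleftrightarrow> continuous_map Xt Yt f \<and>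
     (\<forall>t. \<forall>x\<in>topspace Xt. f (actX t x) = actY t (f x))"

definition is_extension :: "'a topology \<Rightarrow> ('g \<Rightarrow> 'a \<Rightarrow> 'a) \<Rightarrow> 'b topology \<Rightarrow> ('g \<Rightarrow> 'b \<Rightarrow> 'b) \<Rightarrow> ('a \<Rightarrow> 'b) \<Rightarrow> bool" where
  "is_extension Xt actX Yt actY f \<longleftrightarrow> is_hom Xt actX Yt actY f \<and> f ` topspace Xt = topspace Yt"

definition is_flow_iso :: "'a topology \<Rightarrow> ('g \<Rightarrow> 'a \<Rightarrow> 'a) \<Rightarrow> 'b topology \<Rightarrow> ('g \<Rightarrow> 'b \<Rightarrow> 'b) \<Rightarrow> ('a \<Rightarrow> 'b) \<Rightarrow> bool" where
  "is_flow_iso Xt actX Yt actY f \<longleftrightarrow> homeomorphic_map Xt Yt f \<and>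
     (\<forall>t. \<forall>x\<in>topspace Xt. f (actX t x) = actY t (f x))"

definition rel_of :: "'a set \<Rightarrow> ('a \<Rightarrow> 'b) \<Rightarrow> ('a \<times> 'a) set" where
  "rel_of X f = {(x1, x2). x1 \<in> X \<and> x2 \<in> X \<and> f x1 = f x2}"

definition diag :: "'a set \<Rightarrow> ('a \<times> 'a) set" where
  "diag X = {(x, x) | x. x \<in> X}"

definition act2 :: "('g \<Rightarrow> 'a \<Rightarrow> 'a) \<Rightarrow> 'g \<Rightarrow> 'a \<times> 'a \<Rightarrow> 'a \<times> 'a" where
  "act2 act t z = (act t (fst z), act t (snd z))"

definition is_proximal_ext :: "'a topology \<Rightarrow> ('g \<Rightarrow> 'a \<Rightarrow> 'a) \<Rightarrow> 'b topology \<Rightarrow> ('g \<Rightarrow> 'b \<Rightarrow> 'b) \<Rightarrow> ('a \<Rightarrow> 'b) \<Rightarrow> bool" where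
  "is_proximal_ext Xt actX Yt actY f \<longleftrightarrow> is_extension Xt actX Yt actY f \<and>
     (\<forall>z\<in>rel_of (topspace Xt) f.
        (prod_topology Xt Xt) closure_of (range (\<lambda>t. act2 actX t z)) \<inter> diag (topspace Xt) \<noteq> {})"

definition is_ap_ext :: "'a topology \<Rightarrow> ('g \<Rightarrow> 'a \<Rightarrow> 'a) \<Rightarrow> 'b topology \<Rightarrow> ('g \<Rightarrow> 'b \<Rightarrow> 'b) \<Rightarrow> ('a \<Rightarrow> 'b) \<Rightarrow> bool" where
  "is_ap_ext Xt actX Yt actY f \<longleftrightarrow> is_extension Xt actX Yt actY f \<and>
     \<not> (\<exists>x x'. (x, x') \<in> rel_of (topspace Xt) f - diag (topspace Xt) \<and>
          (\<forall>U V. openin Xt U \<and> x \<in> U \<and> openin Xt V \<and> x' \<in> V \<longrightarrow>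
             (prod_topology Xt Xt) closure_of
                (\<Union>t. act2 actX t ` ((U \<times> V) \<inter> rel_of (topspace Xt) f))
               \<inter> diag (topspace Xt) \<noteq> {}))"

text \<open>A PI-tower for the extension \<phi> : X' \<rightarrow> Y.  The ordinal
  \<vartheta> + 1 is represented by a well-order W with a greatest element
  \<vartheta> and least element 0 on an index type 'w.  The flows
  Y_\<gamma> have carriers in the type 'z; Y_0 is identified with
  Y via a flow isomorphism h.  psi \<gamma> \<delta> is the connecting map
  Y_\<delta> \<rightarrow> Y_\<gamma> for \<gamma> \<le> \<delta>.\<close>

definition strict_below :: "('w \<times> 'w) set \<Rightarrow> 'w \<Rightarrow> 'w set" where
  "strict_below W l = {g. (g, l) \<in> W \<and> g \<noteq> l}"

definition has_PI_tower ::
  "'a topology \<Rightarrow> ('g::topological_group_add \<Rightarrow> 'a \<Rightarrow> 'a) \<Rightarrow> 'y topology \<Rightarrow> ('g \<Rightarrow> 'y \<Rightarrow> 'y)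
   \<Rightarrow> ('a \<Rightarrow> 'y) \<Rightarrow> ('w \<times> 'w) set \<Rightarrow> ('w \<Rightarrow> 'z topology) \<Rightarrow> ('w \<Rightarrow> 'g \<Rightarrow> 'z \<Rightarrow> 'z)
   \<Rightarrow> ('w \<Rightarrow> 'a \<Rightarrow> 'z) \<Rightarrow> ('w \<Rightarrow> 'w \<Rightarrow> 'z \<Rightarrow> 'z) \<Rightarrow> bool" where
  "has_PI_tower Xt actX Yt actY \<phi> W Ys actYs pr psi \<longleftrightarrow>
     Well_order W \<and>
     (\<exists>z0 th h. z0 \<in> Field W \<and> th \<in> Field W \<and>
        (\<forall>g\<in>Field W. (z0, g) \<in> W \<and> (g, th) \<in> W) \<and>
        \<comment> \<open>Y_0 = Y and pi'_0 = phi\<close>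
        is_flow_iso Yt actY (Ys z0) (actYs z0) h \<and>
        (\<forall>x\<in>topspace Xt. pr z0 x = h (\<phi> x)) \<and>
        \<comment> \<open>pi'_theta is an isomorphism\<close>
        is_flow_iso Xt actX (Ys th) (actYs th) (pr th)) \<and>
     (\<forall>g\<in>Field W. is_minimal_compact_flow (Ys g) (actYs g) \<and>
        is_extension Xt actX (Ys g) (actYs g) (pr g)) \<and>
     \<comment> \<open>compatible connecting extensions\<close>
     (\<forall>g d. (g, d) \<in> W \<longrightarrow>
        is_extension (Ys d) (actYs d) (Ys g) (actYs g) (psi g d) \<and>
        (\<forall>x\<in>topspace Xt. psi g d (pr d x) = pr g x)) \<and>
     \<comment> \<open>successor steps are proximal or almost periodic\<close>
     (\<forall>g d. (g, d) \<in> W \<and> g \<noteq> d \<and> (\<nexists>e. e \<in> strict_below W d \<and> g \<in> strict_below W e) \<longrightarrow>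
        is_proximal_ext (Ys d) (actYs d) (Ys g) (actYs g) (psi g d) \<or>
        is_ap_ext (Ys d) (actYs d) (Ys g) (actYs g) (psi g d)) \<and>
     \<comment> \<open>limit steps are inverse limits\<close>
     (\<forall>l\<in>Field W. strict_below W l \<noteq> {} \<and>
        (\<forall>g\<in>strict_below W l. \<exists>e. e \<in> strict_below W l \<and> g \<in> strict_below W e) \<longrightarrow>
        homeomorphic_map (Ys l)
          (subtopology (product_topology Ys (strict_below W l))
             {f. \<forall>g\<in>strict_below W l. \<forall>d\<in>strict_below W l. (g, d) \<in> W \<longrightarrow> psi g d (f d) = f g})
          (\<lambda>y. restrict (\<lambda>g. psi g l y) (strict_below W l)))"

definition is_PI ::
  "'x topology \<Rightarrow> ('g::topological_group_add \<Rightarrow> 'x \<Rightarrow> 'x) \<Rightarrow> 'y topology \<Rightarrow> ('g \<Rightarrow> 'y \<Rightarrow> 'y)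
   \<Rightarrow> ('x \<Rightarrow> 'y) \<Rightarrow> bool" where
  "is_PI Xt actX Yt actY \<pi> \<longleftrightarrow>
     (\<exists>(Xp :: 'g filter set topology) actXp \<rho>.
        is_minimal_compact_flow Xp actXp \<and>
        is_proximal_ext Xp actXp Xt actX \<rho> \<and>
        (\<exists>(W :: ('g filter set \<times> 'g filter set) set)
           (Ys :: 'g filter set \<Rightarrow> 'g filter set topology) actYs pr psi.
           has_PI_tower Xp actXp Yt actY (\<pi> \<circ> \<rho>) W Ys actYs pr psi))"

definition is_ultrafilter :: "'g filter \<Rightarrow> bool" where
  "is_ultrafilter p \<longleftrightarrow> p \<noteq> bot \<and> (\<forall>A. eventually (\<lambda>t. t \<in> A) p \<or> eventually (\<lambda>t. t \<notin> A) p)"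

definition betaT :: "'g filter set" where
  "betaT = {p. is_ultrafilter p}"

definition betaT_top :: "'g filter topology" where
  "betaT_top = topology_generated_by {{p. is_ultrafilter p \<and> eventually (\<lambda>t. t \<in> A) p} | A. True}"

text \<open>Semigroup operation extending the group operation (p q) ; A \<in> pq iff
  {s. s^-^1A \<in> q} \<in> p; right multiplication is continuous.\<close>
definition betaT_mult :: "'g::group_add filter \<Rightarrow> 'g filter \<Rightarrow> 'g filter" where
  "betaT_mult p q = Abs_filter (\<lambda>P. eventually (\<lambda>s. eventually (\<lambda>t. P (s + t)) q) p)"

definition betaT_act :: "'g::group_add \<Rightarrow> 'g filter \<Rightarrow> 'g filter" where
  "betaT_act t p = filtermap (\<lambda>s. t + s) p"

definition is_left_ideal :: "'g::group_add filter set \<Rightarrow> bool" where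
  "is_left_ideal L \<longleftrightarrow> L \<subseteq> betaT \<and> (\<forall>p\<in>betaT. \<forall>q\<in>L. betaT_mult p q \<in> L)"

definition is_minimal_left_ideal :: "'g::group_add filter set \<Rightarrow> bool" where
  "is_minimal_left_ideal L \<longleftrightarrow> L \<noteq> {} \<and> is_left_ideal L \<and>
     (\<forall>L'. L' \<noteq> {} \<and> is_left_ideal L' \<and> L' \<subseteq> L \<longrightarrow> L' = L)"

text \<open>Automorphisms of the flow (T, I) (T discrete); extended by the identity
  outside I so that they are uniquely determined by their action on I.\<close>
definition Aut :: "'g::group_add filter set \<Rightarrow> ('g filter \<Rightarrow> 'g filter) set" where
  "Aut I = {\<alpha>. bij_betw \<alpha> I I \<and> (\<forall>p. p \<notin> I \<longrightarrow> \<alpha> p = p) \<and>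
     continuous_map (subtopology betaT_top I) (subtopology betaT_top I) \<alpha> \<and>
     (\<forall>t. \<forall>p\<in>I. \<alpha> (betaT_act t p) = betaT_act t (\<alpha> p))}"

definition Gamma :: "'g filter set \<Rightarrow> ('g filter \<Rightarrow> 'g filter) \<Rightarrow> ('g filter \<times> 'g filter) set" where
  "Gamma I \<alpha> = {(m, \<alpha> m) | m. m \<in> I}"

text \<open>Net convergence in the tau-topology: \<alpha>_i \<rightarrow>_\<tau> \<alpha>.  A net is a
  function on an index type together with a proper filter (the filter of tails of a
  directed set).\<close>
definition tau_conv :: "'g filter set \<Rightarrow> 'i filter \<Rightarrow> ('i \<Rightarrow> 'g filter \<Rightarrow> 'g filter)
    \<Rightarrow> ('g filter \<Rightarrow> 'g filter) \<Rightarrow> bool" where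
  "tau_conv I F \<delta> \<alpha> \<longleftrightarrow>
     (\<forall>m\<in>I. \<exists>mm. eventually (\<lambda>i. mm i \<in> I) F \<and>
        limitin (subtopology betaT_top I) mm m F \<and>
        limitin (subtopology betaT_top I) (\<lambda>i. \<delta> i (mm i)) (\<alpha> m) F)"

text \<open>The derived group \<FF>'.  The net index type is fixed to
  ('g filter \<Rightarrow> 'g filter) \<times> ('g filter \<Rightarrow> 'g filter) \<times> ('g filter \<Rightarrow> 'g filter),
  which is no restriction (push any net forward along
  i \<mapsto> (\<delta>_i, m \<mapsto> m_i, m \<mapsto> m'_i)).\<close>
definition derived :: "'g filter set \<Rightarrow> ('g filter \<Rightarrow> 'g filter) set \<Rightarrow> ('g filter \<Rightarrow> 'g filter) set" where
  "derived I FF = {\<alpha>\<in>FF. \<exists>(F :: (('g filter \<Rightarrow> 'g filter) \<times> ('g filter \<Rightarrow> 'g filter)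
                                 \<times> ('g filter \<Rightarrow> 'g filter)) filter) \<delta>.
       F \<noteq> bot \<and> eventually (\<lambda>i. \<delta> i \<in> FF) F \<and>
       tau_conv I F \<delta> \<alpha> \<and> tau_conv I F \<delta> (\<lambda>p. p)}"

text \<open>The transfinite sequence \<FF>_o: the set of all its members is the
  smallest family containing \<FF>, closed under the derivation and under
  intersections of chains.  \<FF>_\<infinity> is its least element (the stable value).\<close>
inductive_set F_seq :: "'g filter set \<Rightarrow> ('g filter \<Rightarrow> 'g filter) set \<Rightarrow> ('g filter \<Rightarrow> 'g filter) set set"
  for I FF where
  base: "FF \<in> F_seq I FF"
| succ: "H \<in> F_seq I FF \<Longrightarrow> derived I H \<in> F_seq I FF"
| lim: "(\<And>H. H \<in> C \<Longrightarrow> H \<in> F_seq I FF) \<Longrightarrow> C \<noteq> {} \<Longrightarrow> Complete_Partial_Order.chain (\<subseteq>) C \<Longrightarrow> \<Inter>C \<in> F_seq I FF"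

definition F_infty :: "'g filter set \<Rightarrow> ('g filter \<Rightarrow> 'g filter) set \<Rightarrow> ('g filter \<Rightarrow> 'g filter) set" where
  "F_infty I FF = \<Inter>(F_seq I FF)"

definition FF_of :: "'g::group_add filter set \<Rightarrow> ('g filter \<Rightarrow> 'y) \<Rightarrow> ('g filter \<Rightarrow> 'g filter) set" where
  "FF_of I piY = {\<alpha>\<in>Aut I. \<forall>m\<in>I. piY (\<alpha> m) = piY m}"

definition M_infty :: "'g::group_add filter set \<Rightarrow> ('g filter \<Rightarrow> 'x) \<Rightarrow> ('x \<Rightarrow> 'y) \<Rightarrow> ('x \<times> 'x) set" where
  "M_infty I piX \<pi> =
     (\<lambda>(m, m'). (piX m, piX m')) `
       ((prod_topology (subtopology betaT_top I) (subtopology betaT_top I)) closure_of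
          (\<Union>\<alpha>\<in>F_infty I (FF_of I (\<pi> \<circ> piX)). Gamma I \<alpha>))"

definition LY_pair_rel ::
  "('g \<Rightarrow> 'x::metric_space \<Rightarrow> 'x) \<Rightarrow> 'x set \<Rightarrow> ('x \<Rightarrow> 'y) \<Rightarrow> ('x \<times> 'x) set \<Rightarrow> 'x \<Rightarrow> 'x \<Rightarrow> bool" where
  "LY_pair_rel act X \<pi> L x x' \<longleftrightarrow>
     closed L \<and> diag X \<subset> L \<and> L \<subseteq> rel_of X \<pi> \<and>
     (x, x') \<in> rel_of X \<pi> \<and> L \<subseteq> closure (range (\<lambda>t. act2 act t (x, x')))"

definition residual_in :: "'a::topological_space set \<Rightarrow> 'a set \<Rightarrow> bool" where
  "residual_in S A \<longleftrightarrow> A \<subseteq> S \<and>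
     (\<exists>U :: nat \<Rightarrow> 'a set. (\<forall>n. openin (top_of_set S) (U n) \<and> S \<subseteq> closure (U n)) \<and>
        (\<Inter>n. U n) \<subseteq> A)"

end

theory Submission
  imports Defs
begin

text \<open>Write \<open>\<F>\<close> for the group of \<open>\<pi> \<circ> \<pi>\<^sub>X\<close>, \<open>\<A>\<close> for that of \<open>\<pi>\<^sub>X\<close> and \<open>\<F>\<^sub>\<infinity>\<close> for the stable derived
  group.  The equality \<open>\<F>\<^sub>\<infinity>' = \<F>\<^sub>\<infinity>\<close> says that any two graphs \<open>\<Gamma>[\<alpha>]\<close>, \<open>\<Gamma>[\<beta>]\<close> with \<open>\<alpha>, \<beta> \<in> \<F>\<^sub>\<infinity>\<close> are
  approximated near given points by one and the same minimal set \<open>\<Gamma>[\<delta>]\<close>; hence \<open>M\<^sub>\<infinity>\<close> is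
  topologically transitive with dense minimal points.  The points of \<open>M\<^sub>\<infinity>\<close> with dense orbit are
  therefore residual, the projections \<open>M\<^sub>\<infinity> \<rightarrow> X\<close> and \<open>\<pi>\<close> are semi-open, and two applications of a
  Kuratowski-Ulam theorem for semi-open maps give the residual sets of the statement.

  It remains to see that \<open>M\<^sub>\<infinity>\<close> is not the diagonal, that is, that \<open>\<pi>\<close> is PI when \<open>\<F>\<^sub>\<infinity> \<subseteq> \<A>\<close>.  Let
  \<open>X'\<close> be the largest quotient of the minimal ideal with group \<open>\<A>\<close> that is jointly continuous for the
  given topology of \<open>T\<close>; it is a proximal extension of \<open>X\<close>.  Starting at \<open>Y\<close>, choose proximal or
  almost periodic extensions inside \<open>X'\<close> transfinitely until a quotient \<open>Z\<close> of \<open>X'\<close> without further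
  ones is reached, and let \<open>\<H>\<close> be its group.  Having no proximal extension, \<open>Z\<close> is relatively
  incontractible below \<open>X'\<close>: the relation of \<open>X' \<rightarrow> Z\<close> is the closure of the graphs of \<open>\<H>\<close>.
  If \<open>\<H>'\<A> \<noteq> \<H>\<close>, the pairs whose difference lies in \<open>\<H>'\<A>\<close> form a closed invariant equivalence
  relation which defines a nontrivial almost periodic extension of \<open>Z\<close>.  So \<open>\<H> = \<H>'\<A>\<close>, whence
  \<open>\<H> \<subseteq> \<F>\<^sub>\<infinity>\<A> = \<A>\<close>; then \<open>X' \<rightarrow> Z\<close> is proximal and \<open>Z = X'\<close>.\<close>

section \<open>Transfinite descent\<close>

text \<open>Two demands of \<open>is_PI\<close> shape the construction: flows and index orders must
  live in the type \<open>'g filter set\<close>. The flows are therefore quotients of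
  \<open>I\<close> whose points are subsets of \<open>I\<close>, and ordinals give way to chains of
  equivalence relations under reverse inclusion. The difference of a pair \<open>(m, n)\<close> is
  the automorphism \<open>kap m n\<close> taking \<open>e \<odot> m\<close> to
  \<open>e \<odot> n\<close>. Closedness and invariance of the almost periodic relation rest on
  this. Convergence of automorphisms is handled by asking which open sets of
  \<open>I \<times> I\<close> their graphs meet. Passing from \<open>\<H> = \<H>'\<A>\<close> to
  \<open>\<H> \<subseteq> \<F>\<^sub>\<infinity>\<A>\<close> is a transfinite induction on the
  inclusion \<open>(\<S>\<A>)' \<subseteq> \<S>'\<A>\<close> and on the exchange of the product by
  \<open>\<A>\<close> with intersections of chains; both come from compactness of \<open>I\<close>.
  Incontractibility is proved with functions: suprema over \<H> turn \<A>-invariant uniformly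
  continuous functions into \<H>-invariant ones.\<close>

inductive_set descent :: "('a set \<Rightarrow> 'a set) \<Rightarrow> 'a set \<Rightarrow> 'a set set" for f a where
  base: "a \<in> descent f a"
| step: "S \<in> descent f a \<Longrightarrow> f S \<in> descent f a"
| lim: "(\<And>S. S \<in> C \<Longrightarrow> S \<in> descent f a) \<Longrightarrow> C \<noteq> {} \<Longrightarrow> Complete_Partial_Order.chain (\<subseteq>) C
    \<Longrightarrow> \<Inter>C \<in> descent f a"

lemma descent_subset:
  assumes f: "\<And>S. f S \<subseteq> S" and "S \<in> descent f a"
  shows "S \<subseteq> a"
  using assms(2) by induction (use f in blast)+

text \<open>The hypothesis on \<open>c\<close> is the notion of an extreme point from the
  Bourbaki-Witt theorem. Induction on \<open>x\<close> then leaves no member strictly between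
  \<open>f c\<close> and \<open>c\<close>.\<close>

lemma descent_extreme:
  assumes f: "\<And>S. f S \<subseteq> S" and c: "\<And>x. x \<in> descent f a \<Longrightarrow> c \<subset> x \<Longrightarrow> c \<subseteq> f x"
    and "c \<in> descent f a" and x: "x \<in> descent f a"
  shows "x \<subseteq> f c \<or> c \<subseteq> x"
  using x
proof induction
  case base
  then show ?case using descent_subset[OF f] assms(3) by blast
next
  case (step S)
  then show ?case using f[of S] c[OF step(1)] by (cases "c = S") auto
next
  case (lim C)
  then show ?case by blast
qed

text \<open>Every member is extreme, by induction on \<open>c\<close>. In the limit case a member
  \<open>x\<close> strictly above \<open>\<Inter>C\<close> is not contained in some
  \<open>d \<in> C\<close>; comparison with \<open>d\<close> gives \<open>d \<subset> x\<close>, and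
  the induction hypothesis for \<open>d\<close> applies.\<close>

lemma descent_compare:
  assumes f: "\<And>S. f S \<subseteq> S" and c: "c \<in> descent f a" and x: "x \<in> descent f a"
  shows "x \<subseteq> f c \<or> c \<subseteq> x"
proof -
  have "\<forall>x\<in>descent f a. c \<subset> x \<longrightarrow> c \<subseteq> f x"
    using c
  proof induction
    case base
    then show ?case using descent_subset[OF f] by blast
  next
    case (step S)
    show ?case
    proof (intro ballI impI)
      fix x assume x: "x \<in> descent f a" "f S \<subset> x"
      have "x \<subseteq> f S \<or> S \<subseteq> x"
        using descent_extreme[OF f _ step(1) x(1)] step(2) by blast
      then show "f S \<subseteq> f x" using x f[of S] step(2) by blast
    qed
  next
    case (lim C)
    show ?case
    proof (intro ballI impI)
      fix x assume x: "x \<in> descent f a" "\<Inter>C \<subset> x"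
      then obtain d where d: "d \<in> C" "\<not> x \<subseteq> d" by blast
      have "x \<subseteq> f d \<or> d \<subseteq> x"
        using descent_extreme[OF f _ lim(1)[OF d(1)] x(1)] lim.IH[OF d(1)] by blast
      then have "d \<subset> x" using f[of d] d by blast
      then show "\<Inter>C \<subseteq> f x" using lim.IH[OF d(1)] x(1) d(1) by blast
    qed
  qed
  then show ?thesis using descent_extreme[OF f _ c x] by blast
qed

lemma descent_chain:
  assumes f: "\<And>S. f S \<subseteq> S"
  shows "Complete_Partial_Order.chain (\<subseteq>) (descent f a)"
  unfolding chain_def using descent_compare[OF f] f by blast

lemma descent_Inter:
  assumes f: "\<And>S. f S \<subseteq> S" and "C \<subseteq> descent f a" "C \<noteq> {}"
  shows "\<Inter>C \<in> descent f a"
proof (rule descent.lim)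
  show "S \<in> descent f a" if "S \<in> C" for S using that assms(2) by blast
  show "Complete_Partial_Order.chain (\<subseteq>) C"
    using chain_subset[OF descent_chain[of f a, OF f] assms(2)] .
qed fact

lemma descent_fixpoint:
  assumes f: "\<And>S. f S \<subseteq> S"
  shows "\<Inter>(descent f a) \<in> descent f a" "f (\<Inter>(descent f a)) = \<Inter>(descent f a)"
proof -
  show *: "\<Inter>(descent f a) \<in> descent f a"
    by (rule descent_Inter[OF f]) (use descent.base in auto)
  show "f (\<Inter>(descent f a)) = \<Inter>(descent f a)"
    using descent.step[OF *] f by blast
qed

text \<open>Brings the derived series under the general results on descents, which serve again for
  the tower of quotient relations.\<close>

lemma F_seq_eq_descent: "F_seq I FF = descent (derived I) FF"
proof
  show "F_seq I FF \<subseteq> descent (derived I) FF"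
  proof
    fix H assume "H \<in> F_seq I FF"
    then show "H \<in> descent (derived I) FF"
      by induction (auto intro: descent.intros)
  qed
  show "descent (derived I) FF \<subseteq> F_seq I FF"
  proof
    fix H assume "H \<in> descent (derived I) FF"
    then show "H \<in> F_seq I FF"
      by induction (auto intro: F_seq.intros)
  qed
qed

section \<open>Ultrafilters and limits along them\<close>

text \<open>Zorn's lemma on the proper filters below \<open>F\<close>. A chain is bounded by its
  infimum, which is proper because an event of the infimum of a directed family already holds in one
  member.\<close>

lemma ex_ultrafilter_le:
  assumes "F \<noteq> bot"
  shows "\<exists>U\<le>F. is_ultrafilter U"
proof -
  let ?A = "{G. G \<noteq> bot \<and> G \<le> F}"
  have "\<exists>m\<in>?A. \<forall>a\<in>?A. (\<lambda>x y. y \<le> x) m a \<longrightarrow> a = m"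
  proof (rule predicate_Zorn)
    show "partial_order_on ?A (relation_of (\<lambda>x y. y \<le> x) ?A)"
      by (rule partial_order_on_relation_ofI) auto
    fix C assume C: "C \<in> Chains (relation_of (\<lambda>x y. y \<le> x) ?A)"
    then have sub: "C \<subseteq> ?A" and ch: "\<And>x y. x \<in> C \<Longrightarrow> y \<in> C \<Longrightarrow> x \<le> y \<or> y \<le> x"
      by (auto simp: Chains_def relation_of_def)
    show "\<exists>u\<in>?A. \<forall>a\<in>C. u \<le> a"
    proof (cases "C = {}")
      case True
      then show ?thesis using assms by auto
    next
      case False
      have "Inf C \<noteq> bot"
      proof
        assume "Inf C = bot"
        then have "eventually (\<lambda>_. False) (Inf C)" by simp
        moreover have "\<exists>G\<in>C. G \<le> inf x y" if "x \<in> C" "y \<in> C" for x y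
          using ch[OF that] that by auto
        ultimately obtain G where "G \<in> C" "eventually (\<lambda>_. False) G"
          using eventually_Inf_base[OF False] by blast
        then show False using sub by (auto simp: trivial_limit_def)
      qed
      moreover have "Inf C \<le> F"
      proof -
        obtain c where "c \<in> C" using False by blast
        then show ?thesis using sub Inf_lower[of c C] by (auto intro: order_trans)
      qed
      ultimately show ?thesis by (intro bexI[of _ "Inf C"]) (auto intro: Inf_lower)
    qed
  qed
  then obtain U where "U \<in> ?A" and max': "\<forall>a\<in>?A. a \<le> U \<longrightarrow> a = U" by (elim bexE)
  then have U: "U \<noteq> bot" "U \<le> F" by auto
  have max: "G = U" if "G \<noteq> bot" "G \<le> U" for G
    using max' that order_trans[OF that(2) U(2)] by simp
  have "eventually (\<lambda>t. t \<in> A) U \<or> eventually (\<lambda>t. t \<notin> A) U" for A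
  proof (rule disjCI)
    assume "\<not> eventually (\<lambda>t. t \<notin> A) U"
    then have "inf U (principal A) \<noteq> bot"
      by (simp add: trivial_limit_def eventually_inf_principal)
    then have "inf U (principal A) = U" by (rule max) simp
    moreover have "eventually (\<lambda>t. t \<in> A) (inf U (principal A))"
      by (simp add: eventually_inf_principal)
    ultimately show "eventually (\<lambda>t. t \<in> A) U" by simp
  qed
  then show ?thesis using U by (auto simp: is_ultrafilter_def)
qed

lemma ultrafilter_neq_bot: "is_ultrafilter p \<Longrightarrow> p \<noteq> bot"
  by (simp add: is_ultrafilter_def)

lemma ultrafilter_not_eventually:
  assumes "is_ultrafilter p"
  shows "\<not> eventually P p \<longleftrightarrow> eventually (\<lambda>x. \<not> P x) p"
proof -
  have "eventually (\<lambda>t. t \<in> Collect P) p \<or> eventually (\<lambda>t. t \<notin> Collect P) p"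
    using assms unfolding is_ultrafilter_def by blast
  moreover have False if "eventually P p" "eventually (\<lambda>x. \<not> P x) p"
    using eventually_conj[OF that] ultrafilter_neq_bot[OF assms] by (simp add: trivial_limit_def)
  ultimately show ?thesis by (simp only: mem_Collect_eq) blast
qed

lemma ultrafilter_eqI:
  assumes "is_ultrafilter p" "is_ultrafilter q" "\<And>P. eventually P p \<Longrightarrow> eventually P q"
  shows "p = q"
proof (rule filter_eqI[rule_format])
  fix P
  show "eventually P p = eventually P q"
    using assms(3)[of P] assms(3)[of "\<lambda>x. \<not> P x"] ultrafilter_not_eventually[OF assms(1), of P]
      ultrafilter_not_eventually[OF assms(2), of P] by blast
qed

text \<open>When \<open>F\<close> and the \<open>f i\<close> are ultrafilters this is the limit of
  \<open>f\<close> along \<open>F\<close> in \<open>betaT\<close>. The semigroup product is the case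
  of the family \<open>betaT_act s q\<close> along \<open>p\<close>.\<close>

definition ulim :: "'i filter \<Rightarrow> ('i \<Rightarrow> 'a filter) \<Rightarrow> 'a filter" where
  "ulim F f = Abs_filter (\<lambda>P. eventually (\<lambda>i. eventually P (f i)) F)"

lemma eventually_ulim: "eventually P (ulim F f) \<longleftrightarrow> eventually (\<lambda>i. eventually P (f i)) F"
proof -
  have "is_filter (\<lambda>P. eventually (\<lambda>i. eventually P (f i)) F)"
  proof
    fix P Q :: "'a \<Rightarrow> bool"
    assume PQ: "\<forall>x. P x \<longrightarrow> Q x" and "eventually (\<lambda>i. eventually P (f i)) F"
    from this(2) show "eventually (\<lambda>i. eventually Q (f i)) F"
    proof eventually_elim
      case (elim i)
      then show ?case by (rule eventually_mono) (use PQ in blast)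
    qed
  qed (simp_all add: eventually_conj_iff)
  then show ?thesis unfolding ulim_def by (rule eventually_Abs_filter)
qed

lemma ulim_cong: "eventually (\<lambda>i. f i = g i) F \<Longrightarrow> ulim F f = ulim F g"
  by (rule filter_eqI[rule_format]) (auto simp: eventually_ulim elim: eventually_elim2)

lemma is_ultrafilter_ulim:
  assumes F: "is_ultrafilter F" and f: "eventually (\<lambda>i. is_ultrafilter (f i)) F"
  shows "is_ultrafilter (ulim F f)"
proof -
  have "ulim F f \<noteq> bot"
  proof
    assume "ulim F f = bot"
    then have "eventually (\<lambda>i. eventually (\<lambda>_. False) (f i)) F"
      using eventually_ulim[of "\<lambda>_. False" F f] by simp
    then have "eventually (\<lambda>i. False) F"
      using f by eventually_elim (simp add: is_ultrafilter_def trivial_limit_def)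
    then show False using F by (simp add: is_ultrafilter_def trivial_limit_def)
  qed
  moreover have "eventually (\<lambda>t. t \<in> A) (ulim F f) \<or> eventually (\<lambda>t. t \<notin> A) (ulim F f)" for A
  proof (rule disjCI)
    assume "\<not> eventually (\<lambda>t. t \<notin> A) (ulim F f)"
    then have "eventually (\<lambda>i. \<not> eventually (\<lambda>t. t \<notin> A) (f i)) F"
      by (simp add: eventually_ulim ultrafilter_not_eventually[OF F])
    then show "eventually (\<lambda>t. t \<in> A) (ulim F f)"
      unfolding eventually_ulim using f
      by eventually_elim (auto simp: ultrafilter_not_eventually)
  qed
  ultimately show ?thesis by (simp add: is_ultrafilter_def)
qed

section \<open>The semigroup of ultrafilters\<close>

lemma betaT_mult_eq_ulim: "betaT_mult p q = ulim p (\<lambda>s. betaT_act s q)"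
  by (simp add: betaT_mult_def ulim_def betaT_act_def eventually_filtermap)

lemma eventually_betaT_act: "eventually P (betaT_act t p) \<longleftrightarrow> eventually (\<lambda>s. P (t + s)) p"
  by (simp add: betaT_act_def eventually_filtermap)

lemma eventually_betaT_mult:
  "eventually P (betaT_mult p q) \<longleftrightarrow> eventually (\<lambda>s. eventually (\<lambda>t. P (s + t)) q) p"
  by (simp add: betaT_mult_eq_ulim eventually_ulim eventually_betaT_act)

lemma betaT_mult_assoc: "betaT_mult (betaT_mult p q) r = betaT_mult p (betaT_mult q r)"
  by (rule filter_eqI[rule_format]) (simp add: eventually_betaT_mult add.assoc)

lemma betaT_act_mult: "betaT_act t (betaT_mult p q) = betaT_mult (betaT_act t p) q"
  by (rule filter_eqI[rule_format]) (simp add: eventually_betaT_mult eventually_betaT_act add.assoc)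

lemma betaT_act_zero [simp]: "betaT_act 0 p = p"
  by (rule filter_eqI[rule_format]) (simp add: eventually_betaT_act)

lemma betaT_act_add: "betaT_act (s + t) p = betaT_act s (betaT_act t p)"
  by (rule filter_eqI[rule_format]) (simp add: eventually_betaT_act add.assoc)

lemma ulim_mult: "ulim F (\<lambda>i. betaT_mult (f i) q) = betaT_mult (ulim F f) q"
  by (rule filter_eqI[rule_format]) (simp add: eventually_betaT_mult eventually_ulim)

lemma betaT_act_in [intro, simp]: "p \<in> betaT \<Longrightarrow> betaT_act t p \<in> betaT"
proof -
  assume p: "p \<in> betaT"
  have "(eventually (\<lambda>x. x \<in> A) (betaT_act t p) \<or> eventually (\<lambda>x. x \<notin> A) (betaT_act t p))" for A
    using ultrafilter_not_eventually[of p "\<lambda>s. t + s \<notin> A"] p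
    by (auto simp: betaT_def eventually_betaT_act)
  moreover have "betaT_act t p \<noteq> bot"
    using p by (auto simp: betaT_def is_ultrafilter_def trivial_limit_def eventually_betaT_act)
  ultimately show ?thesis by (simp add: betaT_def is_ultrafilter_def)
qed

lemma ulim_in_betaT:
  "is_ultrafilter F \<Longrightarrow> eventually (\<lambda>i. f i \<in> betaT) F \<Longrightarrow> ulim F f \<in> betaT"
  using is_ultrafilter_ulim[of F f] by (simp add: betaT_def)

lemma betaT_mult_in [intro, simp]:
  assumes "p \<in> betaT" "q \<in> betaT"
  shows "betaT_mult p q \<in> betaT"
  unfolding betaT_mult_eq_ulim
proof (rule ulim_in_betaT)
  show "is_ultrafilter p" using assms by (simp add: betaT_def)
  show "eventually (\<lambda>i. betaT_act i q \<in> betaT) p"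
    using betaT_act_in[OF assms(2)] by (intro always_eventually) blast
qed

definition principal_uf :: "'g \<Rightarrow> 'g filter" where
  "principal_uf t = principal {t}"

lemma eventually_principal_uf [simp]: "eventually P (principal_uf t) \<longleftrightarrow> P t"
  by (simp add: principal_uf_def eventually_principal)

lemma principal_uf_in [simp]: "principal_uf t \<in> betaT"
  by (auto simp: betaT_def is_ultrafilter_def trivial_limit_def)

lemma betaT_mult_principal: "betaT_mult (principal_uf t) q = betaT_act t q"
  by (rule filter_eqI[rule_format]) (simp add: eventually_betaT_mult eventually_betaT_act)

lemma openin_betaT_basic: "openin betaT_top {p \<in> betaT. eventually (\<lambda>t. t \<in> A) p}"
  unfolding betaT_top_def betaT_def by (rule topology_generated_by_Basis) auto

text \<open>The generating sets are closed under binary intersection, so they form a base and not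
  merely a subbase.\<close>

lemma openin_betaT_iff:
  "openin betaT_top W \<longleftrightarrow> W \<subseteq> betaT \<and>
     (\<forall>p\<in>W. \<exists>A. eventually (\<lambda>t. t \<in> A) p \<and> {q \<in> betaT. eventually (\<lambda>t. t \<in> A) q} \<subseteq> W)"
    (is "?L \<longleftrightarrow> ?R")
proof
  assume ?L
  then have "generate_topology_on {{p. is_ultrafilter p \<and> eventually (\<lambda>t. t \<in> A) p} | A. True} W"
    by (simp add: betaT_top_def openin_topology_generated_by_iff)
  then show ?R
  proof induction
    case Empty
    then show ?case by simp
  next
    case (Int a b)
    show ?case
    proof (intro conjI ballI)
      show "a \<inter> b \<subseteq> betaT" using Int by blast
      fix p assume p: "p \<in> a \<inter> b"
      then have pab: "p \<in> a" "p \<in> b" by auto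
      from bspec[OF conjunct2[OF Int.IH(1)] pab(1)] obtain A
        where A: "eventually (\<lambda>t. t \<in> A) p" "{q \<in> betaT. eventually (\<lambda>t. t \<in> A) q} \<subseteq> a" by (elim exE conjE)
      from bspec[OF conjunct2[OF Int.IH(2)] pab(2)] obtain B
        where B: "eventually (\<lambda>t. t \<in> B) p" "{q \<in> betaT. eventually (\<lambda>t. t \<in> B) q} \<subseteq> b" by (elim exE conjE)
      have "eventually (\<lambda>t. t \<in> A \<inter> B) p" using A(1) B(1) by (simp add: eventually_conj_iff)
      moreover have "{q \<in> betaT. eventually (\<lambda>t. t \<in> A \<inter> B) q} \<subseteq> a \<inter> b"
        using A(2) B(2) by (auto simp: eventually_conj_iff)
      ultimately show "\<exists>A. eventually (\<lambda>t. t \<in> A) p \<and> {q \<in> betaT. eventually (\<lambda>t. t \<in> A) q} \<subseteq> a \<inter> b"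
        by blast
    qed
  next
    case (UN K)
    show ?case
    proof (intro conjI ballI)
      show "\<Union>K \<subseteq> betaT" using UN by blast
      fix p assume "p \<in> \<Union>K"
      then obtain k where k: "k \<in> K" "p \<in> k" by blast
      from bspec[OF conjunct2[OF UN.IH[OF k(1)]] k(2)]
      show "\<exists>A. eventually (\<lambda>t. t \<in> A) p \<and> {q \<in> betaT. eventually (\<lambda>t. t \<in> A) q} \<subseteq> \<Union>K"
        using k(1) by blast
    qed
  next
    case (Basis s)
    then show ?case by (auto simp: betaT_def)
  qed
next
  assume R: ?R
  define AA where "AA = {A. {q \<in> betaT. eventually (\<lambda>t. t \<in> A) q} \<subseteq> W}"
  have "W = (\<Union>A\<in>AA. {q \<in> betaT. eventually (\<lambda>t. t \<in> A) q})"
  proof (intro equalityI subsetI)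
    fix p assume "p \<in> W"
    with R show "p \<in> (\<Union>A\<in>AA. {q \<in> betaT. eventually (\<lambda>t. t \<in> A) q})"
      unfolding AA_def by blast
  qed (auto simp: AA_def)
  moreover have "openin betaT_top (\<Union>A\<in>AA. {q \<in> betaT. eventually (\<lambda>t. t \<in> A) q})"
    using openin_betaT_basic by blast
  ultimately show ?L by simp
qed

lemma topspace_betaT [simp]: "topspace betaT_top = betaT"
proof
  show "topspace betaT_top \<subseteq> betaT"
    using openin_betaT_iff openin_topspace by blast
  have "openin betaT_top betaT" by (subst openin_betaT_iff) (auto intro: exI[of _ UNIV])
  then show "betaT \<subseteq> topspace betaT_top" by (rule openin_subset)
qed

lemma limitin_betaT_iff:
  assumes "eventually (\<lambda>i. f i \<in> betaT) F"
  shows "limitin betaT_top f l F \<longleftrightarrow>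
    l \<in> betaT \<and> (\<forall>A. eventually (\<lambda>t. t \<in> A) l \<longrightarrow> eventually (\<lambda>i. eventually (\<lambda>t. t \<in> A) (f i)) F)"
    (is "?L \<longleftrightarrow> ?R")
proof
  assume ?L
  then have l: "l \<in> betaT" and lim: "\<And>U. openin betaT_top U \<Longrightarrow> l \<in> U \<Longrightarrow> eventually (\<lambda>x. f x \<in> U) F"
    by (auto simp: limitin_def)
  show ?R
  proof (intro conjI l allI impI)
    fix A assume "eventually (\<lambda>t. t \<in> A) l"
    then have "eventually (\<lambda>x. f x \<in> {q \<in> betaT. eventually (\<lambda>t. t \<in> A) q}) F"
      using l by (intro lim openin_betaT_basic) auto
    then show "eventually (\<lambda>i. eventually (\<lambda>t. t \<in> A) (f i)) F"
      by eventually_elim auto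
  qed
next
  assume R: ?R
  show ?L
    unfolding limitin_def
  proof (intro conjI allI impI)
    show "l \<in> topspace betaT_top" using R by simp
    fix U assume "openin betaT_top U \<and> l \<in> U"
    then obtain A where A: "eventually (\<lambda>t. t \<in> A) l" "{q \<in> betaT. eventually (\<lambda>t. t \<in> A) q} \<subseteq> U"
      by (auto simp: openin_betaT_iff)
    then have "eventually (\<lambda>i. eventually (\<lambda>t. t \<in> A) (f i)) F" using R by blast
    then show "eventually (\<lambda>x. f x \<in> U) F"
      using assms by eventually_elim (use A in auto)
  qed
qed

lemma limitin_ulim:
  assumes "is_ultrafilter F" "eventually (\<lambda>i. f i \<in> betaT) F"
  shows "limitin betaT_top f (ulim F f) F"
  using assms by (simp add: limitin_betaT_iff ulim_in_betaT eventually_ulim)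

lemma Hausdorff_betaT: "Hausdorff_space betaT_top"
  unfolding Hausdorff_space_def topspace_betaT
proof (intro allI impI)
  fix p q :: "'a filter" assume pq: "p \<in> betaT \<and> q \<in> betaT \<and> p \<noteq> q"
  then obtain P where P: "eventually P p" "\<not> eventually P q"
    using ultrafilter_eqI[of p q] by (auto simp: betaT_def)
  have nq: "eventually (\<lambda>x. \<not> P x) q"
    using P pq ultrafilter_not_eventually[of q P] by (auto simp: betaT_def)
  have "disjnt {p \<in> betaT. eventually (\<lambda>t. t \<in> Collect P) p} {p \<in> betaT. eventually (\<lambda>t. t \<in> - Collect P) p}"
    unfolding disjnt_iff
  proof (intro allI notI)
    fix r assume "r \<in> {p \<in> betaT. eventually (\<lambda>t. t \<in> Collect P) p} \<and>
      r \<in> {p \<in> betaT. eventually (\<lambda>t. t \<in> - Collect P) p}"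
    then have "is_ultrafilter r" "eventually P r" "eventually (\<lambda>t. \<not> P t) r" by (auto simp: betaT_def)
    then show False using ultrafilter_not_eventually[of r P] by blast
  qed
  moreover have "p \<in> {p \<in> betaT. eventually (\<lambda>t. t \<in> Collect P) p}"
    "q \<in> {p \<in> betaT. eventually (\<lambda>t. t \<in> - Collect P) p}"
    using P nq pq by auto
  ultimately show "\<exists>U V. openin betaT_top U \<and> openin betaT_top V \<and> p \<in> U \<and> q \<in> V \<and> disjnt U V"
    using openin_betaT_basic by blast
qed

section \<open>Compactness through ultrafilters\<close>

text \<open>Without a finite subcover the complements of the covering sets generate a proper filter.
  An ultrafilter below it cannot converge: a limit would lie in a covering set whose complement the
  ultrafilter contains.\<close>

lemma compact_space_ultrafilterI:
  assumes conv: "\<And>F. is_ultrafilter F \<Longrightarrow> eventually (\<lambda>x. x \<in> topspace X) F \<Longrightarrow> \<exists>l. limitin X id l F"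
  shows "compact_space X"
  unfolding compact_space_alt
proof (intro allI impI)
  fix \<U> assume "(\<forall>U\<in>\<U>. openin X U) \<and> topspace X \<subseteq> \<Union> \<U>"
  then have op: "\<And>U. U \<in> \<U> \<Longrightarrow> openin X U" and cov: "topspace X \<subseteq> \<Union> \<U>" by auto
  show "\<exists>\<F>. finite \<F> \<and> \<F> \<subseteq> \<U> \<and> topspace X \<subseteq> \<Union> \<F>"
  proof (rule ccontr)
    assume no: "\<not> ?thesis"
    define F where "F = (INF U\<in>\<U>. principal (topspace X - U))"
    have ev: "eventually (\<lambda>x. x \<in> topspace X - U) F" if "U \<in> \<U>" for U
      unfolding F_def using that by (intro eventually_INF1[of U]) (auto simp: eventually_principal)
    have "\<U> \<noteq> {}" using no cov by (metis empty_subsetI finite.emptyI)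
    have "F \<noteq> bot"
    proof
      assume "F = bot"
      then have "eventually (\<lambda>_. False) F" by simp
      then have "\<exists>\<F>\<subseteq>\<U>. finite \<F> \<and> eventually (\<lambda>_. False) (INF U\<in>\<F>. principal (topspace X - U))"
        unfolding F_def by (rule eventually_INF[THEN iffD1])
      then obtain \<F> where \<F>: "\<F> \<subseteq> \<U>" "finite \<F>" and
        e: "eventually (\<lambda>_. False) (INF U\<in>\<F>. principal (topspace X - U))" by (elim exE conjE)
      have "(INF U\<in>\<F>. principal (topspace X - U)) = principal (\<Inter>U\<in>\<F>. topspace X - U)"
        using \<F>(2) by (rule INF_principal_finite)
      with e have "eventually (\<lambda>_. False) (principal (\<Inter>U\<in>\<F>. topspace X - U))" by (simp only:)
      then have "(\<Inter>U\<in>\<F>. topspace X - U) = {}"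
        unfolding eventually_principal by blast
      then have "topspace X \<subseteq> \<Union>\<F>" by blast
      then show False using no \<F> by blast
    qed
    then obtain U where U: "U \<le> F" "is_ultrafilter U" using ex_ultrafilter_le by blast
    obtain V0 where "V0 \<in> \<U>" using \<open>\<U> \<noteq> {}\<close> by auto
    then have "eventually (\<lambda>x. x \<in> topspace X) U"
      using filter_leD[OF U(1) ev] by (simp add: eventually_conj_iff)
    then obtain l where l: "limitin X id l U" using conv U by blast
    then have "l \<in> topspace X" by (simp add: limitin_def)
    then obtain V where V: "V \<in> \<U>" "l \<in> V" using cov by auto
    have "eventually (\<lambda>x. x \<in> V) U" using l V op by (auto simp: limitin_def)
    moreover have "eventually (\<lambda>x. x \<in> topspace X - V) U" using filter_leD[OF U(1) ev] V by auto
    ultimately have "eventually (\<lambda>x. False) U" by eventually_elim auto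
    then show False using U by (simp add: is_ultrafilter_def trivial_limit_def)
  qed
qed

text \<open>Ultrafilters take the place of nets because any auxiliary family in \<open>I\<close>
  then converges along them without passing to a subnet.\<close>

lemma ex_ultrafilter_closure_of:
  assumes "z \<in> X closure_of S"
  shows "\<exists>F. is_ultrafilter F \<and> eventually (\<lambda>x. x \<in> S) F \<and> limitin X id z F"
proof -
  have z: "z \<in> topspace X" and *: "\<And>U. openin X U \<Longrightarrow> z \<in> U \<Longrightarrow> \<exists>y\<in>S. y \<in> U"
    using assms by (auto simp: in_closure_of)
  have "inf (nhdsin X z) (principal S) \<noteq> bot"
    unfolding trivial_limit_def eventually_inf_principal eventually_nhdsin using z * by blast
  then obtain F where F: "F \<le> inf (nhdsin X z) (principal S)" "is_ultrafilter F"
    using ex_ultrafilter_le by blast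
  have "eventually (\<lambda>x. x \<in> S) F"
    by (rule filter_leD[OF F(1)]) (simp add: eventually_inf_principal)
  moreover have "limitin X id z F"
    unfolding limitin_def
  proof (intro conjI z allI impI)
    fix U assume "openin X U \<and> z \<in> U"
    then have "eventually (\<lambda>x. x \<in> U) (nhdsin X z)" by (auto simp: eventually_nhdsin)
    then show "eventually (\<lambda>x. id x \<in> U) F"
      using F by (auto intro: filter_leD simp: eventually_inf_principal elim: eventually_mono)
  qed
  ultimately show ?thesis using F by blast
qed

section \<open>A minimal left ideal and its automorphisms\<close>

lemma chain_Inter_nonempty:
  assumes "compact_space X" and ne: "C \<noteq> {}" and chain: "\<And>S T. S \<in> C \<Longrightarrow> T \<in> C \<Longrightarrow> S \<subseteq> T \<or> T \<subseteq> S"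
    and C: "\<And>S. S \<in> C \<Longrightarrow> closedin X S \<and> S \<noteq> {}"
  shows "\<Inter>C \<noteq> {}"
proof -
  have fin: "\<Inter>\<F> \<in> C" if "finite \<F>" "\<F> \<noteq> {}" "\<F> \<subseteq> C" for \<F>
    using that
  proof (induction \<F> rule: finite_ne_induct)
    case (singleton x)
    then show ?case by simp
  next
    case (insert x F)
    then have "x \<in> C" "\<Inter>F \<in> C" by auto
    then have "x \<inter> \<Inter>F = x \<or> x \<inter> \<Inter>F = \<Inter>F" using chain by blast
    then show ?case using \<open>x \<in> C\<close> \<open>\<Inter>F \<in> C\<close> by auto
  qed
  have "\<Inter>\<F> \<noteq> {}" if "finite \<F>" "\<F> \<subseteq> C" for \<F>
  proof (cases "\<F> = {}")
    case False
    show ?thesis using fin[OF that(1) False that(2)] C by blast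
  qed simp
  then show ?thesis
    using assms(1)[unfolded compact_space_fip, rule_format, of C] C by simp
qed

locale minimal_ideal =
  fixes I :: "'g::group_add filter set"
  assumes minI: "is_minimal_left_ideal I"
begin

abbreviation mul (infixl "\<odot>" 70) where "p \<odot> q \<equiv> betaT_mult p q"
abbreviation act where "act \<equiv> betaT_act"
abbreviation K where "K \<equiv> subtopology betaT_top I"
abbreviation K2 where "K2 \<equiv> prod_topology K K"

lemma I_sub: "p \<in> I \<Longrightarrow> p \<in> betaT"
  using minI by (auto simp: is_minimal_left_ideal_def is_left_ideal_def)

lemma I_nonempty: "I \<noteq> {}"
  using minI by (simp add: is_minimal_left_ideal_def)

lemma mul_I [intro, simp]: "p \<in> betaT \<Longrightarrow> q \<in> I \<Longrightarrow> p \<odot> q \<in> I"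
  using minI by (simp add: is_minimal_left_ideal_def is_left_ideal_def)

lemma mul_I' [intro, simp]: "p \<in> I \<Longrightarrow> q \<in> I \<Longrightarrow> p \<odot> q \<in> I"
  using I_sub by blast

lemma act_I [intro, simp]: "q \<in> I \<Longrightarrow> act t q \<in> I"
  by (metis betaT_mult_principal mul_I principal_uf_in)

text \<open>\<open>I \<odot> q\<close> is itself a left ideal inside \<open>I\<close>, so minimality
  applies. This is the algebraic form of the minimality of the flow \<open>I\<close>: every point is
  a left multiple of every other.\<close>

lemma ideal_mul_eq:
  assumes "q \<in> I"
  shows "(\<lambda>p. p \<odot> q) ` I = I"
proof -
  have "is_left_ideal ((\<lambda>p. p \<odot> q) ` I)"
    unfolding is_left_ideal_def
  proof (intro conjI ballI)
    show "(\<lambda>p. p \<odot> q) ` I \<subseteq> betaT" using assms I_sub by auto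
    fix p r :: "'g filter" assume "p \<in> betaT" "r \<in> (\<lambda>p. p \<odot> q) ` I"
    then obtain s where s: "s \<in> I" "r = s \<odot> q" by auto
    have "p \<odot> r = (p \<odot> s) \<odot> q" by (simp add: s betaT_mult_assoc)
    then show "p \<odot> r \<in> (\<lambda>p. p \<odot> q) ` I" using \<open>p \<in> betaT\<close> s(1) by blast
  qed
  then have "(\<lambda>p. p \<odot> q) ` I \<noteq> {} \<and> is_left_ideal ((\<lambda>p. p \<odot> q) ` I) \<and> (\<lambda>p. p \<odot> q) ` I \<subseteq> I"
    using assms I_nonempty by auto
  then show ?thesis by (rule minI[unfolded is_minimal_left_ideal_def, THEN conjunct2, THEN conjunct2, rule_format])
qed

lemma ex_left_factor: "p \<in> I \<Longrightarrow> q \<in> I \<Longrightarrow> \<exists>r\<in>I. p = r \<odot> q"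
  using ideal_mul_eq[of q] by blast

text \<open>Write \<open>f i = g i \<odot> q\<close> with one fixed \<open>q \<in> I\<close>. Right
  multiplication commutes with limits, so the limit is a left multiple of \<open>q\<close>. This is
  the source of the compactness of \<open>I\<close>.\<close>

lemma ulim_I:
  assumes F: "is_ultrafilter F" and f: "eventually (\<lambda>i. f i \<in> I) F"
  shows "ulim F f \<in> I"
proof -
  obtain q where q: "q \<in> I" using I_nonempty by auto
  define g where "g i = (SOME r. r \<in> I \<and> f i = r \<odot> q)" for i
  have g: "g i \<in> I \<and> f i = g i \<odot> q" if "f i \<in> I" for i
    unfolding g_def by (rule someI_ex) (use ex_left_factor[OF that q] in blast)
  have "eventually (\<lambda>i. f i = g i \<odot> q) F" "eventually (\<lambda>i. g i \<in> betaT) F"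
    using f by (eventually_elim, use g I_sub in blast)+
  then have "ulim F f = ulim F g \<odot> q" "ulim F g \<in> betaT"
    using ulim_cong[of f "\<lambda>i. g i \<odot> q" F] ulim_mult[of F g q] ulim_in_betaT[OF F] by auto
  then show ?thesis using q by simp
qed

lemma betaT_Int_I [simp]: "betaT \<inter> I = I"
  using I_sub by auto

lemma topspace_K [simp]: "topspace K = I"
  using I_sub by auto

lemma topspace_K2 [simp]: "topspace K2 = I \<times> I"
  by simp

lemma eventually_betaT: "eventually (\<lambda>i. f i \<in> I) F \<Longrightarrow> eventually (\<lambda>i. f i \<in> betaT) F"
  by (erule eventually_mono) (rule I_sub)

lemma limitin_K:
  assumes F: "is_ultrafilter F" and f: "eventually (\<lambda>i. f i \<in> I) F"
  shows "limitin K f (ulim F f) F"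
  by (simp add: limitin_subtopology f ulim_I[OF assms] limitin_ulim[OF F eventually_betaT[OF f]])

lemma compact_K: "compact_space K"
proof (rule compact_space_ultrafilterI)
  fix F :: "'g filter filter" assume "is_ultrafilter F" "eventually (\<lambda>x. x \<in> topspace K) F"
  then show "\<exists>l. limitin K id l F"
    using limitin_K[of F id] by (auto intro: exI[of _ "ulim F id"])
qed

lemma Hausdorff_K: "Hausdorff_space K"
  by (simp add: Hausdorff_betaT Hausdorff_space_subtopology)

lemma compact_K2: "compact_space K2" and Hausdorff_K2: "Hausdorff_space K2"
  by (simp_all add: compact_space_prod_topology compact_K Hausdorff_space_prod_topology Hausdorff_K)

lemma continuous_K:
  assumes "\<And>p. p \<in> I \<Longrightarrow> f p \<in> I"
    and B: "\<And>A. \<exists>B. \<forall>p\<in>I. eventually (\<lambda>t. t \<in> A) (f p) \<longleftrightarrow> eventually (\<lambda>t. t \<in> B) p"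
  shows "continuous_map K K f"
proof -
  have op: "openin K {p \<in> I. eventually (\<lambda>t. t \<in> A) p}" for A :: "'g set"
  proof -
    have "{p \<in> I. eventually (\<lambda>t. t \<in> A) p} = {p \<in> betaT. eventually (\<lambda>t. t \<in> A) p} \<inter> I"
      using I_sub by auto
    then show ?thesis using openin_betaT_basic[of A] by (auto simp: openin_subtopology)
  qed
  have "continuous_map K (topology_generated_by {{p. is_ultrafilter p \<and> eventually (\<lambda>t. t \<in> A) p} |A. True}) f"
  proof (rule continuous_on_generated_topo)
    fix U :: "'g filter set" assume "U \<in> {{p. is_ultrafilter p \<and> eventually (\<lambda>t. t \<in> A) p} |A. True}"
    then obtain A where U: "U = {p. is_ultrafilter p \<and> eventually (\<lambda>t. t \<in> A) p}" by auto
    obtain B where "\<forall>p\<in>I. eventually (\<lambda>t. t \<in> A) (f p) \<longleftrightarrow> eventually (\<lambda>t. t \<in> B) p"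
      using assms(2)[of A] by auto
    then have "f -` U \<inter> topspace K = {p \<in> I. eventually (\<lambda>t. t \<in> B) p}"
      using assms(1) I_sub by (auto simp: U betaT_def)
    then show "openin K (f -` U \<inter> topspace K)" using op by (simp add: topspace_subtopology)
  next
    have "f ` I \<subseteq> betaT" using assms(1) I_sub by auto
    then show "f ` topspace K \<subseteq> \<Union>{{p. is_ultrafilter p \<and> eventually (\<lambda>t. t \<in> A) p} |A. True}"
      unfolding topspace_betaT[unfolded betaT_top_def topology_generated_by_topspace] topspace_K .
  qed
  then have "continuous_map K betaT_top f" by (simp only: betaT_top_def[symmetric])
  then show ?thesis using assms(1) by (simp add: continuous_map_in_subtopology image_subset_iff)
qed

lemma continuous_act: "continuous_map K K (act t)"
proof (rule continuous_K)
  fix A :: "'g set"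
  have "eventually (\<lambda>s. s \<in> A) (act t p) \<longleftrightarrow> eventually (\<lambda>s. s \<in> {s. t + s \<in> A}) p" for p
    by (simp add: eventually_betaT_act)
  then show "\<exists>B. \<forall>p\<in>I. eventually (\<lambda>s. s \<in> A) (act t p) \<longleftrightarrow> eventually (\<lambda>s. s \<in> B) p" by blast
qed simp

lemma continuous_rmul:
  assumes "g \<in> I"
  shows "continuous_map K K (\<lambda>p. p \<odot> g)"
proof (rule continuous_K)
  fix A :: "'g set"
  have "eventually (\<lambda>s. s \<in> A) (p \<odot> g) \<longleftrightarrow> eventually (\<lambda>s. s \<in> {s. eventually (\<lambda>t. s + t \<in> A) g}) p" for p
    by (simp add: eventually_betaT_mult)
  then show "\<exists>B. \<forall>p\<in>I. eventually (\<lambda>s. s \<in> A) (p \<odot> g) \<longleftrightarrow> eventually (\<lambda>s. s \<in> B) p" by blast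
qed (use assms in simp)

lemma limitin_act:
  assumes "p \<in> betaT" "m \<in> I"
  shows "limitin K (\<lambda>t. act t m) (p \<odot> m) p"
proof -
  have "limitin K (\<lambda>t. act t m) (ulim p (\<lambda>t. act t m)) p"
    using assms by (intro limitin_K) (auto simp: betaT_def)
  then show ?thesis by (simp add: betaT_mult_eq_ulim)
qed

lemma closedin_limit:
  assumes "limitin X f l F" "closedin X C" "is_ultrafilter F" "eventually (\<lambda>i. f i \<in> C) F"
  shows "l \<in> C"
  using limitin_closedin[OF assms(1,2,4)] ultrafilter_neq_bot[OF assms(3)] by blast

lemma orbit_dense:
  assumes "m \<in> I" "openin K W" "W \<noteq> {}"
  shows "\<exists>t. act t m \<in> W"
proof -
  obtain x where x: "x \<in> W" using assms by auto
  then have "x \<in> I" using assms(2) openin_subset by fastforce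
  then obtain p where p: "p \<in> I" "x = p \<odot> m" using ex_left_factor assms(1) by blast
  have "limitin K (\<lambda>t. act t m) x p" using limitin_act[OF I_sub] p assms(1) by simp
  then have "eventually (\<lambda>t. act t m \<in> W) p" using assms(2) x by (auto simp: limitin_def)
  then show ?thesis
    using p(1) I_sub[of p] by (auto simp: betaT_def is_ultrafilter_def dest: eventually_happens')
qed

text \<open>The Ellis-Numakura argument. A minimal closed subsemigroup \<open>S\<close> satisfies
  \<open>S \<odot> a = S\<close> for each \<open>a \<in> S\<close>; hence the elements fixing
  \<open>a\<close> from the left form a nonempty closed subsemigroup, which must be all of
  \<open>S\<close> and so contains \<open>a\<close>.\<close>

lemma ex_idempotent: "\<exists>u\<in>I. u \<odot> u = u"
proof -
  define \<S> where "\<S> = {S. S \<noteq> {} \<and> closedin K S \<and> (\<forall>a\<in>S. \<forall>b\<in>S. a \<odot> b \<in> S)}"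
  have "I \<in> \<S>" using I_nonempty closedin_topspace[of K] by (simp add: \<S>_def)
  have "\<exists>m\<in>\<S>. \<forall>a\<in>\<S>. (\<lambda>x y. y \<subseteq> x) m a \<longrightarrow> a = m"
  proof (rule predicate_Zorn)
    show "partial_order_on \<S> (relation_of (\<lambda>x y. y \<subseteq> x) \<S>)"
      by (rule partial_order_on_relation_ofI) auto
    fix C assume C: "C \<in> Chains (relation_of (\<lambda>x y. y \<subseteq> x) \<S>)"
    then have sub: "C \<subseteq> \<S>" and ch: "\<And>x y. x \<in> C \<Longrightarrow> y \<in> C \<Longrightarrow> x \<subseteq> y \<or> y \<subseteq> x"
      by (auto simp: Chains_def relation_of_def)
    show "\<exists>u\<in>\<S>. \<forall>a\<in>C. u \<subseteq> a"
    proof (cases "C = {}")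
      case True
      then show ?thesis using \<open>I \<in> \<S>\<close> by auto
    next
      case False
      have "closedin K S \<and> S \<noteq> {}" if "S \<in> C" for S using sub that by (auto simp: \<S>_def)
      then have "\<Inter>C \<noteq> {}" "closedin K (\<Inter>C)"
        using chain_Inter_nonempty[OF compact_K False ch] closedin_Inter[OF False] by auto
      moreover have "\<forall>a\<in>\<Inter>C. \<forall>b\<in>\<Inter>C. a \<odot> b \<in> \<Inter>C" using sub by (auto simp: \<S>_def)
      ultimately have "\<Inter>C \<in> \<S>" by (simp add: \<S>_def)
      then show ?thesis by (intro bexI[of _ "\<Inter>C"]) auto
    qed
  qed
  then obtain S where "S \<in> \<S>" and min: "\<And>S'. S' \<in> \<S> \<Longrightarrow> S' \<subseteq> S \<Longrightarrow> S' = S" by blast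
  then have S: "S \<noteq> {}" "closedin K S" "\<And>a b. a \<in> S \<Longrightarrow> b \<in> S \<Longrightarrow> a \<odot> b \<in> S"
    by (auto simp: \<S>_def)
  have SI: "S \<subseteq> I" using closedin_subset[OF S(2)] by simp
  obtain a where a: "a \<in> S" using S(1) by auto
  then have aI: "a \<in> I" using SI by auto
  have "closedin K ((\<lambda>p. p \<odot> a) ` S)"
    using continuous_imp_closed_map[OF continuous_rmul[OF aI] compact_K Hausdorff_K] S(2)
    by (simp add: closed_map_def)
  moreover have "b \<odot> c \<in> (\<lambda>p. p \<odot> a) ` S" if bc: "b \<in> (\<lambda>p. p \<odot> a) ` S" "c \<in> (\<lambda>p. p \<odot> a) ` S" for b c
  proof -
    obtain b' c' where "b' \<in> S" "b = b' \<odot> a" "c' \<in> S" "c = c' \<odot> a" using bc by blast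
    then have "b \<odot> c = (b' \<odot> a \<odot> c') \<odot> a" "b' \<odot> a \<odot> c' \<in> S"
      using S(3) a by (simp_all add: betaT_mult_assoc)
    then show ?thesis by blast
  qed
  ultimately have "(\<lambda>p. p \<odot> a) ` S \<in> \<S>" using S(1) by (auto simp: \<S>_def)
  moreover have "(\<lambda>p. p \<odot> a) ` S \<subseteq> S" using S(3) a by auto
  ultimately have Sa: "(\<lambda>p. p \<odot> a) ` S = S" by (rule min)
  define R where "R = {s \<in> S. s \<odot> a = a}"
  have "R = S \<inter> {s \<in> topspace K. s \<odot> a \<in> {a}}" using SI by (auto simp: R_def)
  moreover have "closedin K {s \<in> topspace K. s \<odot> a \<in> {a}}"
    by (rule closedin_continuous_map_preimage[OF continuous_rmul[OF aI]])
      (use closedin_Hausdorff_singleton[OF Hausdorff_K] aI in simp)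
  ultimately have "closedin K R" using S(2) by (simp add: closedin_Int)
  moreover have "R \<noteq> {}" using Sa a by (force simp: R_def)
  moreover have "\<forall>b\<in>R. \<forall>c\<in>R. b \<odot> c \<in> R" using S(3) by (auto simp: R_def betaT_mult_assoc)
  ultimately have "R \<in> \<S>" by (simp add: \<S>_def)
  then have "R = S" by (rule min) (auto simp: R_def)
  then have "a \<odot> a = a" using a by (auto simp: R_def)
  then show ?thesis using aI by blast
qed

definition e where "e = (SOME u. u \<in> I \<and> u \<odot> u = u)"

lemma e_in [simp, intro]: "e \<in> I" and e_idem [simp]: "e \<odot> e = e"
proof -
  have "e \<in> I \<and> e \<odot> e = e"
    unfolding e_def by (rule someI_ex) (use ex_idempotent in blast)
  then show "e \<in> I" "e \<odot> e = e" by auto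
qed

lemma e_betaT [simp, intro]: "e \<in> betaT"
  by (simp add: I_sub)

lemma mul_e [simp]: "p \<in> I \<Longrightarrow> p \<odot> e = p"
  by (metis betaT_mult_assoc e_idem e_in ex_left_factor)

lemma e_e_mul [simp]: "e \<odot> (e \<odot> m) = e \<odot> m"
  by (metis betaT_mult_assoc e_idem)

text \<open>Minimality gives a left inverse \<open>b\<close> of \<open>a\<close>, and a left inverse
  \<open>c\<close> of \<open>b\<close>; associativity forces \<open>c = a\<close>. Thus
  \<open>e \<odot> I\<close> is a group.\<close>

lemma ex_inverse:
  assumes "a \<in> I" "e \<odot> a = a"
  shows "\<exists>b\<in>I. e \<odot> b = b \<and> a \<odot> b = e \<and> b \<odot> a = e"
proof -
  have left: "\<exists>b\<in>I. e \<odot> b = b \<and> b \<odot> a = e" if "a \<in> I" for a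
  proof -
    obtain c where "c \<in> I" "c \<odot> a = e" using ex_left_factor[OF e_in \<open>a \<in> I\<close>] by metis
    then show ?thesis by (intro bexI[of _ "e \<odot> c"]) (simp_all add: betaT_mult_assoc)
  qed
  obtain b where b: "b \<in> I" "e \<odot> b = b" "b \<odot> a = e" using left[OF assms(1)] by blast
  obtain c where c: "c \<in> I" "e \<odot> c = c" "c \<odot> b = e" using left[OF b(1)] by blast
  have "c = c \<odot> (b \<odot> a)" using b(3) c(1) by simp
  also have "\<dots> = a" using c(3) assms(2) by (simp flip: betaT_mult_assoc)
  finally show ?thesis using b c by blast
qed

section \<open>Automorphisms as right multiplications\<close>

definition rmul where "rmul g p = (if p \<in> I then p \<odot> g else p)"

lemma Aut_in [simp]: "\<alpha> \<in> Aut I \<Longrightarrow> m \<in> I \<Longrightarrow> \<alpha> m \<in> I"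
  by (auto simp: Aut_def bij_betw_def)

lemma Aut_out: "\<alpha> \<in> Aut I \<Longrightarrow> m \<notin> I \<Longrightarrow> \<alpha> m = m"
  by (simp add: Aut_def)

lemma Aut_continuous: "\<alpha> \<in> Aut I \<Longrightarrow> continuous_map K K \<alpha>"
  by (simp add: Aut_def)

lemma Aut_act: "\<alpha> \<in> Aut I \<Longrightarrow> m \<in> I \<Longrightarrow> \<alpha> (act t m) = act t (\<alpha> m)"
  by (simp add: Aut_def)

lemma rmul_Aut:
  assumes "g \<in> I" "e \<odot> g = g"
  shows "rmul g \<in> Aut I"
proof -
  obtain h where h: "h \<in> I" "e \<odot> h = h" "g \<odot> h = e" "h \<odot> g = e"
    using ex_inverse[OF assms] by blast
  have "bij_betw (rmul g) I I"
    by (rule bij_betw_byWitness[where f' = "rmul h"])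
      (use h assms in \<open>auto simp: rmul_def betaT_mult_assoc\<close>)
  moreover have "continuous_map K K (rmul g)"
    by (rule continuous_map_eq[OF continuous_rmul[OF assms(1)]]) (auto simp: rmul_def)
  ultimately show ?thesis by (auto simp: Aut_def rmul_def betaT_act_mult)
qed

text \<open>An automorphism commutes with the group by definition and with \<open>betaT\<close> by
  continuity, since \<open>p \<odot> m\<close> is the limit of the translates of \<open>m\<close>
  along \<open>p\<close>. It is therefore determined by one value and, by \<open>Aut_eq_mul\<close>,
  is right multiplication by its value at \<open>e\<close>.\<close>

lemma Aut_mul:
  assumes "\<alpha> \<in> Aut I" "p \<in> betaT" "m \<in> I"
  shows "\<alpha> (p \<odot> m) = p \<odot> \<alpha> m"
proof -
  have p: "is_ultrafilter p" using assms(2) by (simp add: betaT_def)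
  have "limitin K (\<alpha> \<circ> (\<lambda>t. act t m)) (\<alpha> (p \<odot> m)) p"
    by (rule continuous_map_limit[OF Aut_continuous[OF assms(1)] limitin_act[OF assms(2,3)]])
  moreover have "\<alpha> \<circ> (\<lambda>t. act t m) = (\<lambda>t. act t (\<alpha> m))" using Aut_act[OF assms(1,3)] by auto
  moreover have "limitin K (\<lambda>t. act t (\<alpha> m)) (p \<odot> \<alpha> m) p" using limitin_act assms by simp
  ultimately show ?thesis
    using limitin_Hausdorff_unique[OF _ _ ultrafilter_neq_bot[OF p] Hausdorff_K] by metis
qed

lemma Aut_eq_mul: "\<alpha> \<in> Aut I \<Longrightarrow> m \<in> I \<Longrightarrow> \<alpha> m = m \<odot> \<alpha> e"
  using Aut_mul[of \<alpha> m e] I_sub by simp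

lemma Aut_eqI:
  assumes "\<alpha> \<in> Aut I" "\<beta> \<in> Aut I" "m \<in> I" "\<alpha> m = \<beta> m"
  shows "\<alpha> = \<beta>"
proof
  fix p
  show "\<alpha> p = \<beta> p"
  proof (cases "p \<in> I")
    case True
    then obtain r where r: "r \<in> I" "p = r \<odot> m" using ex_left_factor assms(3) by blast
    then show ?thesis using Aut_mul[OF assms(1) I_sub assms(3)] Aut_mul[OF assms(2) I_sub assms(3)] assms(4)
      by simp
  next
    case False
    then show ?thesis using assms by (simp add: Aut_out)
  qed
qed

lemma Aut_id [simp]: "id \<in> Aut I"
  by (auto simp: Aut_def continuous_map_id bij_betw_id)

lemma Aut_comp [simp]:
  assumes "\<alpha> \<in> Aut I" "\<beta> \<in> Aut I"
  shows "\<alpha> \<circ> \<beta> \<in> Aut I"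
  using assms bij_betw_trans[of \<beta> I I \<alpha> I] continuous_map_compose[of K K \<beta> K \<alpha>]
  by (auto simp: Aut_def bij_betw_def)

lemma Aut_bij: "\<alpha> \<in> Aut I \<Longrightarrow> bij \<alpha>"
proof -
  assume a: "\<alpha> \<in> Aut I"
  then have 1: "bij_betw \<alpha> I I" by (simp add: Aut_def)
  have 2: "bij_betw \<alpha> (- I) (- I)"
    using a by (subst bij_betw_cong[of _ _ id]) (auto simp: Aut_def bij_betw_id)
  have "bij_betw \<alpha> (I \<union> - I) (I \<union> - I)" by (rule bij_betw_combine[OF 1 2]) auto
  then show ?thesis by (simp add: Compl_partition)
qed

text \<open>The inverse is recognised as right multiplication by the inverse of
  \<open>\<alpha> e\<close> in the group \<open>e \<odot> I\<close>, which supplies its continuity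
  and equivariance.\<close>

lemma Aut_inv [simp]:
  assumes "\<alpha> \<in> Aut I"
  shows "inv \<alpha> \<in> Aut I"
proof -
  have "e \<odot> \<alpha> e = \<alpha> e" using Aut_mul[OF assms, of e e] by simp
  then obtain b where b: "b \<in> I" "e \<odot> b = b" "\<alpha> e \<odot> b = e" "b \<odot> \<alpha> e = e"
    using ex_inverse[OF Aut_in[OF assms e_in]] by blast
  have "rmul b (\<alpha> p) = p" for p
  proof (cases "p \<in> I")
    case True
    have "rmul b (\<alpha> p) = p \<odot> \<alpha> e \<odot> b"
      using True assms by (simp add: rmul_def flip: Aut_eq_mul)
    also have "\<dots> = p" using b(3) True by (simp add: betaT_mult_assoc)
    finally show ?thesis .
  next
    case False
    then show ?thesis by (simp add: Aut_out[OF assms] rmul_def)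
  qed
  then have "inv \<alpha> = rmul b"
    using Aut_bij[OF assms] by (metis bij_is_surj ext inv_unique_comp surj_f_inv_f)
  then show ?thesis using rmul_Aut b by simp
qed

lemma Aut_inv_apply [simp]:
  assumes "\<alpha> \<in> Aut I"
  shows "inv \<alpha> (\<alpha> m) = m" "\<alpha> (inv \<alpha> m) = m" "inv \<alpha> \<circ> \<alpha> = id" "\<alpha> \<circ> inv \<alpha> = id" "inv (inv \<alpha>) = \<alpha>"
proof -
  have b: "inj \<alpha>" "surj \<alpha>" using Aut_bij[OF assms] by (auto simp: bij_def)
  show "inv \<alpha> (\<alpha> m) = m" "\<alpha> (inv \<alpha> m) = m" using b by (simp_all add: surj_f_inv_f)
  show "inv \<alpha> \<circ> \<alpha> = id" using b by simp
  show "\<alpha> \<circ> inv \<alpha> = id" using b by (simp flip: surj_iff)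
  show "inv (inv \<alpha>) = \<alpha>" by (rule inv_inv_eq[OF Aut_bij[OF assms]])
qed

text \<open>The difference of two points of \<open>I\<close>: \<open>Aut I\<close> acts simply
  transitively on the group \<open>e \<odot> I\<close>, so exactly one automorphism qualifies.
  Points of a graph have the automorphism as difference (\<open>kap_Aut\<close>), and differences
  compose along triples (\<open>kap_trans\<close>).\<close>

definition kap where "kap m n = (SOME \<alpha>. \<alpha> \<in> Aut I \<and> e \<odot> n = \<alpha> (e \<odot> m))"

lemma
  assumes "m \<in> I" "n \<in> I"
  shows kap_in [intro, simp]: "kap m n \<in> Aut I"
    and kap_eq: "kap m n (e \<odot> m) = e \<odot> n"
proof -
  have "e \<odot> m \<in> I" using assms by simp
  then obtain b where b: "b \<in> I" "e \<odot> b = b" "(e \<odot> m) \<odot> b = e" "b \<odot> (e \<odot> m) = e"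
    using ex_inverse[of "e \<odot> m"] by auto
  have "e \<odot> n = (e \<odot> m) \<odot> (b \<odot> (e \<odot> n))"
    using b(3) by (simp flip: betaT_mult_assoc)
  moreover have "e \<odot> (b \<odot> (e \<odot> n)) = b \<odot> (e \<odot> n)" using b(2) by (simp flip: betaT_mult_assoc)
  ultimately have "rmul (b \<odot> (e \<odot> n)) \<in> Aut I \<and> e \<odot> n = rmul (b \<odot> (e \<odot> n)) (e \<odot> m)"
    using assms b by (auto intro!: rmul_Aut simp: rmul_def)
  then have "\<exists>\<alpha>. \<alpha> \<in> Aut I \<and> e \<odot> n = \<alpha> (e \<odot> m)" by blast
  from someI_ex[OF this] show "kap m n \<in> Aut I" "kap m n (e \<odot> m) = e \<odot> n"
    by (auto simp: kap_def)
qed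

lemma kap_unique:
  assumes "m \<in> I" "n \<in> I" "\<alpha> \<in> Aut I" "\<alpha> (e \<odot> m) = e \<odot> n"
  shows "kap m n = \<alpha>"
proof (rule Aut_eqI)
  show "e \<odot> m \<in> I" using assms by simp
  show "kap m n (e \<odot> m) = \<alpha> (e \<odot> m)" using assms by (simp only: kap_eq)
qed (use assms in auto)

lemma kap_trans:
  assumes "m \<in> I" "n \<in> I" "k \<in> I"
  shows "kap m k = kap n k \<circ> kap m n"
  by (rule kap_unique) (use assms in \<open>simp_all add: kap_eq\<close>)

lemma kap_refl [simp]: "m \<in> I \<Longrightarrow> kap m m = id"
  by (rule kap_unique) simp_all

lemma kap_sym:
  assumes "m \<in> I" "n \<in> I"
  shows "kap n m = inv (kap m n)"
proof (rule kap_unique)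
  show "inv (kap m n) (e \<odot> n) = e \<odot> m"
    using Aut_inv_apply(1)[OF kap_in[OF assms], of "e \<odot> m"] unfolding kap_eq[OF assms] .
qed (use assms in auto)

lemma kap_Aut [simp]: "\<alpha> \<in> Aut I \<Longrightarrow> m \<in> I \<Longrightarrow> kap m (\<alpha> m) = \<alpha>"
  by (rule kap_unique) (simp_all add: Aut_mul)

section \<open>Limits of automorphisms\<close>

definition pre2 where
  "pre2 f g W = {z \<in> I \<times> I. (f (fst z), g (snd z)) \<in> W}"

lemma pre2_iff [simp]: "(x, y) \<in> pre2 f g W \<longleftrightarrow> x \<in> I \<and> y \<in> I \<and> (f x, g y) \<in> W"
  by (simp add: pre2_def)

lemma openin_pre2:
  assumes "continuous_map K K f" "continuous_map K K g" "openin K2 W"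
  shows "openin K2 (pre2 f g W)"
proof -
  have "continuous_map K2 K2 (\<lambda>(x, y). (f x, g y))"
    using assms by (simp add: continuous_map_prod_top)
  from openin_continuous_map_preimage[OF this assms(3)] show ?thesis
    by (simp add: pre2_def case_prod_beta)
qed

lemma limitin_pair:
  assumes "limitin K f a F" "limitin K g b F"
  shows "limitin K2 (\<lambda>i. (f i, g i)) (a, b) F"
  using assms by (simp add: limitin_pairwise o_def)

lemma limitin_act2:
  assumes "p \<in> betaT" "m \<in> I" "n \<in> I"
  shows "limitin K2 (\<lambda>t. (act t m, act t n)) (p \<odot> m, p \<odot> n) p"
  using assms by (intro limitin_pair limitin_act)

lemma orbit2_meets:
  assumes "p \<in> betaT" "m \<in> I" "n \<in> I" "openin K2 W" "(p \<odot> m, p \<odot> n) \<in> W"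
  shows "\<exists>t. (act t m, act t n) \<in> W"
proof -
  have "eventually (\<lambda>t. (act t m, act t n) \<in> W) p"
    using limitin_act2[OF assms(1-3)] assms(4,5) by (simp add: limitin_def)
  moreover have "p \<noteq> bot" using assms(1) by (simp add: betaT_def is_ultrafilter_def)
  ultimately show ?thesis using eventually_happens' by blast
qed

lemma closedin_orbit2:
  assumes "closedin K2 C" "(m, n) \<in> C" "p \<in> betaT"
    and inv: "\<And>t x y. (x, y) \<in> C \<Longrightarrow> (act t x, act t y) \<in> C"
  shows "(p \<odot> m, p \<odot> n) \<in> C"
proof (rule closedin_limit[OF limitin_act2 assms(1)])
  show "m \<in> I" "n \<in> I" using closedin_subset[OF assms(1)] assms(2) by auto
  show "eventually (\<lambda>t. (act t m, act t n) \<in> C) p" using inv assms(2) by simp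
  show "is_ultrafilter p" using assms(3) by (simp add: betaT_def)
qed fact

text \<open>Open sets met by graphs replace approximating points: that
  \<open>m\<^sub>i \<rightarrow> m\<close> and
  \<open>\<delta>\<^sub>i m\<^sub>i \<rightarrow> \<alpha> m\<close> for some choice of points means
  that the graphs eventually meet every neighbourhood of \<open>(m, \<alpha> m)\<close>.\<close>

definition meets where
  "meets \<delta> W \<longleftrightarrow> (\<exists>m\<in>I. (m, \<delta> m) \<in> W)"

lemma meets_mono: "meets \<delta> W \<Longrightarrow> W \<subseteq> W' \<Longrightarrow> meets \<delta> W'"
  by (auto simp: meets_def)

lemma meets_act: "\<delta> \<in> Aut I \<Longrightarrow> meets \<delta> (pre2 (act t) (act t) W) \<Longrightarrow> meets \<delta> W"
  by (auto simp: meets_def Aut_act[symmetric])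

lemma meets_left: "meets \<delta> (pre2 id \<gamma> W) \<Longrightarrow> meets (\<gamma> \<circ> \<delta>) W"
  by (auto simp: meets_def)

text \<open>A graph is a minimal set of the product flow, being a copy of \<open>I\<close>. Any
  neighbourhood of one of its points is therefore visited by the orbit of any other, which makes the
  choice of base point immaterial in everything that follows.\<close>

lemma Gamma_orbit:
  assumes "\<alpha> \<in> Aut I" "m \<in> I" "n \<in> I" "openin K2 W" "(n, \<alpha> n) \<in> W"
  shows "\<exists>t. (act t m, \<alpha> (act t m)) \<in> W"
proof -
  obtain p where p: "p \<in> I" "n = p \<odot> m" using ex_left_factor[OF assms(3,2)] by auto
  have "\<alpha> n = p \<odot> \<alpha> m" using Aut_mul[OF assms(1) I_sub[OF p(1)] assms(2)] p(2) by simp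
  then have "\<exists>t. (act t m, act t (\<alpha> m)) \<in> W"
    using assms p by (intro orbit2_meets[of p]) (auto intro: I_sub)
  then show ?thesis using assms(1,2) by (simp add: Aut_act)
qed

definition Qcl where
  "Qcl H = K2 closure_of (\<Union>\<alpha>\<in>H. Gamma I \<alpha>)"

lemma in_Qcl_iff:
  assumes "H \<subseteq> Aut I"
  shows "z \<in> Qcl H \<longleftrightarrow> z \<in> I \<times> I \<and> (\<forall>W. openin K2 W \<and> z \<in> W \<longrightarrow> (\<exists>\<delta>\<in>H. meets \<delta> W))"
proof -
  have "(\<exists>y. y \<in> (\<Union>\<alpha>\<in>H. Gamma I \<alpha>) \<and> y \<in> W) \<longleftrightarrow> (\<exists>\<delta>\<in>H. meets \<delta> W)" for W
    by (auto simp: meets_def Gamma_def)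
  then show ?thesis
    unfolding Qcl_def in_closure_of topspace_K2 by (simp add: conj_commute)
qed

lemma Qcl_mono: "H \<subseteq> H' \<Longrightarrow> Qcl H \<subseteq> Qcl H'"
  unfolding Qcl_def by (intro closure_of_mono) blast

lemma Qcl_sub: "Qcl H \<subseteq> I \<times> I"
  unfolding Qcl_def using closure_of_subset_topspace[of K2] by simp

lemma Qcl_graph: "H \<subseteq> Aut I \<Longrightarrow> \<alpha> \<in> H \<Longrightarrow> m \<in> I \<Longrightarrow> (m, \<alpha> m) \<in> Qcl H"
  unfolding Qcl_def
  by (rule subsetD[OF closure_of_subset]) (auto simp: Gamma_def)

lemma closedin_Qcl: "closedin K2 (Qcl H)"
  unfolding Qcl_def by (rule closedin_closure_of)

lemma Qcl_minimal:
  assumes "closedin K2 C" "\<And>\<alpha> m. \<alpha> \<in> H \<Longrightarrow> m \<in> I \<Longrightarrow> (m, \<alpha> m) \<in> C"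
  shows "Qcl H \<subseteq> C"
  unfolding Qcl_def by (rule closure_of_minimal[OF _ assms(1)]) (auto simp: Gamma_def assms(2))

text \<open>Subgroups closed in the \<tau>-sense. Closedness is expressed by the closure of the
  graphs and tested at \<open>e\<close> only, which suffices by minimality of graphs.\<close>

definition csub where
  "csub H \<longleftrightarrow> H \<subseteq> Aut I \<and> id \<in> H \<and> (\<forall>\<alpha>\<in>H. \<forall>\<beta>\<in>H. \<alpha> \<circ> \<beta> \<in> H) \<and> (\<forall>\<alpha>\<in>H. inv \<alpha> \<in> H) \<and>
    (\<forall>\<alpha>\<in>Aut I. (e, \<alpha> e) \<in> Qcl H \<longrightarrow> \<alpha> \<in> H)"

lemma csubD:
  assumes "csub H"
  shows "H \<subseteq> Aut I" "\<alpha> \<in> H \<Longrightarrow> \<alpha> \<in> Aut I" "id \<in> H" "\<alpha> \<in> H \<Longrightarrow> \<beta> \<in> H \<Longrightarrow> \<alpha> \<circ> \<beta> \<in> H"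
    "\<alpha> \<in> H \<Longrightarrow> inv \<alpha> \<in> H" "\<alpha> \<in> Aut I \<Longrightarrow> (e, \<alpha> e) \<in> Qcl H \<Longrightarrow> \<alpha> \<in> H"
  using assms unfolding csub_def by blast+

definition TC where
  "TC F \<delta> \<alpha> \<longleftrightarrow> (\<forall>W. openin K2 W \<and> (e, \<alpha> e) \<in> W \<longrightarrow> eventually (\<lambda>i. meets (\<delta> i) W) F)"

lemma TCD: "TC F \<delta> \<alpha> \<Longrightarrow> openin K2 W \<Longrightarrow> (e, \<alpha> e) \<in> W \<Longrightarrow> eventually (\<lambda>i. meets (\<delta> i) W) F"
  by (simp add: TC_def)

lemma kap_mul:
  assumes "m \<in> I" "n \<in> I" "r \<in> I"
  shows "kap m n (r \<odot> m) = r \<odot> n"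
proof -
  have "kap m n (r \<odot> (e \<odot> m)) = r \<odot> (e \<odot> n)"
    using Aut_mul[OF kap_in[OF assms(1,2)] I_sub[OF assms(3)], of "e \<odot> m"] kap_eq[OF assms(1,2)] assms by simp
  moreover have "r \<odot> (e \<odot> x) = r \<odot> x" for x using assms(3) by (simp flip: betaT_mult_assoc)
  ultimately show ?thesis by simp
qed

text \<open>Choose \<open>r\<close> with \<open>r \<odot> m = e\<close>. Then
  \<open>(e, kap m n e)\<close> is \<open>r\<close> applied to \<open>(m, n)\<close>, so some
  translate of \<open>(m, n)\<close> enters a given neighbourhood of it. The graph points converging
  to \<open>(m, n)\<close> follow under the same translation and stay on their graphs.\<close>

lemma TC_limit:
  assumes \<delta>: "eventually (\<lambda>i. \<delta> i \<in> Aut I) F" and lim: "limitin K mm m F" "limitin K (\<lambda>i. \<delta> i (mm i)) n F"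
  shows "TC F \<delta> (kap m n)"
  unfolding TC_def
proof (intro allI impI)
  fix W assume W: "openin K2 W \<and> (e, kap m n e) \<in> W"
  have mn: "m \<in> I" "n \<in> I" using lim by (auto simp: limitin_def)
  obtain r where r: "r \<in> I" "r \<odot> m = e" using ex_left_factor[OF e_in mn(1)] by metis
  have "kap m n e = r \<odot> n" using kap_mul[OF mn r(1)] r(2) by simp
  then have "(r \<odot> m, r \<odot> n) \<in> W" using W r(2) by simp
  then obtain t where t: "(act t m, act t n) \<in> W"
    using orbit2_meets[OF I_sub[OF r(1)] mn] W by blast
  have W': "openin K2 (pre2 (act t) (act t) W)" "(m, n) \<in> pre2 (act t) (act t) W"
    using W t mn by (auto intro: openin_pre2 continuous_act)
  have "eventually (\<lambda>i. (mm i, \<delta> i (mm i)) \<in> pre2 (act t) (act t) W) F"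
    using limitin_pair[OF lim] W' unfolding limitin_def by blast
  then show "eventually (\<lambda>i. meets (\<delta> i) W) F"
    using \<delta>
  proof eventually_elim
    case (elim i)
    then have "meets (\<delta> i) (pre2 (act t) (act t) W)" unfolding meets_def by (meson pre2_iff)
    then show ?case using meets_act elim by blast
  qed
qed

lemma TC_left:
  assumes "TC F \<delta> \<alpha>" "\<alpha> \<in> Aut I" "\<gamma> \<in> Aut I"
  shows "TC F (\<lambda>i. \<gamma> \<circ> \<delta> i) (\<gamma> \<circ> \<alpha>)"
  unfolding TC_def
proof (intro allI impI)
  fix W assume W: "openin K2 W \<and> (e, (\<gamma> \<circ> \<alpha>) e) \<in> W"
  then have "openin K2 (pre2 id \<gamma> W)" "(e, \<alpha> e) \<in> pre2 id \<gamma> W"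
    using assms by (auto intro!: openin_pre2 Aut_continuous)
  then have "eventually (\<lambda>i. meets (\<delta> i) (pre2 id \<gamma> W)) F"
    using assms(1) by (simp add: TC_def)
  then show "eventually (\<lambda>i. meets (\<gamma> \<circ> \<delta> i) W) F"
    by eventually_elim (rule meets_left)
qed

lemma TC_csub:
  assumes "csub H" "eventually (\<lambda>i. \<delta> i \<in> H) F" "F \<noteq> bot" "TC F \<delta> \<alpha>" "\<alpha> \<in> Aut I"
  shows "\<alpha> \<in> H"
proof (rule csubD(6)[OF assms(1,5)])
  show "(e, \<alpha> e) \<in> Qcl H"
    unfolding in_Qcl_iff[OF csubD(1)[OF assms(1)]]
  proof (intro conjI allI impI)
    show "(e, \<alpha> e) \<in> I \<times> I" using assms(5) by simp
    fix W assume "openin K2 W \<and> (e, \<alpha> e) \<in> W"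
    then have "eventually (\<lambda>i. meets (\<delta> i) W) F" using assms(4) by (simp add: TC_def)
    then have "eventually (\<lambda>i. \<delta> i \<in> H \<and> meets (\<delta> i) W) F" using assms(2) by eventually_elim simp
    then have "\<exists>i. \<delta> i \<in> H \<and> meets (\<delta> i) W" by (rule eventually_happens'[OF assms(3)])
    then show "\<exists>\<delta>\<in>H. meets \<delta> W" by blast
  qed
qed

lemma kap_csub:
  assumes "csub H" "is_ultrafilter F" "eventually (\<lambda>i. \<delta> i \<in> H) F"
    "limitin K mm m F" "limitin K (\<lambda>i. \<delta> i (mm i)) n F"
  shows "kap m n \<in> H"
proof (rule TC_csub[OF assms(1,3) ultrafilter_neq_bot[OF assms(2)]])
  show "TC F \<delta> (kap m n)"
  proof (rule TC_limit[OF _ assms(4)])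
    show "eventually (\<lambda>i. \<delta> i \<in> Aut I) F"
      using assms(3) by eventually_elim (rule csubD(2)[OF assms(1)])
  qed fact
  show "kap m n \<in> Aut I" using assms(4,5) by (intro kap_in) (auto simp: limitin_def)
qed

section \<open>The derived group\<close>

text \<open>\<open>Gamma_orbit\<close> provides for each test point a time that carries the test
  back to \<open>e\<close>. The finitely many pulled-back neighbourhoods are intersected into one
  neighbourhood of \<open>(e, \<alpha> e)\<close> and one of \<open>(e, e)\<close>.\<close>

lemma meets_everywhere:
  assumes near: "\<And>W W'. openin K2 W \<Longrightarrow> openin K2 W' \<Longrightarrow> (e, \<alpha> e) \<in> W \<Longrightarrow> (e, e) \<in> W' \<Longrightarrow>
      \<exists>\<delta>\<in>H. meets \<delta> W \<and> meets \<delta> W'"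
    and H: "H \<subseteq> Aut I" "\<alpha> \<in> Aut I" and M: "finite M" "M \<subseteq> I"
    and W: "\<And>m. m \<in> M \<Longrightarrow> openin K2 (W m) \<and> (m, \<alpha> m) \<in> W m"
    and W': "\<And>m. m \<in> M \<Longrightarrow> openin K2 (W' m) \<and> (m, m) \<in> W' m"
  shows "\<exists>\<delta>\<in>H. \<forall>m\<in>M. meets \<delta> (W m) \<and> meets \<delta> (W' m)"
proof -
  have "\<exists>t. (act t e, \<alpha> (act t e)) \<in> W m" if "m \<in> M" for m
    using Gamma_orbit[OF H(2) e_in, of m "W m"] W[OF that] M(2) that by blast
  then obtain s where s: "\<And>m. m \<in> M \<Longrightarrow> (act (s m) e, \<alpha> (act (s m) e)) \<in> W m" by metis
  have "\<exists>t. (act t e, id (act t e)) \<in> W' m" if "m \<in> M" for m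
    using Gamma_orbit[OF Aut_id e_in, of m "W' m"] W'[OF that] M(2) that by auto
  then obtain t where t: "\<And>m. m \<in> M \<Longrightarrow> (act (t m) e, act (t m) e) \<in> W' m" by (metis id_apply)
  \<comment> \<open>The factor \<open>I \<times> I\<close> provides the open set when
    \<open>M\<close> is empty.\<close>
  define V where "V = (\<Inter>m\<in>M. pre2 (act (s m)) (act (s m)) (W m)) \<inter> (I \<times> I)"
  define V' where "V' = (\<Inter>m\<in>M. pre2 (act (t m)) (act (t m)) (W' m)) \<inter> (I \<times> I)"
  have top: "openin K2 (I \<times> I)" using openin_topspace[of K2] by simp
  have "openin K2 V \<and> openin K2 V'"
  proof (cases "M = {}")
    case True
    then show ?thesis using top by (simp add: V_def V'_def)
  next
    case False
    then show ?thesis unfolding V_def V'_def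
      using M W W' top by (auto intro!: openin_Int openin_INT2 openin_pre2 continuous_act)
  qed
  moreover have "(e, \<alpha> e) \<in> V" "(e, e) \<in> V'"
    using s t H(2) by (auto simp: V_def V'_def Aut_act[OF H(2), symmetric])
  ultimately obtain \<delta> where \<delta>: "\<delta> \<in> H" "meets \<delta> V" "meets \<delta> V'" using near by blast
  have "meets \<delta> (W m) \<and> meets \<delta> (W' m)" if "m \<in> M" for m
  proof
    have "\<delta> \<in> Aut I" using \<delta> H by auto
    moreover have "V \<subseteq> pre2 (act (s m)) (act (s m)) (W m)" "V' \<subseteq> pre2 (act (t m)) (act (t m)) (W' m)"
      using that by (auto simp: V_def V'_def)
    ultimately show "meets \<delta> (W m)" "meets \<delta> (W' m)"
      using meets_act meets_mono \<delta> by blast+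
  qed
  then show ?thesis using \<delta>(1) by blast
qed

lemma derived_subset: "derived I H \<subseteq> H"
  by (auto simp: derived_def)

text \<open>Turns the test by two open sets at \<open>e\<close> into the net required by
  \<open>derived\<close>. An index is an automorphism together with two functions recording the
  points that approximate \<open>m\<close> on its graph, which is why the index type is a
  triple.\<close>

lemma derivedI:
  assumes H: "H \<subseteq> Aut I" "\<alpha> \<in> H"
    and near: "\<And>W W'. openin K2 W \<Longrightarrow> openin K2 W' \<Longrightarrow> (e, \<alpha> e) \<in> W \<Longrightarrow> (e, e) \<in> W' \<Longrightarrow>
      \<exists>\<delta>\<in>H. meets \<delta> W \<and> meets \<delta> W'"
  shows "\<alpha> \<in> derived I H"
proof -
  have \<alpha>: "\<alpha> \<in> Aut I" using H by auto
  \<comment> \<open>A basic condition consists of neighbourhoods of all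
    \<open>(m, \<alpha> m)\<close> and \<open>(m, m)\<close>, of which only those over the finite
    set \<open>M\<close> are enforced by \<open>S\<close>. Intersecting neighbourhoods and uniting
    the finite sets shows that the conditions are directed.\<close>
  define B where "B = {(M, W, W'). finite M \<and> M \<subseteq> I \<and>
    (\<forall>m\<in>I. openin K2 (W m) \<and> (m, \<alpha> m) \<in> W m \<and> openin K2 (W' m) \<and> (m, m) \<in> W' m)}"
  define S where "S b = (case b of (M, W, W') \<Rightarrow> {(\<delta>, f, f'). \<delta> \<in> H \<and>
    (\<forall>m\<in>M. (f m, \<delta> (f m)) \<in> W m \<and> (f' m, \<delta> (f' m)) \<in> W' m)})"
    for b :: "'g filter set \<times> ('g filter \<Rightarrow> ('g filter \<times> 'g filter) set) \<times> ('g filter \<Rightarrow> ('g filter \<times> 'g filter) set)"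
  define \<Phi> where "\<Phi> = (INF b\<in>B. principal (S b))"
  have top: "openin K2 (I \<times> I)" using openin_topspace[of K2] by simp
  have triv: "({}, \<lambda>_. I \<times> I, \<lambda>_. I \<times> I) \<in> B" using top \<alpha> by (simp add: B_def)
  have ev: "eventually P \<Phi> \<longleftrightarrow> (\<exists>b\<in>B. \<forall>x\<in>S b. P x)" for P
    unfolding \<Phi>_def
  proof (subst eventually_INF_base)
    show "B \<noteq> {}" using triv by blast
    fix b c assume b: "b \<in> B" and c: "c \<in> B"
    obtain M W W' where bb: "b = (M, W, W')" by (cases b)
    obtain N V V' where cc: "c = (N, V, V')" by (cases c)
    have "(M \<union> N, \<lambda>m. W m \<inter> V m, \<lambda>m. W' m \<inter> V' m) \<in> B"
      using b c by (auto simp: B_def bb cc)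
    moreover have "S (M \<union> N, \<lambda>m. W m \<inter> V m, \<lambda>m. W' m \<inter> V' m) \<subseteq> S b \<inter> S c"
      by (auto simp: S_def bb cc)
    ultimately show "\<exists>x\<in>B. principal (S x) \<le> inf (principal (S b)) (principal (S c))"
      by (intro bexI) auto
  qed (simp add: eventually_principal)
  have "\<Phi> \<noteq> bot"
  proof
    assume "\<Phi> = bot"
    then have "eventually (\<lambda>_. False) \<Phi>" by simp
    then obtain b0 where b0: "b0 \<in> B" "\<forall>x\<in>S b0. False" unfolding ev by (elim bexE)
    obtain M W W' where bb: "b0 = (M, W, W')" by (cases b0)
    have b: "(M, W, W') \<in> B" and emp: "S (M, W, W') = {}" using b0 unfolding bb by auto
    have "\<exists>\<delta>\<in>H. \<forall>m\<in>M. meets \<delta> (W m) \<and> meets \<delta> (W' m)"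
      by (rule meets_everywhere[OF near H(1) \<alpha>]) (use b in \<open>auto simp: B_def\<close>)
    then obtain \<delta> where \<delta>: "\<delta> \<in> H" "\<forall>m\<in>M. \<exists>x. (x, \<delta> x) \<in> W m" "\<forall>m\<in>M. \<exists>x. (x, \<delta> x) \<in> W' m"
      unfolding meets_def by blast
    obtain f where "\<forall>m\<in>M. (f m, \<delta> (f m)) \<in> W m" using bchoice[OF \<delta>(2)] by blast
    moreover obtain f' where "\<forall>m\<in>M. (f' m, \<delta> (f' m)) \<in> W' m" using bchoice[OF \<delta>(3)] by blast
    ultimately have "(\<delta>, f, f') \<in> S (M, W, W')" using \<delta>(1) by (simp add: S_def)
    then show False using emp by simp
  qed
  have evH: "eventually (\<lambda>i. fst i \<in> H) \<Phi>"
    unfolding ev using triv by (rule bexI[rotated]) (auto simp: S_def)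
  have lim: "limitin K2 (\<lambda>(\<delta>, f, f'). (f m, \<delta> (f m))) (m, \<alpha> m) \<Phi>" if m: "m \<in> I" for m
    unfolding limitin_def topspace_K2
  proof (intro conjI allI impI)
    show "(m, \<alpha> m) \<in> I \<times> I" using m \<alpha> by simp
    fix U assume U: "openin K2 U \<and> (m, \<alpha> m) \<in> U"
    \<comment> \<open>Only the test at \<open>m\<close> matters here; \<open>I \<times> I\<close> is
      the vacuous condition elsewhere.\<close>
    have "({m}, (\<lambda>_. I \<times> I)(m := U), \<lambda>_. I \<times> I) \<in> B" using U top \<alpha> m by (simp add: B_def)
    then show "eventually (\<lambda>x. (case x of (\<delta>, f, f') \<Rightarrow> (f m, \<delta> (f m))) \<in> U) \<Phi>"
      unfolding ev by (rule bexI[rotated]) (auto simp: S_def)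
  qed
  have lim': "limitin K2 (\<lambda>(\<delta>, f, f'). (f' m, \<delta> (f' m))) (m, m) \<Phi>" if m: "m \<in> I" for m
    unfolding limitin_def topspace_K2
  proof (intro conjI allI impI)
    show "(m, m) \<in> I \<times> I" using m by simp
    fix U assume U: "openin K2 U \<and> (m, m) \<in> U"
    have "({m}, \<lambda>_. I \<times> I, (\<lambda>_. I \<times> I)(m := U)) \<in> B" using U top \<alpha> m by (simp add: B_def)
    then show "eventually (\<lambda>x. (case x of (\<delta>, f, f') \<Rightarrow> (f' m, \<delta> (f' m))) \<in> U) \<Phi>"
      unfolding ev by (rule bexI[rotated]) (auto simp: S_def)
  qed
  have evI: "eventually (\<lambda>i. mm i \<in> I) \<Phi>" if "limitin K mm m \<Phi>" for mm m
    using that openin_topspace[of K] unfolding limitin_def topspace_K by blast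
  have "tau_conv I \<Phi> fst \<alpha>"
    unfolding tau_conv_def
  proof
    fix m assume "m \<in> I"
    then have "limitin K (\<lambda>i. fst (snd i) m) m \<Phi>" "limitin K (\<lambda>i. fst i (fst (snd i) m)) (\<alpha> m) \<Phi>"
      using lim[of m] by (simp_all add: limitin_pairwise o_def case_prod_beta)
    then show "\<exists>mm. eventually (\<lambda>i. mm i \<in> I) \<Phi> \<and> limitin K mm m \<Phi> \<and> limitin K (\<lambda>i. fst i (mm i)) (\<alpha> m) \<Phi>"
      using evI by (intro exI[of _ "\<lambda>i. fst (snd i) m"] conjI)
  qed
  moreover have "tau_conv I \<Phi> fst (\<lambda>p. p)"
    unfolding tau_conv_def
  proof
    fix m assume "m \<in> I"
    then have "limitin K (\<lambda>i. snd (snd i) m) m \<Phi>" "limitin K (\<lambda>i. fst i (snd (snd i) m)) m \<Phi>"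
      using lim'[of m] by (simp_all add: limitin_pairwise o_def case_prod_beta)
    then show "\<exists>mm. eventually (\<lambda>i. mm i \<in> I) \<Phi> \<and> limitin K mm m \<Phi> \<and> limitin K (\<lambda>i. fst i (mm i)) m \<Phi>"
      using evI by (intro exI[of _ "\<lambda>i. snd (snd i) m"] conjI)
  qed
  ultimately show ?thesis unfolding derived_def mem_Collect_eq using H(2) \<open>\<Phi> \<noteq> bot\<close> evH
    by (intro conjI exI[of _ \<Phi>] exI[of _ fst])
qed

lemma limitin_mono: "limitin X f l F \<Longrightarrow> G \<le> F \<Longrightarrow> limitin X f l G"
  by (auto simp: limitin_def dest: filter_leD)

lemma derivedE:
  assumes "\<alpha> \<in> derived I H"
  obtains F :: "(('g filter \<Rightarrow> 'g filter) \<times> ('g filter \<Rightarrow> 'g filter) \<times> ('g filter \<Rightarrow> 'g filter)) filter"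
    and \<delta> mm mm' where
    "is_ultrafilter F" "eventually (\<lambda>i. \<delta> i \<in> H) F"
    "limitin K mm e F" "limitin K (\<lambda>i. \<delta> i (mm i)) (\<alpha> e) F"
    "limitin K mm' e F" "limitin K (\<lambda>i. \<delta> i (mm' i)) e F"
proof -
  obtain G :: "(('g filter \<Rightarrow> 'g filter) \<times> ('g filter \<Rightarrow> 'g filter) \<times> ('g filter \<Rightarrow> 'g filter)) filter" and \<delta>
    where G: "G \<noteq> bot" "eventually (\<lambda>i. \<delta> i \<in> H) G" "tau_conv I G \<delta> \<alpha>" "tau_conv I G \<delta> (\<lambda>p. p)"
    using assms unfolding derived_def mem_Collect_eq by (elim conjE exE)
  obtain mm where mm: "limitin K mm e G" "limitin K (\<lambda>i. \<delta> i (mm i)) (\<alpha> e) G"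
    using bspec[OF G(3)[unfolded tau_conv_def] e_in] by blast
  obtain mm' where mm': "limitin K mm' e G" "limitin K (\<lambda>i. \<delta> i (mm' i)) e G"
    using bspec[OF G(4)[unfolded tau_conv_def] e_in] by blast
  obtain F where F: "F \<le> G" "is_ultrafilter F" using ex_ultrafilter_le[OF G(1)] by blast
  show thesis
    using that[of F \<delta> mm mm'] F G(2) mm mm' by (simp add: filter_leD limitin_mono)
qed

text \<open>The converse of \<open>derivedI\<close>, with two independent base points. Convergence
  is known at \<open>e\<close>, and minimality of the graphs of \<open>\<alpha>\<close> and of the
  identity moves each test to its own point.\<close>

lemma derived_near:
  assumes "\<alpha> \<in> derived I H" "H \<subseteq> Aut I" "m \<in> I" "m' \<in> I"
    "openin K2 W" "(m, \<alpha> m) \<in> W" "openin K2 W'" "(m', m') \<in> W'"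
  shows "\<exists>\<delta>\<in>H. meets \<delta> W \<and> meets \<delta> W'"
proof -
  have \<alpha>: "\<alpha> \<in> Aut I" using assms(1,2) derived_subset by blast
  from assms(1) obtain F :: "(('g filter \<Rightarrow> 'g filter) \<times> ('g filter \<Rightarrow> 'g filter) \<times> ('g filter \<Rightarrow> 'g filter)) filter"
    and \<delta> mm mm' where F: "is_ultrafilter F" "eventually (\<lambda>i. \<delta> i \<in> H) F"
    "limitin K mm e F" "limitin K (\<lambda>i. \<delta> i (mm i)) (\<alpha> e) F"
    "limitin K mm' e F" "limitin K (\<lambda>i. \<delta> i (mm' i)) e F" by (rule derivedE)
  have Aut: "eventually (\<lambda>i. \<delta> i \<in> Aut I) F" using F(2) assms(2) by (auto elim: eventually_mono)
  have "TC F \<delta> (kap e (\<alpha> e))" "TC F \<delta> (kap e e)" by (rule TC_limit[OF Aut]; fact)+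
  then have TC: "TC F \<delta> \<alpha>" "TC F \<delta> id" using \<alpha> by simp_all
  obtain s where s: "(act s e, \<alpha> (act s e)) \<in> W" using Gamma_orbit[OF \<alpha> e_in assms(3,5,6)] by blast
  obtain t where t: "(act t e, act t e) \<in> W'"
    using Gamma_orbit[OF Aut_id e_in assms(4,7)] assms(8) by auto
  have "(e, \<alpha> e) \<in> pre2 (act s) (act s) W" "(e, id e) \<in> pre2 (act t) (act t) W'"
    using s t \<alpha> by (auto simp: Aut_act[OF \<alpha>, symmetric])
  then have "eventually (\<lambda>i. meets (\<delta> i) (pre2 (act s) (act s) W)) F"
    "eventually (\<lambda>i. meets (\<delta> i) (pre2 (act t) (act t) W')) F"
    using TCD[OF TC(1) openin_pre2[OF continuous_act continuous_act assms(5)]]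
      TCD[OF TC(2) openin_pre2[OF continuous_act continuous_act assms(7)]] by blast+
  with F(2) Aut have "eventually (\<lambda>i. \<delta> i \<in> H \<and> meets (\<delta> i) W \<and> meets (\<delta> i) W') F"
    by eventually_elim (blast intro: meets_act)
  from eventually_happens'[OF ultrafilter_neq_bot[OF F(1)] this] show ?thesis by blast
qed

lemma meets_right:
  assumes "\<beta> \<in> Aut I" "meets \<delta> (pre2 (inv \<beta>) id W)"
  shows "meets (\<delta> \<circ> \<beta>) W"
proof -
  obtain x where x: "x \<in> I" "(inv \<beta> x, \<delta> x) \<in> W" using assms(2) by (auto simp: meets_def)
  then have "(inv \<beta> x, (\<delta> \<circ> \<beta>) (inv \<beta> x)) \<in> W" "inv \<beta> x \<in> I" using assms(1) by simp_all
  then show ?thesis unfolding meets_def by blast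
qed

lemma meets_conj:
  assumes "\<beta> \<in> Aut I" "meets \<delta> (pre2 \<beta> \<beta> W)"
  shows "meets (\<beta> \<circ> \<delta> \<circ> inv \<beta>) W"
proof -
  obtain x where x: "x \<in> I" "(\<beta> x, \<beta> (\<delta> x)) \<in> W" using assms(2) by (auto simp: meets_def)
  then have "(\<beta> x, (\<beta> \<circ> \<delta> \<circ> inv \<beta>) (\<beta> x)) \<in> W" "\<beta> x \<in> I" using assms(1) by simp_all
  then show ?thesis unfolding meets_def by blast
qed

lemma openin_pre2_Aut:
  "\<alpha> \<in> Aut I \<Longrightarrow> \<beta> \<in> Aut I \<Longrightarrow> openin K2 W \<Longrightarrow> openin K2 (pre2 \<alpha> \<beta> W)"
  by (rule openin_pre2[OF Aut_continuous Aut_continuous])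

lemma id_derived: "csub H \<Longrightarrow> id \<in> derived I H"
proof (rule derivedI)
  assume H: "csub H"
  show "H \<subseteq> Aut I" "id \<in> H" using csubD[OF H] by blast+
  fix W W' assume "(e, id e) \<in> W" "(e, e) \<in> W'"
  then have "meets id W" "meets id W'" unfolding meets_def using e_in by (metis id_apply)+
  then show "\<exists>\<delta>\<in>H. meets \<delta> W \<and> meets \<delta> W'" using csubD(3)[OF H] by blast
qed

text \<open>Composing on the left with \<open>inv \<alpha>\<close> a net that converges to both
  \<open>\<alpha>\<close> and the identity gives one that converges to both the identity and
  \<open>inv \<alpha>\<close>.\<close>

lemma inv_derived:
  assumes H: "csub H" and \<alpha>: "\<alpha> \<in> derived I H"
  shows "inv \<alpha> \<in> derived I H"
proof (rule derivedI)
  have HA: "H \<subseteq> Aut I" and \<alpha>H: "\<alpha> \<in> H" using csubD[OF H] \<alpha> derived_subset by blast+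
  then have \<alpha>A: "\<alpha> \<in> Aut I" by blast
  show "H \<subseteq> Aut I" "inv \<alpha> \<in> H" using HA csubD(5)[OF H \<alpha>H] by blast+
  fix W W' assume W: "openin K2 W" "openin K2 W'" "(e, inv \<alpha> e) \<in> W" "(e, e) \<in> W'"
  have "\<exists>\<delta>\<in>H. meets \<delta> (pre2 id (inv \<alpha>) W') \<and> meets \<delta> (pre2 id (inv \<alpha>) W)"
    by (rule derived_near[OF \<alpha> HA e_in e_in]) (use W \<alpha>A in \<open>simp_all add: openin_pre2_Aut\<close>)
  then obtain \<delta> where "\<delta> \<in> H" "meets (inv \<alpha> \<circ> \<delta>) W'" "meets (inv \<alpha> \<circ> \<delta>) W"
    using meets_left by blast
  then show "\<exists>\<delta>\<in>H. meets \<delta> W \<and> meets \<delta> W'" using csubD(4)[OF H csubD(5)[OF H \<alpha>H]] by blast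
qed

text \<open>The relation ``some net converges to both'' is not transitive in a non-Hausdorff space;
  it is on this group because limits may be taken in two steps, translations being continuous.\<close>

lemma comp_derived:
  assumes H: "csub H" and \<alpha>: "\<alpha> \<in> derived I H" and \<beta>: "\<beta> \<in> derived I H"
  shows "\<alpha> \<circ> \<beta> \<in> derived I H"
proof (rule derivedI)
  have HA: "H \<subseteq> Aut I" and mem: "\<alpha> \<in> H" "\<beta> \<in> H" using csubD[OF H] \<alpha> \<beta> derived_subset by blast+
  then have Aut: "\<alpha> \<in> Aut I" "\<beta> \<in> Aut I" by blast+
  show "H \<subseteq> Aut I" "\<alpha> \<circ> \<beta> \<in> H" using HA csubD(4)[OF H mem] by blast+
  fix W W' assume W: "openin K2 W" "openin K2 W'" "(e, (\<alpha> \<circ> \<beta>) e) \<in> W" "(e, e) \<in> W'"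
  have "\<exists>\<delta>\<in>H. meets \<delta> (pre2 (inv \<beta>) id W) \<and> meets \<delta> W'"
    by (rule derived_near[OF \<alpha> HA, of "\<beta> e" e]) (use W Aut in \<open>simp_all add: openin_pre2_Aut\<close>)
  then obtain \<delta> where \<delta>: "\<delta> \<in> H" "meets (\<delta> \<circ> \<beta>) W" "meets \<delta> W'" using meets_right[OF Aut(2)] by blast
  obtain m m' where m: "m \<in> I" "(m, \<delta> (\<beta> m)) \<in> W" "m' \<in> I" "(m', \<delta> m') \<in> W'"
    using \<delta>(2,3) by (auto simp: meets_def)
  have \<delta>A: "\<delta> \<in> Aut I" using \<delta>(1) HA by blast
  \<comment> \<open>The automorphism \<open>\<delta>\<close> is now frozen. An
    \<open>\<epsilon>\<close> close to \<open>\<beta>\<close> near \<open>m\<close> and to the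
    identity near \<open>m'\<close> makes \<open>\<delta> \<circ> \<epsilon>\<close> meet both sets
    at once.\<close>
  have "\<exists>\<epsilon>\<in>H. meets \<epsilon> (pre2 id \<delta> W) \<and> meets \<epsilon> (pre2 id \<delta> W')"
    by (rule derived_near[OF \<beta> HA, of m m']) (use W Aut \<delta>A m in \<open>simp_all add: openin_pre2_Aut\<close>)
  then obtain \<epsilon> where "\<epsilon> \<in> H" "meets (\<delta> \<circ> \<epsilon>) W" "meets (\<delta> \<circ> \<epsilon>) W'" using meets_left by blast
  then show "\<exists>\<delta>\<in>H. meets \<delta> W \<and> meets \<delta> W'" using csubD(4)[OF H \<delta>(1)] by blast
qed

text \<open>For closedness, some \<open>\<gamma>\<close> in the derived group already has a graph
  meeting \<open>W\<close>. The point where it does so can serve as base point in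
  \<open>derived_near\<close>, with \<open>\<gamma>\<close> in place of
  \<open>\<alpha>\<close>.\<close>

lemma csub_derived:
  assumes H: "csub H"
  shows "csub (derived I H)"
  unfolding csub_def
proof (intro conjI ballI impI)
  have HA: "H \<subseteq> Aut I" using csubD(1)[OF H] .
  show DA: "derived I H \<subseteq> Aut I" using derived_subset[of H] HA by blast
  show "id \<in> derived I H" by (rule id_derived[OF H])
  show "\<alpha> \<circ> \<beta> \<in> derived I H" if "\<alpha> \<in> derived I H" "\<beta> \<in> derived I H" for \<alpha> \<beta>
    by (rule comp_derived[OF H that])
  show "inv \<alpha> \<in> derived I H" if "\<alpha> \<in> derived I H" for \<alpha> by (rule inv_derived[OF H that])
  show "\<alpha> \<in> derived I H" if \<alpha>: "\<alpha> \<in> Aut I" "(e, \<alpha> e) \<in> Qcl (derived I H)" for \<alpha>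
  proof (rule derivedI[OF HA])
    show "\<alpha> \<in> H" using csubD(6)[OF H \<alpha>(1)] \<alpha>(2) Qcl_mono[OF derived_subset] by blast
    fix W W' assume W: "openin K2 W" "openin K2 W'" "(e, \<alpha> e) \<in> W" "(e, e) \<in> W'"
    then obtain \<gamma> where "\<gamma> \<in> derived I H" "meets \<gamma> W"
      using \<alpha>(2) unfolding in_Qcl_iff[OF DA] by blast
    then obtain m where m: "m \<in> I" "(m, \<gamma> m) \<in> W" by (auto simp: meets_def)
    show "\<exists>\<delta>\<in>H. meets \<delta> W \<and> meets \<delta> W'"
      by (rule derived_near[OF \<open>\<gamma> \<in> derived I H\<close> HA m(1) e_in W(1) m(2) W(2,4)])
  qed
qed

lemma derived_mono:
  assumes "H \<subseteq> H'" "H' \<subseteq> Aut I"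
  shows "derived I H \<subseteq> derived I H'"
proof
  fix \<alpha> assume \<alpha>: "\<alpha> \<in> derived I H"
  have HA: "H \<subseteq> Aut I" using assms by blast
  show "\<alpha> \<in> derived I H'"
  proof (rule derivedI[OF assms(2)])
    show "\<alpha> \<in> H'" using \<alpha> derived_subset assms(1) by blast
    fix W W' assume W: "openin K2 W" "openin K2 W'" "(e, \<alpha> e) \<in> W" "(e, e) \<in> W'"
    show "\<exists>\<delta>\<in>H'. meets \<delta> W \<and> meets \<delta> W'"
      using derived_near[OF \<alpha> HA e_in e_in W(1,3,2,4)] assms(1) by blast
  qed
qed

definition normalizes where
  "normalizes A H \<longleftrightarrow> (\<forall>a\<in>A. \<forall>h\<in>H. a \<circ> h \<circ> inv a \<in> H)"

lemma normalizes_derived: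
  assumes H: "csub H" and A: "A \<subseteq> Aut I" "normalizes A H"
  shows "normalizes A (derived I H)"
  unfolding normalizes_def
proof (intro ballI)
  fix a h assume a: "a \<in> A" and h: "h \<in> derived I H"
  have HA: "H \<subseteq> Aut I" using csubD(1)[OF H] .
  have Aut: "a \<in> Aut I" "h \<in> Aut I" "h \<in> H" using a h A HA derived_subset by blast+
  show "a \<circ> h \<circ> inv a \<in> derived I H"
  proof (rule derivedI[OF HA])
    show "a \<circ> h \<circ> inv a \<in> H" using A(2) a Aut(3) by (simp add: normalizes_def)
    fix W W' assume W: "openin K2 W" "openin K2 W'" "(e, (a \<circ> h \<circ> inv a) e) \<in> W" "(e, e) \<in> W'"
    have "\<exists>\<delta>\<in>H. meets \<delta> (pre2 a a W) \<and> meets \<delta> (pre2 a a W')"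
      by (rule derived_near[OF h HA, of "inv a e" "inv a e"])
        (use W Aut in \<open>simp_all add: openin_pre2_Aut\<close>)
    then obtain \<delta> where "\<delta> \<in> H" "meets (a \<circ> \<delta> \<circ> inv a) W" "meets (a \<circ> \<delta> \<circ> inv a) W'"
      using meets_conj[OF Aut(1)] by blast
    then show "\<exists>\<delta>\<in>H. meets \<delta> W \<and> meets \<delta> W'" using A(2) a unfolding normalizes_def by blast
  qed
qed

section \<open>Products of groups and the stable derived group\<close>

definition gprod where
  "gprod H A = {h \<circ> a | h a. h \<in> H \<and> a \<in> A}"

lemma gprodI: "h \<in> H \<Longrightarrow> a \<in> A \<Longrightarrow> h \<circ> a \<in> gprod H A"
  by (auto simp: gprod_def)

lemma gprod_mono: "H \<subseteq> H' \<Longrightarrow> gprod H A \<subseteq> gprod H' A"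
  by (auto simp: gprod_def)

lemma gprod_left: "csub A \<Longrightarrow> H \<subseteq> gprod H A"
  using gprodI[of _ H id A] csubD(3)[of A] by auto

lemma gprod_right: "csub H \<Longrightarrow> A \<subseteq> gprod H A"
  using gprodI[of id H _ A] csubD(3)[of H] by auto

lemma gprod_Aut: "csub H \<Longrightarrow> csub A \<Longrightarrow> gprod H A \<subseteq> Aut I"
  using csubD(2) by (auto simp: gprod_def)

text \<open>The intermediate points \<open>a i (mm i)\<close> converge along the ultrafilter because
  \<open>I\<close> is compact. Their limit \<open>k\<close> splits the difference
  \<open>kap m n\<close> into a factor from \<open>A\<close> and one from \<open>H\<close>.\<close>

lemma factor_limit:
  assumes H: "csub H" and A: "csub A" and F: "is_ultrafilter F"
    and ev: "eventually (\<lambda>i. h i \<in> H) F" "eventually (\<lambda>i. a i \<in> A) F" "eventually (\<lambda>i. mm i \<in> I) F"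
    and lim: "limitin K mm m F" "limitin K (\<lambda>i. h i (a i (mm i))) n F"
  shows "\<exists>k\<in>I. limitin K (\<lambda>i. a i (mm i)) k F \<and> kap m k \<in> A \<and> kap k n \<in> H"
proof -
  have "eventually (\<lambda>i. a i (mm i) \<in> I) F"
    using ev(2,3) by eventually_elim (rule Aut_in[OF csubD(2)[OF A]])
  then have k: "limitin K (\<lambda>i. a i (mm i)) (ulim F (\<lambda>i. a i (mm i))) F"
    by (rule limitin_K[OF F])
  then have "ulim F (\<lambda>i. a i (mm i)) \<in> I" by (simp add: limitin_def)
  moreover have "kap m (ulim F (\<lambda>i. a i (mm i))) \<in> A" by (rule kap_csub[OF A F ev(2) lim(1) k])
  moreover have "kap (ulim F (\<lambda>i. a i (mm i))) n \<in> H" by (rule kap_csub[OF H F ev(1) k lim(2)])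
  ultimately show ?thesis using k by blast
qed

lemma inv_comp: "\<alpha> \<in> Aut I \<Longrightarrow> \<beta> \<in> Aut I \<Longrightarrow> inv (\<alpha> \<circ> \<beta>) = inv \<beta> \<circ> inv \<alpha>"
  using Aut_bij o_inv_distrib by blast

lemma normalizes_inv:
  assumes "csub A" "normalizes A H" "a \<in> A" "h \<in> H"
  shows "inv a \<circ> h \<circ> a \<in> H"
proof -
  have "inv a \<circ> h \<circ> inv (inv a) \<in> H"
    using assms csubD(5)[OF assms(1,3)] unfolding normalizes_def by blast
  then show ?thesis using csubD(2)[OF assms(1,3)] by simp
qed

lemma csub_gprod:
  assumes H: "csub H" and A: "csub A" and norm: "normalizes A H"
  shows "csub (gprod H A)"
  unfolding csub_def
proof (intro conjI ballI impI)
  show PA: "gprod H A \<subseteq> Aut I" by (rule gprod_Aut[OF H A])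
  show "id \<in> gprod H A" using gprodI[OF csubD(3)[OF H] csubD(3)[OF A]] by simp
  show "\<alpha> \<circ> \<beta> \<in> gprod H A" if \<alpha>: "\<alpha> \<in> gprod H A" and \<beta>: "\<beta> \<in> gprod H A" for \<alpha> \<beta>
  proof -
    obtain h a h' a' where *: "\<alpha> = h \<circ> a" "h \<in> H" "a \<in> A" "\<beta> = h' \<circ> a'" "h' \<in> H" "a' \<in> A"
      using \<alpha> \<beta> by (auto simp: gprod_def)
    have "inv a (a x) = x" for x using csubD(2)[OF A *(3)] by simp
    then have "\<alpha> \<circ> \<beta> = (h \<circ> (a \<circ> h' \<circ> inv a)) \<circ> (a \<circ> a')" by (auto simp: *)
    moreover have "a \<circ> h' \<circ> inv a \<in> H" using norm * by (simp add: normalizes_def)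
    ultimately show ?thesis using gprodI csubD(4)[OF H] csubD(4)[OF A] * by metis
  qed
  show "inv \<alpha> \<in> gprod H A" if \<alpha>: "\<alpha> \<in> gprod H A" for \<alpha>
  proof -
    obtain h a where *: "\<alpha> = h \<circ> a" "h \<in> H" "a \<in> A" using \<alpha> by (auto simp: gprod_def)
    have Aut: "h \<in> Aut I" "a \<in> Aut I" using * csubD(2)[OF H] csubD(2)[OF A] by blast+
    have "inv \<alpha> = (inv a \<circ> inv h \<circ> a) \<circ> inv a"
      using Aut by (auto simp: * inv_comp)
    moreover have "inv a \<circ> inv h \<circ> a \<in> H"
      by (rule normalizes_inv[OF A norm *(3) csubD(5)[OF H *(2)]])
    ultimately show ?thesis using gprodI csubD(5)[OF A *(3)] by metis
  qed
  show "\<alpha> \<in> gprod H A" if \<alpha>: "\<alpha> \<in> Aut I" "(e, \<alpha> e) \<in> Qcl (gprod H A)" for \<alpha>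
  proof -
    obtain F where F: "is_ultrafilter F" "eventually (\<lambda>x. x \<in> (\<Union>\<alpha>\<in>gprod H A. Gamma I \<alpha>)) F"
      "limitin K2 id (e, \<alpha> e) F"
      using ex_ultrafilter_closure_of \<alpha>(2) unfolding Qcl_def by metis
    have "\<exists>h a. z \<in> (\<Union>\<alpha>\<in>gprod H A. Gamma I \<alpha>) \<longrightarrow> h \<in> H \<and> a \<in> A \<and> fst z \<in> I \<and> snd z = h (a (fst z))" for z
      unfolding gprod_def Gamma_def by fastforce
    then obtain h a where ha: "\<And>z. z \<in> (\<Union>\<alpha>\<in>gprod H A. Gamma I \<alpha>) \<Longrightarrow>
        h z \<in> H \<and> a z \<in> A \<and> fst z \<in> I \<and> snd z = h z (a z (fst z))" by metis
    have ev: "eventually (\<lambda>z. h z \<in> H) F" "eventually (\<lambda>z. a z \<in> A) F" "eventually (\<lambda>z. fst z \<in> I) F"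
      "eventually (\<lambda>z. snd z = h z (a z (fst z))) F"
      using F(2) by (eventually_elim, use ha in blast)+
    have lim: "limitin K fst e F" "limitin K snd (\<alpha> e) F"
      using F(3) by (simp_all add: limitin_pairwise o_def)
    have lim': "limitin K (\<lambda>z. h z (a z (fst z))) (\<alpha> e) F"
      by (rule limitin_transform_eventually[OF ev(4) lim(2)])
    obtain k where k: "k \<in> I" "kap e k \<in> A" "kap k (\<alpha> e) \<in> H"
      using factor_limit[OF H A F(1) ev(1-3) lim(1) lim'] by blast
    have "\<alpha> = kap k (\<alpha> e) \<circ> kap e k"
      using kap_trans[OF e_in k(1), of "\<alpha> e"] \<alpha>(1) by simp
    then show ?thesis using gprodI[OF k(3,2)] by simp
  qed
qed

text \<open>A net with two limits, translated on the left by the inverse of one of them, has the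
  identity as a limit.\<close>

lemma TC_derived:
  assumes H: "csub H" and F: "F \<noteq> bot" "eventually (\<lambda>i. h i \<in> H) F"
    and TC: "TC F h h1" "TC F h h2" and mem: "h1 \<in> H" "h2 \<in> H"
  shows "inv h2 \<circ> h1 \<in> derived I H"
proof (rule derivedI)
  show HA: "H \<subseteq> Aut I" using csubD(1)[OF H] .
  have hA: "h1 \<in> Aut I" "h2 \<in> Aut I" using mem HA by blast+
  show "inv h2 \<circ> h1 \<in> H" using csubD(4)[OF H csubD(5)[OF H mem(2)] mem(1)] .
  have TC1: "TC F (\<lambda>i. inv h2 \<circ> h i) (inv h2 \<circ> h1)" and TC2: "TC F (\<lambda>i. inv h2 \<circ> h i) id"
    using TC_left[OF TC(1) hA(1), of "inv h2"] TC_left[OF TC(2) hA(2), of "inv h2"] hA by simp_all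
  fix W W' assume W: "openin K2 W" "openin K2 W'" "(e, (inv h2 \<circ> h1) e) \<in> W" "(e, e) \<in> W'"
  have "eventually (\<lambda>i. meets (inv h2 \<circ> h i) W) F" "eventually (\<lambda>i. meets (inv h2 \<circ> h i) W') F"
    using TCD[OF TC1 W(1,3)] TCD[OF TC2 W(2)] W(4) by simp_all
  then have "eventually (\<lambda>i. h i \<in> H \<and> meets (inv h2 \<circ> h i) W \<and> meets (inv h2 \<circ> h i) W') F"
    using F(2) by eventually_elim blast
  from eventually_happens'[OF F(1) this]
  show "\<exists>\<delta>\<in>H. meets \<delta> W \<and> meets \<delta> W'" using csubD(4)[OF H csubD(5)[OF H mem(2)]] by blast
qed

text \<open>Factor the net as \<open>h i \<circ> a i\<close> and apply \<open>factor_limit\<close>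
  to both families of points. One and the same net \<open>h\<close> then has two limits
  \<open>h1\<close> and \<open>h2\<close>, so \<open>inv h2 \<circ> h1\<close> lies in the derived
  group of \<open>H\<close>. Since \<open>h2\<close> also belongs to \<open>A\<close>, conjugation
  by it preserves that group.\<close>

lemma derived_gprod:
  assumes H: "csub H" and A: "csub A" and norm: "normalizes A H"
  shows "derived I (gprod H A) \<subseteq> gprod (derived I H) A"
proof
  fix \<gamma> assume \<gamma>: "\<gamma> \<in> derived I (gprod H A)"
  have HA: "H \<subseteq> Aut I" using csubD(1)[OF H] .
  have \<gamma>A: "\<gamma> \<in> Aut I" using \<gamma> derived_subset gprod_Aut[OF H A] by blast
  from \<gamma> obtain F :: "(('g filter \<Rightarrow> 'g filter) \<times> ('g filter \<Rightarrow> 'g filter) \<times> ('g filter \<Rightarrow> 'g filter)) filter"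
    and \<delta> mm mm' where F: "is_ultrafilter F" "eventually (\<lambda>i. \<delta> i \<in> gprod H A) F"
    and lim: "limitin K mm e F" "limitin K (\<lambda>i. \<delta> i (mm i)) (\<gamma> e) F"
    "limitin K mm' e F" "limitin K (\<lambda>i. \<delta> i (mm' i)) e F" by (rule derivedE)
  have "\<exists>h a. \<delta> i \<in> gprod H A \<longrightarrow> h \<in> H \<and> a \<in> A \<and> \<delta> i = h \<circ> a" for i
    by (auto simp: gprod_def)
  then obtain h a where ha: "\<And>i. \<delta> i \<in> gprod H A \<Longrightarrow> h i \<in> H \<and> a i \<in> A \<and> \<delta> i = h i \<circ> a i" by metis
  have ev: "eventually (\<lambda>i. h i \<in> H) F" "eventually (\<lambda>i. a i \<in> A) F" "eventually (\<lambda>i. \<delta> i = h i \<circ> a i) F"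
    using F(2) by (eventually_elim, use ha in blast)+
  have top: "openin K I" using openin_topspace[of K] by simp
  have evI: "eventually (\<lambda>i. mm i \<in> I) F" "eventually (\<lambda>i. mm' i \<in> I) F"
    using lim(1,3) top e_in by (auto simp: limitin_def)
  have lim2: "limitin K (\<lambda>i. h i (a i (mm i))) (\<gamma> e) F" "limitin K (\<lambda>i. h i (a i (mm' i))) e F"
    by (rule limitin_transform_eventually[OF _ lim(2)], use ev(3) in eventually_elim, simp)
      (rule limitin_transform_eventually[OF _ lim(4)], use ev(3) in eventually_elim, simp)
  obtain k where k: "k \<in> I" "limitin K (\<lambda>i. a i (mm i)) k F" "kap e k \<in> A" "kap k (\<gamma> e) \<in> H"
    using factor_limit[OF H A F(1) ev(1,2) evI(1) lim(1) lim2(1)] by blast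
  obtain k' where k': "k' \<in> I" "limitin K (\<lambda>i. a i (mm' i)) k' F" "kap e k' \<in> A" "kap k' e \<in> H"
    using factor_limit[OF H A F(1) ev(1,2) evI(2) lim(3) lim2(2)] by blast
  define h1 where "h1 = kap k (\<gamma> e)"
  define h2 where "h2 = kap k' e"
  have hH: "h1 \<in> H" "h2 \<in> H" and hA: "h1 \<in> Aut I" "h2 \<in> Aut I"
    using k k' HA by (auto simp: h1_def h2_def)
  have evA: "eventually (\<lambda>i. h i \<in> Aut I) F"
    using ev(1) by eventually_elim (use HA in blast)
  have TC: "TC F h h1" "TC F h h2"
    unfolding h1_def h2_def
    by (rule TC_limit[OF evA k(2) lim2(1)], rule TC_limit[OF evA k'(2) lim2(2)])
  have \<phi>: "inv h2 \<circ> h1 \<in> derived I H"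
    by (rule TC_derived[OF H ultrafilter_neq_bot[OF F(1)] ev(1) TC hH])
  \<comment> \<open>The second family of points runs from \<open>e\<close> back to \<open>e\<close>.
    Hence its \<open>H\<close>-factor \<open>h2\<close> is inverse to its \<open>A\<close>-factor
    and lies in both groups.\<close>
  have inv2: "inv (kap e k') = h2" unfolding h2_def using kap_sym[OF e_in k'(1)] by simp
  then have h2A: "h2 \<in> A" using csubD(5)[OF A k'(3)] by simp
  have "h2 \<circ> (inv h2 \<circ> h1) \<circ> inv h2 \<in> derived I H"
    using normalizes_derived[OF H csubD(1)[OF A] norm] h2A \<phi> unfolding normalizes_def by blast
  moreover have "h2 \<circ> kap e k \<in> A" by (rule csubD(4)[OF A h2A k(3)])
  moreover have "\<gamma> = (h2 \<circ> (inv h2 \<circ> h1) \<circ> inv h2) \<circ> (h2 \<circ> kap e k)"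
  proof -
    have "\<gamma> = h1 \<circ> kap e k"
      unfolding h1_def using kap_trans[OF e_in k(1), of "\<gamma> e"] \<gamma>A by simp
    then show ?thesis using hA by (simp add: fun_eq_iff)
  qed
  ultimately show "\<gamma> \<in> gprod (derived I H) A" using gprodI by metis
qed

text \<open>A factorization of \<open>\<gamma>\<close> is recorded by the value at \<open>e\<close>
  of its \<open>A\<close>-factor. The closures of these sets of values form a chain of nonempty
  closed subsets of \<open>I\<close>, and a common point \<open>n\<close> yields the factorization
  \<open>kap n (\<gamma> e) \<circ> kap e n\<close>, whose first factor lies in every member of
  \<open>C\<close>.\<close>

lemma gprod_chain:
  assumes C: "\<And>H. H \<in> C \<Longrightarrow> csub H" "C \<noteq> {}" "Complete_Partial_Order.chain (\<subseteq>) C"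
    and A: "csub A" and \<gamma>: "\<And>H. H \<in> C \<Longrightarrow> \<gamma> \<in> gprod H A"
  shows "\<gamma> \<in> gprod (\<Inter>C) A"
proof -
  obtain H0 where "H0 \<in> C" using C(2) by blast
  then have \<gamma>A: "\<gamma> \<in> Aut I" using \<gamma> gprod_Aut[OF C(1) A] by blast
  define S where "S H = {a e | a. a \<in> A \<and> \<gamma> \<circ> inv a \<in> H}" for H
  have SI: "S H \<subseteq> I" for H using csubD(2)[OF A] by (auto simp: S_def)
  have "\<Inter>((\<lambda>H. K closure_of S H) ` C) \<noteq> {}"
  proof (rule chain_Inter_nonempty[OF compact_K])
    show "(\<lambda>H. K closure_of S H) ` C \<noteq> {}" using C(2) by blast
    fix T assume "T \<in> (\<lambda>H. K closure_of S H) ` C"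
    then obtain H where H: "H \<in> C" "T = K closure_of S H" by blast
    obtain h a where ha: "h \<in> H" "a \<in> A" "\<gamma> = h \<circ> a" using \<gamma>[OF H(1)] by (auto simp: gprod_def)
    have "a (inv a x) = x" for x using csubD(2)[OF A ha(2)] by simp
    then have "\<gamma> \<circ> inv a = h" by (auto simp: ha(3))
    then have "a e \<in> S H" using ha by (auto simp: S_def)
    moreover have "S H \<subseteq> K closure_of S H" using SI by (intro closure_of_subset) simp
    ultimately show "closedin K T \<and> T \<noteq> {}" using H(2) by auto
  next
    fix T T' assume "T \<in> (\<lambda>H. K closure_of S H) ` C" "T' \<in> (\<lambda>H. K closure_of S H) ` C"
    then obtain H H' where H: "H \<in> C" "H' \<in> C" "T = K closure_of S H" "T' = K closure_of S H'" by blast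
    have mono: "S H \<subseteq> S H'" if "H \<subseteq> H'" for H H' using that by (auto simp: S_def)
    have "H \<subseteq> H' \<or> H' \<subseteq> H" using C(3) H by (simp add: chain_def)
    then show "T \<subseteq> T' \<or> T' \<subseteq> T" unfolding H using closure_of_mono mono by metis
  qed
  then obtain n where n: "\<And>H. H \<in> C \<Longrightarrow> n \<in> K closure_of S H" by blast
  have key: "n \<in> I \<and> kap e n \<in> A \<and> kap n (\<gamma> e) \<in> H" if H: "H \<in> C" for H
  proof -
    obtain F where F: "is_ultrafilter F" "eventually (\<lambda>x. x \<in> S H) F" "limitin K id n F"
      using ex_ultrafilter_closure_of[OF n[OF H]] by blast
    have "\<exists>a. x \<in> S H \<longrightarrow> a \<in> A \<and> \<gamma> \<circ> inv a \<in> H \<and> x = a e" for x by (auto simp: S_def)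
    then obtain a where a: "\<And>x. x \<in> S H \<Longrightarrow> a x \<in> A \<and> \<gamma> \<circ> inv (a x) \<in> H \<and> x = a x e" by metis
    have ev: "eventually (\<lambda>x. a x \<in> A) F" "eventually (\<lambda>x. \<gamma> \<circ> inv (a x) \<in> H) F"
      "eventually (\<lambda>x. x = a x e) F"
      using F(2) by (eventually_elim, use a in blast)+
    have ev4: "eventually (\<lambda>x. \<gamma> e = (\<gamma> \<circ> inv (a x)) (id x)) F"
      using ev(1,3)
    proof eventually_elim
      case (elim x)
      have "inv (a x) (a x e) = e" using csubD(2)[OF A elim(1)] by simp
      then show ?case using elim(2) by simp
    qed
    have const: "limitin K (\<lambda>_. c) c F" if "c \<in> I" for c using that by simp
    have lim1: "limitin K (\<lambda>x. a x e) n F"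
      by (rule limitin_transform_eventually[OF _ F(3)]) (use ev(3) in simp)
    have lim2: "limitin K (\<lambda>x. (\<gamma> \<circ> inv (a x)) (id x)) (\<gamma> e) F"
      by (rule limitin_transform_eventually[OF ev4]) (use const[of "\<gamma> e"] \<gamma>A in simp)
    have "kap e n \<in> A" by (rule kap_csub[OF A F(1) ev(1) const[OF e_in] lim1])
    moreover have "kap n (\<gamma> e) \<in> H" by (rule kap_csub[OF C(1)[OF H] F(1) ev(2) F(3) lim2])
    moreover have "n \<in> I" using F(3) by (simp add: limitin_def)
    ultimately show ?thesis by blast
  qed
  have nI: "n \<in> I" "kap e n \<in> A" using key[OF \<open>H0 \<in> C\<close>] by auto
  have "\<gamma> = kap n (\<gamma> e) \<circ> kap e n"
    using kap_trans[OF e_in nI(1), of "\<gamma> e"] \<gamma>A by simp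
  moreover have "kap n (\<gamma> e) \<in> \<Inter>C" using key by blast
  ultimately show ?thesis using gprodI[OF _ nI(2)] by metis
qed

lemma csub_Inter:
  assumes "\<And>H. H \<in> C \<Longrightarrow> csub H" "C \<noteq> {}"
  shows "csub (\<Inter>C)"
  unfolding csub_def
proof (intro conjI ballI impI)
  obtain H0 where H0: "H0 \<in> C" using assms(2) by blast
  show "\<Inter>C \<subseteq> Aut I" using csubD(1)[OF assms(1)[OF H0]] H0 by blast
  show "id \<in> \<Inter>C" using csubD(3)[OF assms(1)] by blast
  show "\<alpha> \<circ> \<beta> \<in> \<Inter>C" if "\<alpha> \<in> \<Inter>C" "\<beta> \<in> \<Inter>C" for \<alpha> \<beta> using csubD(4)[OF assms(1)] that by blast
  show "inv \<alpha> \<in> \<Inter>C" if "\<alpha> \<in> \<Inter>C" for \<alpha> using csubD(5)[OF assms(1)] that by blast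
  show "\<alpha> \<in> \<Inter>C" if "\<alpha> \<in> Aut I" "(e, \<alpha> e) \<in> Qcl (\<Inter>C)" for \<alpha>
  proof
    fix H assume H: "H \<in> C"
    have "Qcl (\<Inter>C) \<subseteq> Qcl H" by (rule Qcl_mono) (use H in blast)
    then show "\<alpha> \<in> H" using csubD(6)[OF assms(1)[OF H] that(1)] that(2) by blast
  qed
qed

lemma descent_csub:
  assumes "csub F" "csub A" "A \<subseteq> F" "H \<in> descent (derived I) F"
  shows "csub H \<and> normalizes A H"
  using assms(4)
proof induction
  case base
  have "a \<circ> h \<circ> inv a \<in> F" if "a \<in> A" "h \<in> F" for a h
    using that csubD(4,5)[OF assms(1)] assms(3) by blast
  then show ?case using assms(1) by (simp add: normalizes_def)
next
  case (step S)
  then show ?case using csub_derived normalizes_derived[OF _ csubD(1)[OF assms(2)]] by blast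
next
  case (lim C)
  have "csub (\<Inter>C)" by (rule csub_Inter) (use lim in blast)+
  moreover have "normalizes A (\<Inter>C)" using lim.IH unfolding normalizes_def by blast
  ultimately show ?case by blast
qed

lemma F_infty_csub: "csub F \<Longrightarrow> csub (F_infty I F)"
  and derived_F_infty: "derived I (F_infty I F) = F_infty I F"
  and F_infty_subset: "F_infty I F \<subseteq> F"
proof -
  have "F_infty I F \<in> descent (derived I) F" "derived I (F_infty I F) = F_infty I F"
    using descent_fixpoint[of "derived I" F, OF derived_subset] by (simp_all add: F_infty_def F_seq_eq_descent)
  then show "derived I (F_infty I F) = F_infty I F" "csub F \<Longrightarrow> csub (F_infty I F)" "F_infty I F \<subseteq> F"
    using descent_csub[of F F] descent_subset[of "derived I", OF derived_subset] by blast+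
qed

text \<open>Induction along the derived series of \<open>F\<close>. If \<open>H\<close> lies in
  \<open>S A\<close>, then \<open>H \<subseteq> H' A \<subseteq> (S A)' A \<subseteq> S' A\<close>
  by \<open>derived_gprod\<close>, primes denoting derived groups; intersections are handled by
  \<open>gprod_chain\<close>.\<close>

lemma subgroup_F_infty:
  assumes F: "csub F" and A: "csub A" "A \<subseteq> F" and H: "H \<subseteq> F" "H \<subseteq> gprod (derived I H) A"
  shows "H \<subseteq> gprod (F_infty I F) A"
proof -
  have "H \<subseteq> gprod S A" if "S \<in> descent (derived I) F" for S
    using that
  proof induction
    case base
    show ?case using H(1) gprod_left[OF A(1)] by blast
  next
    case (step S)
    have S: "csub S" "normalizes A S" using descent_csub[OF F A step(1)] by auto
    have "H \<subseteq> gprod (derived I (gprod S A)) A"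
      using H(2) gprod_mono[OF derived_mono[OF step(2) gprod_Aut[OF S(1) A(1)]]] by blast
    also have "\<dots> \<subseteq> gprod (gprod (derived I S) A) A"
      by (rule gprod_mono[OF derived_gprod[OF S(1) A(1) S(2)]])
    also have "\<dots> \<subseteq> gprod (derived I S) A"
    proof
      fix x assume "x \<in> gprod (gprod (derived I S) A) A"
      then obtain h a b where "h \<in> derived I S" "a \<in> A" "b \<in> A" "x = h \<circ> (a \<circ> b)"
        by (auto simp: gprod_def o_assoc)
      then show "x \<in> gprod (derived I S) A" using gprodI csubD(4)[OF A(1)] by blast
    qed
    finally show ?case .
  next
    case (lim C)
    show ?case
    proof
      fix \<gamma> assume \<gamma>: "\<gamma> \<in> H"
      show "\<gamma> \<in> gprod (\<Inter>C) A"
      proof (rule gprod_chain[OF _ lim.hyps(2,3) A(1)])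
        show "csub S" if "S \<in> C" for S using descent_csub[OF F A lim(1)[OF that]] by blast
        show "\<gamma> \<in> gprod S A" if "S \<in> C" for S using lim.IH[OF that] \<gamma> by blast
      qed
    qed
  qed
  moreover have "F_infty I F \<in> descent (derived I) F"
    using descent_fixpoint[of "derived I" F, OF derived_subset] by (simp add: F_infty_def F_seq_eq_descent)
  ultimately show ?thesis by blast
qed

end

section \<open>Quotient flows\<close>

locale minimal_ideal_top = minimal_ideal I for I :: "'g::topological_group_add filter set"
begin

text \<open>Invariant closed equivalence relations on \<open>I\<close>. They stand for the quotient
  flows, so that flows can be compared by inclusion and inverse limits become intersections.\<close>

definition icer :: "('g filter \<times> 'g filter) set \<Rightarrow> bool" where
  "icer R \<longleftrightarrow> closedin K2 R \<and> (\<forall>m\<in>I. (m, m) \<in> R) \<and> (\<forall>x y. (x, y) \<in> R \<longrightarrow> (y, x) \<in> R) \<and>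
     (\<forall>x y z. (x, y) \<in> R \<longrightarrow> (y, z) \<in> R \<longrightarrow> (x, z) \<in> R) \<and>
     (\<forall>t x y. (x, y) \<in> R \<longrightarrow> (act t x, act t y) \<in> R)"

lemma icerD:
  assumes "icer R"
  shows "closedin K2 R" "m \<in> I \<Longrightarrow> (m, m) \<in> R" "(x, y) \<in> R \<Longrightarrow> (y, x) \<in> R"
    "(x, y) \<in> R \<Longrightarrow> (y, z) \<in> R \<Longrightarrow> (x, z) \<in> R" "(x, y) \<in> R \<Longrightarrow> (act t x, act t y) \<in> R"
    "(x, y) \<in> R \<Longrightarrow> x \<in> I" "(x, y) \<in> R \<Longrightarrow> y \<in> I"
proof -
  note R = assms[unfolded icer_def]
  show "closedin K2 R" by (rule conjunct1[OF R])
  note R2 = conjunct2[OF R] and R3 = conjunct2[OF conjunct2[OF R]]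
  note R4 = conjunct2[OF R3] and R5 = conjunct2[OF conjunct2[OF R3]]
  show "m \<in> I \<Longrightarrow> (m, m) \<in> R" by (rule bspec[OF conjunct1[OF R2]])
  show "(x, y) \<in> R \<Longrightarrow> (y, x) \<in> R" by (rule conjunct1[OF R3, rule_format])
  show "(x, y) \<in> R \<Longrightarrow> (y, z) \<in> R \<Longrightarrow> (x, z) \<in> R" by (rule conjunct1[OF R4, rule_format])
  show "(x, y) \<in> R \<Longrightarrow> (act t x, act t y) \<in> R" by (rule R5[rule_format])
  show "(x, y) \<in> R \<Longrightarrow> x \<in> I" "(x, y) \<in> R \<Longrightarrow> y \<in> I"
    using closedin_subset[OF conjunct1[OF R]] by auto
qed

lemma icer_mul: "icer R \<Longrightarrow> (m, n) \<in> R \<Longrightarrow> p \<in> betaT \<Longrightarrow> (p \<odot> m, p \<odot> n) \<in> R"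
  by (rule closedin_orbit2[OF icerD(1) _ _ icerD(5)])

lemma icer_Inter:
  assumes "\<And>R. R \<in> C \<Longrightarrow> icer R" "C \<noteq> {}"
  shows "icer (\<Inter>C)"
proof -
  have "closedin K2 (\<Inter>C)" by (rule closedin_Inter[OF assms(2)]) (rule icerD(1)[OF assms(1)])
  then show ?thesis
    unfolding icer_def Inter_iff
  proof (intro conjI ballI allI impI)
    fix R assume R: "R \<in> C"
    note D = icerD[OF assms(1)[OF R]]
    show "(m, m) \<in> R" if "m \<in> I" for m using D(2) that .
    show "(y, x) \<in> R" if "\<forall>R\<in>C. (x, y) \<in> R" for x y using D(3) that R by blast
    show "(x, z) \<in> R" if "\<forall>R\<in>C. (x, y) \<in> R" "\<forall>R\<in>C. (y, z) \<in> R" for x y z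
      using D(4)[of x y z] that R by blast
    show "(act t x, act t y) \<in> R" if "\<forall>R\<in>C. (x, y) \<in> R" for t x y using D(5) that R by blast
  qed
qed

section \<open>Groups of quotients\<close>

definition grp where
  "grp R = {\<alpha> \<in> Aut I. (e, \<alpha> e) \<in> R}"

text \<open>Pairs of \<open>R\<close> remain in \<open>R\<close> under left multiplication by
  ultrafilters, and every point of \<open>I\<close> is a left multiple of any other.\<close>

lemma grp_iff:
  assumes "icer R" "m \<in> I"
  shows "\<alpha> \<in> grp R \<longleftrightarrow> \<alpha> \<in> Aut I \<and> (m, \<alpha> m) \<in> R"
proof -
  have move: "(n, \<alpha> n) \<in> R" if h: "\<alpha> \<in> Aut I" "m \<in> I" "(m, \<alpha> m) \<in> R" "n \<in> I" for m n
  proof -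
    obtain p where p: "p \<in> I" "n = p \<odot> m" using ex_left_factor[OF h(4,2)] by blast
    have "\<alpha> n = p \<odot> \<alpha> m" using Aut_mul[OF h(1) I_sub[OF p(1)] h(2)] p(2) by simp
    then show ?thesis using icer_mul[OF assms(1) h(3) I_sub[OF p(1)]] p(2) by simp
  qed
  show ?thesis unfolding grp_def using move[of e m] move[of m e] assms(2) by auto
qed

lemma csub_grp:
  assumes R: "icer R"
  shows "csub (grp R)"
  unfolding csub_def
proof (intro conjI ballI impI)
  show "grp R \<subseteq> Aut I" by (auto simp: grp_def)
  show "id \<in> grp R" using icerD(2)[OF R e_in] by (simp add: grp_def)
  show "\<alpha> \<circ> \<beta> \<in> grp R" if "\<alpha> \<in> grp R" "\<beta> \<in> grp R" for \<alpha> \<beta>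
  proof -
    have A: "\<alpha> \<in> Aut I" "\<beta> \<in> Aut I" using that by (auto simp: grp_def)
    have "(\<beta> e, \<alpha> (\<beta> e)) \<in> R" using grp_iff[OF R, of "\<beta> e" \<alpha>] that(1) A by simp
    moreover have "(e, \<beta> e) \<in> R" using that(2) by (simp add: grp_def)
    ultimately show ?thesis using icerD(4)[OF R] A by (auto simp: grp_def)
  qed
  show "inv \<alpha> \<in> grp R" if "\<alpha> \<in> grp R" for \<alpha>
  proof -
    have A: "\<alpha> \<in> Aut I" using that by (auto simp: grp_def)
    have "(inv \<alpha> e, \<alpha> (inv \<alpha> e)) \<in> R" using grp_iff[OF R, of "inv \<alpha> e" \<alpha>] that A by simp
    then show ?thesis using icerD(3)[OF R] A by (auto simp: grp_def)
  qed
  show "\<alpha> \<in> grp R" if "\<alpha> \<in> Aut I" "(e, \<alpha> e) \<in> Qcl (grp R)" for \<alpha>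
  proof -
    have "Qcl (grp R) \<subseteq> R"
      by (rule Qcl_minimal[OF icerD(1)[OF R]]) (use grp_iff[OF R] in blast)
    then show ?thesis using that by (auto simp: grp_def)
  qed
qed

lemma kap_grp:
  assumes "icer R" "(m, n) \<in> R"
  shows "kap m n \<in> grp R"
proof -
  have mn: "m \<in> I" "n \<in> I" using icerD(6,7)[OF assms] .
  have "(e \<odot> m, kap m n (e \<odot> m)) \<in> R"
    using icer_mul[OF assms e_betaT] kap_eq[OF mn] by simp
  then show ?thesis using grp_iff[OF assms(1), of "e \<odot> m"] mn by simp
qed

text \<open>Classes are kept as subsets of \<open>I\<close>, so all quotients share the type
  \<open>'g filter set\<close> prescribed by \<open>is_PI\<close>.\<close>

definition cls where
  "cls R m = {n. (m, n) \<in> R}"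

lemma cls_eq_iff:
  assumes "icer R" "m \<in> I" "n \<in> I"
  shows "cls R m = cls R n \<longleftrightarrow> (m, n) \<in> R"
  unfolding cls_def using icerD(2-4)[OF assms(1)] assms(2,3) by blast

definition QT where
  "QT R = topology (\<lambda>U. U \<subseteq> cls R ` I \<and> openin K {m \<in> I. cls R m \<in> U})"

lemma openin_QT: "openin (QT R) U \<longleftrightarrow> U \<subseteq> cls R ` I \<and> openin K {m \<in> I. cls R m \<in> U}"
proof -
  have "istopology (\<lambda>U. U \<subseteq> cls R ` I \<and> openin K {m \<in> I. cls R m \<in> U})"
    unfolding istopology_def
  proof (intro conjI allI impI)
    fix S T assume "S \<subseteq> cls R ` I \<and> openin K {m \<in> I. cls R m \<in> S}"
      "T \<subseteq> cls R ` I \<and> openin K {m \<in> I. cls R m \<in> T}"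
    moreover have "{m \<in> I. cls R m \<in> S \<inter> T} = {m \<in> I. cls R m \<in> S} \<inter> {m \<in> I. cls R m \<in> T}" by blast
    ultimately show "S \<inter> T \<subseteq> cls R ` I" "openin K {m \<in> I. cls R m \<in> S \<inter> T}" by (auto simp only: openin_Int)
  next
    fix \<K> assume \<K>: "\<forall>U\<in>\<K>. U \<subseteq> cls R ` I \<and> openin K {m \<in> I. cls R m \<in> U}"
    then show "\<Union>\<K> \<subseteq> cls R ` I" by blast
    have "{m \<in> I. cls R m \<in> \<Union>\<K>} = (\<Union>U\<in>\<K>. {m \<in> I. cls R m \<in> U})" by blast
    moreover have "openin K (\<Union>U\<in>\<K>. {m \<in> I. cls R m \<in> U})" using \<K> by blast
    ultimately show "openin K {m \<in> I. cls R m \<in> \<Union>\<K>}" by simp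
  qed
  then show ?thesis by (simp add: QT_def)
qed

lemma topspace_QT [simp]: "topspace (QT R) = cls R ` I"
proof
  show "topspace (QT R) \<subseteq> cls R ` I" using openin_topspace[of "QT R"] unfolding openin_QT by blast
  have eq: "{m \<in> I. cls R m \<in> cls R ` I} = topspace K" by auto
  have "openin (QT R) (cls R ` I)" unfolding openin_QT eq using openin_topspace[of K] by simp
  then show "cls R ` I \<subseteq> topspace (QT R)" by (rule openin_subset)
qed

lemma quotient_cls: "quotient_map K (QT R) (cls R)"
  unfolding quotient_map_def topspace_K topspace_QT openin_QT by blast

lemma continuous_cls: "continuous_map K (QT R) (cls R)"
  by (rule quotient_imp_continuous_map[OF quotient_cls])

lemma closedin_saturation:
  assumes "closedin K2 R" "closedin K C"
  shows "closedin K {n. \<exists>m\<in>C. (m, n) \<in> R}"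
proof -
  have "closedin K2 (R \<inter> C \<times> I)"
    using assms closedin_topspace[of K] by (intro closedin_Int) (simp_all add: closedin_prod_Times_iff)
  then have "closedin K (snd ` (R \<inter> C \<times> I))"
    using continuous_imp_closed_map[OF continuous_map_snd compact_K2 Hausdorff_K] by (simp add: closed_map_def)
  moreover have "{n. \<exists>m\<in>C. (m, n) \<in> R} = snd ` (R \<inter> C \<times> I)"
    using closedin_subset[OF assms(1)] by force
  ultimately show ?thesis by simp
qed

text \<open>The saturation of a closed set is the projection of a closed subset of the compact
  square, hence closed. Hausdorffness of the quotient follows by normality of
  \<open>I\<close>.\<close>

lemma closed_map_cls:
  assumes R: "icer R"
  shows "closed_map K (QT R) (cls R)"
  unfolding closed_map_def
proof (intro allI impI)
  fix C assume C: "closedin K C"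
  then have CI: "C \<subseteq> I" using closedin_subset by fastforce
  have "{m \<in> I. cls R m \<in> cls R ` I - cls R ` C} = I - {n. \<exists>m\<in>C. (m, n) \<in> R}"
  proof -
    have "cls R m \<in> cls R ` C \<longleftrightarrow> (\<exists>c\<in>C. (c, m) \<in> R)" if "m \<in> I" for m
    proof -
      have "cls R m = cls R c \<longleftrightarrow> (c, m) \<in> R" if "c \<in> C" for c
        using cls_eq_iff[OF R, of c m] \<open>m \<in> I\<close> CI that by auto
      then show ?thesis unfolding image_iff by blast
    qed
    then show ?thesis by blast
  qed
  moreover have "openin K (I - {n. \<exists>m\<in>C. (m, n) \<in> R})"
    using closedin_saturation[OF icerD(1)[OF R] C] openin_diff[OF openin_topspace] by fastforce
  ultimately show "closedin (QT R) (cls R ` C)"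
    using CI by (simp add: closedin_def openin_QT image_mono)
qed

lemma compact_QT: "compact_space (QT R)"
  using image_compactin[OF compact_K[unfolded compact_space_def] continuous_cls, of R]
  by (simp add: compact_space_def)

lemma Hausdorff_QT:
  assumes "icer R"
  shows "Hausdorff_space (QT R)"
proof -
  have "normal_space K" using compact_K Hausdorff_K compact_Hausdorff_or_regular_imp_normal_space by blast
  then show ?thesis
    using normal_Hausdorff_space_closed_continuous_map_image[OF _ Hausdorff_K closed_map_cls[OF assms] continuous_cls]
    by simp
qed

definition rep where "rep c = (SOME m. m \<in> c)"

lemma rep_cls:
  assumes "icer R" "m \<in> I"
  shows "(m, rep (cls R m)) \<in> R"
proof -
  have "m \<in> cls R m" using icerD(2)[OF assms] by (simp add: cls_def)
  then have "rep (cls R m) \<in> cls R m" unfolding rep_def by (rule someI)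
  then show ?thesis by (simp add: cls_def)
qed

definition qact where "qact R t c = cls R (act t (rep c))"

definition qmap where "qmap S c = cls S (rep c)"

lemma qact_cls [simp]:
  assumes "icer R" "m \<in> I"
  shows "qact R t (cls R m) = cls R (act t m)"
proof -
  note mr = rep_cls[OF assms]
  have "(act t (rep (cls R m)), act t m) \<in> R"
    by (rule icerD(5)[OF assms(1) icerD(3)[OF assms(1) mr]])
  then show ?thesis
    unfolding qact_def using icerD(7)[OF assms(1) mr] assms by (simp add: cls_eq_iff)
qed

lemma qmap_cls:
  assumes "icer R" "icer S" "R \<subseteq> S" "m \<in> I"
  shows "qmap S (cls R m) = cls S m"
proof -
  note mr = rep_cls[OF assms(1,4)]
  have "(rep (cls R m), m) \<in> S" using icerD(3)[OF assms(1) mr] assms(3) by blast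
  then show ?thesis
    unfolding qmap_def using icerD(7)[OF assms(1) mr] assms by (simp add: cls_eq_iff)
qed

text \<open>\<open>I\<close> only sees the group as a discrete one, so joint continuity of a quotient with respect to
  the given topology of the group is a genuine restriction.\<close>

definition tcont where
  "tcont R \<longleftrightarrow> continuous_map (prod_topology euclidean K) (QT R) (\<lambda>(t, m). cls R (act t m))"

lemma continuous_qmap:
  assumes "icer R" "icer S" "R \<subseteq> S"
  shows "continuous_map (QT R) (QT S) (qmap S)"
proof (rule continuous_compose_quotient_map[OF quotient_cls])
  show "continuous_map K (QT S) (qmap S \<circ> cls R)"
    by (rule continuous_map_eq[OF continuous_cls]) (simp add: qmap_cls[OF assms])
qed

lemma tcont_mono:
  assumes "icer R" "icer S" "R \<subseteq> S" "tcont R"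
  shows "tcont S"
  unfolding tcont_def
  by (rule continuous_map_eq[OF continuous_map_compose[OF assms(4)[unfolded tcont_def] continuous_qmap[OF assms(1-3)]]])
    (auto simp: qmap_cls[OF assms(1-3)])

text \<open>A product of quotient maps need not be a quotient map. Here \<open>cls R\<close> is
  proper, so its product with the identity of the group is closed, and joint continuity descends
  from \<open>I\<close>.\<close>

lemma flow_QT:
  assumes R: "icer R" and "tcont R"
  shows "is_flow euclidean (QT R) (qact R)"
  unfolding is_flow_def
proof (intro conjI ballI allI)
  show "qact R 0 c = c" if "c \<in> topspace (QT R)" for c using that R by auto
  show "qact R (s + t) c = qact R s (qact R t c)" if "c \<in> topspace (QT R)" for s t c
    using that R by (auto simp: betaT_act_add)
  show "qact R t c \<in> topspace (QT R)" if "c \<in> topspace (QT R)" for t c using that R by auto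
  let ?q = "\<lambda>(t::'g, m). (id t, cls R m)"
  have "proper_map K (QT R) (cls R)"
    unfolding proper_map_def
  proof (intro conjI ballI closed_map_cls[OF R])
    fix c assume c: "c \<in> topspace (QT R)"
    have "closedin K {m \<in> topspace K. cls R m \<in> {c}}"
      by (rule closedin_continuous_map_preimage[OF continuous_cls])
        (rule closedin_Hausdorff_singleton[OF Hausdorff_QT[OF R] c])
    then show "compactin K {m \<in> topspace K. cls R m = c}"
      using closedin_compact_space[OF compact_K] by simp
  qed
  then have "proper_map (prod_topology euclidean K) (prod_topology euclidean (QT R)) ?q"
    by (intro proper_map_prod[THEN iffD2] disjI2 conjI proper_map_id)
  then have "closed_map (prod_topology euclidean K) (prod_topology euclidean (QT R)) ?q"
    by (rule proper_imp_closed_map)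
  moreover have "continuous_map (prod_topology euclidean K) (prod_topology euclidean (QT R)) ?q"
    by (intro continuous_map_prod_top[THEN iffD2] disjI2 conjI continuous_map_id continuous_cls)
  moreover have "?q ` topspace (prod_topology euclidean K) = topspace (prod_topology euclidean (QT R))"
    by (auto simp: image_iff)
  ultimately have q: "quotient_map (prod_topology euclidean K) (prod_topology euclidean (QT R)) ?q"
    by (intro continuous_closed_imp_quotient_map)
  show "continuous_map (prod_topology euclidean (QT R)) (QT R) (\<lambda>(t, c). qact R t c)"
  proof (rule continuous_compose_quotient_map[OF q])
    show "continuous_map (prod_topology euclidean K) (QT R) ((\<lambda>(t, c). qact R t c) \<circ> ?q)"
      by (rule continuous_map_eq[OF assms(2)[unfolded tcont_def]]) (use R in auto)
  qed
qed

lemma minimal_QT: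
  assumes R: "icer R" and "tcont R"
  shows "is_minimal_compact_flow (QT R) (qact R)"
  unfolding is_minimal_compact_flow_def is_minimal_flow_def
proof (intro conjI ballI flow_QT[OF assms] compact_QT Hausdorff_QT[OF R])
  show "topspace (QT R) \<noteq> {}" using I_nonempty by simp
  fix c assume "c \<in> topspace (QT R)"
  then obtain m where m: "m \<in> I" "c = cls R m" by auto
  show "QT R closure_of orbit (qact R) c = topspace (QT R)"
  proof (intro equalityI closure_of_subset_topspace subsetI)
    fix d assume d: "d \<in> topspace (QT R)"
    show "d \<in> QT R closure_of orbit (qact R) c"
      unfolding in_closure_of
    proof (intro conjI d allI impI)
      fix U assume U: "d \<in> U \<and> openin (QT R) U"
      then have "openin K {m \<in> I. cls R m \<in> U}" "{m \<in> I. cls R m \<in> U} \<noteq> {}"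
        using d by (auto simp: openin_QT)
      then obtain t where "act t m \<in> {m \<in> I. cls R m \<in> U}" using orbit_dense[OF m(1)] by blast
      then have "qact R t c \<in> U" using R m by simp
      then show "\<exists>y. y \<in> orbit (qact R) c \<and> y \<in> U" unfolding orbit_def by blast
    qed
  qed
qed

lemma extension_QT:
  assumes "icer R" "icer S" "R \<subseteq> S"
  shows "is_extension (QT R) (qact R) (QT S) (qact S) (qmap S)"
  unfolding is_extension_def is_hom_def
proof (intro conjI allI ballI continuous_qmap[OF assms])
  fix t x assume "x \<in> topspace (QT R)"
  then show "qmap S (qact R t x) = qact S t (qmap S x)" using assms by (auto simp: qmap_cls[OF assms])
next
  have "qmap S ` (cls R ` I) = cls S ` I" unfolding image_image using qmap_cls[OF assms] by simp
  then show "qmap S ` topspace (QT R) = topspace (QT S)" by simp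
qed

lemma kap_in_closure:
  assumes R: "icer R" and mn: "m \<in> I" "n \<in> I"
  shows "(cls R (e \<odot> m), cls R (e \<odot> n)) \<in>
    prod_topology (QT R) (QT R) closure_of (range (\<lambda>t. act2 (qact R) t (cls R m, cls R n)))"
  unfolding in_closure_of
proof (intro conjI allI impI)
  show "(cls R (e \<odot> m), cls R (e \<odot> n)) \<in> topspace (prod_topology (QT R) (QT R))" using mn by simp
  fix U assume U: "(cls R (e \<odot> m), cls R (e \<odot> n)) \<in> U \<and> openin (prod_topology (QT R) (QT R)) U"
  have "continuous_map K2 (prod_topology (QT R) (QT R)) (\<lambda>(x, y). (cls R x, cls R y))"
    by (intro continuous_map_prod_top[THEN iffD2] disjI2 conjI continuous_cls)
  then have "openin K2 {z \<in> topspace K2. (case z of (x, y) \<Rightarrow> (cls R x, cls R y)) \<in> U}"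
    using U by (intro openin_continuous_map_preimage) auto
  moreover have "(e \<odot> m, e \<odot> n) \<in> {z \<in> topspace K2. (case z of (x, y) \<Rightarrow> (cls R x, cls R y)) \<in> U}"
    using U mn by simp
  ultimately obtain t where "(act t m, act t n) \<in> {z \<in> topspace K2. (case z of (x, y) \<Rightarrow> (cls R x, cls R y)) \<in> U}"
    using orbit2_meets[OF e_betaT mn] by blast
  then have "act2 (qact R) t (cls R m, cls R n) \<in> U" using R mn by (simp add: act2_def)
  then show "\<exists>y. y \<in> range (\<lambda>t. act2 (qact R) t (cls R m, cls R n)) \<and> y \<in> U" by blast
qed

text \<open>The pair of classes of \<open>e \<odot> m\<close> and \<open>e \<odot> n\<close> lies in
  the orbit closure of the pair of classes of \<open>m\<close> and \<open>n\<close>. It is diagonal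
  exactly when the former points are equivalent.\<close>

lemma proximal_QT:
  assumes R: "icer R" and ext: "is_extension (QT R) (qact R) Z actZ f"
    and grp: "\<And>m n. m \<in> I \<Longrightarrow> n \<in> I \<Longrightarrow> f (cls R m) = f (cls R n) \<Longrightarrow> (e \<odot> m, e \<odot> n) \<in> R"
  shows "is_proximal_ext (QT R) (qact R) Z actZ f"
  unfolding is_proximal_ext_def
proof (intro conjI ext ballI)
  fix z assume "z \<in> rel_of (topspace (QT R)) f"
  then obtain m n where mn: "m \<in> I" "n \<in> I" "z = (cls R m, cls R n)" "f (cls R m) = f (cls R n)"
    by (auto simp: rel_of_def)
  have "cls R (e \<odot> m) = cls R (e \<odot> n)" using grp[OF mn(1,2,4)] mn cls_eq_iff[OF R] by simp
  then have "(cls R (e \<odot> m), cls R (e \<odot> n)) \<in> diag (topspace (QT R))"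
    using mn by (simp add: diag_def)
  then show "prod_topology (QT R) (QT R) closure_of range (\<lambda>t. act2 (qact R) t z) \<inter> diag (topspace (QT R)) \<noteq> {}"
    using kap_in_closure[OF R mn(1,2)] mn(3) by blast
qed

text \<open>The difference of an \<open>S\<close>-pair belongs to the group of \<open>S\<close>. If
  that group is contained in the group of \<open>R\<close>, multiplication by \<open>e\<close> makes
  the pair \<open>R\<close>-equivalent.\<close>

lemma proximal_qmap:
  assumes "icer R" "icer S" "R \<subseteq> S" "grp S \<subseteq> grp R"
  shows "is_proximal_ext (QT R) (qact R) (QT S) (qact S) (qmap S)"
proof (rule proximal_QT[OF assms(1) extension_QT[OF assms(1-3)]])
  fix m n assume mn: "m \<in> I" "n \<in> I" and "qmap S (cls R m) = qmap S (cls R n)"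
  then have "(m, n) \<in> S" using qmap_cls[OF assms(1-3)] cls_eq_iff[OF assms(2)] by simp
  then have "kap m n \<in> grp R" using kap_grp[OF assms(2)] assms(4) by blast
  then have "(e \<odot> m, kap m n (e \<odot> m)) \<in> R" using grp_iff[OF assms(1), of "e \<odot> m"] mn by simp
  then show "(e \<odot> m, e \<odot> n) \<in> R" using kap_eq[OF mn] by simp
qed

section \<open>Uniformly continuous functions on the ideal\<close>

text \<open>The \<open>A\<close>-invariant continuous functions that also vary uniformly little
  under small group elements. The second condition recovers the topology of the group, which the
  flow on \<open>I\<close> has forgotten.\<close>

definition UC :: "('g filter \<Rightarrow> 'g filter) set \<Rightarrow> ('g filter \<Rightarrow> real) set" where
  "UC A = {f. continuous_map K euclideanreal f \<and>
     (\<forall>\<epsilon>>0. \<exists>N. open N \<and> 0 \<in> N \<and> (\<forall>s\<in>N. \<forall>m\<in>I. \<bar>f (act s m) - f m\<bar> < \<epsilon>)) \<and>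
     (\<forall>\<alpha>\<in>A. \<forall>m\<in>I. f (\<alpha> m) = f m)}"

lemma UC_I:
  assumes "continuous_map K euclideanreal f"
    "\<And>\<epsilon>. \<epsilon> > 0 \<Longrightarrow> \<exists>N. open N \<and> 0 \<in> N \<and> (\<forall>s\<in>N. \<forall>m\<in>I. \<bar>f (act s m) - f m\<bar> < \<epsilon>)"
    "\<And>\<alpha> m. \<alpha> \<in> A \<Longrightarrow> m \<in> I \<Longrightarrow> f (\<alpha> m) = f m"
  shows "f \<in> UC A"
  using assms unfolding UC_def by simp

lemma UC_D:
  assumes "f \<in> UC A"
  shows "continuous_map K euclideanreal f"
    "\<epsilon> > 0 \<Longrightarrow> \<exists>N. open N \<and> 0 \<in> N \<and> (\<forall>s\<in>N. \<forall>m\<in>I. \<bar>f (act s m) - f m\<bar> < \<epsilon>)"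
    "\<alpha> \<in> A \<Longrightarrow> m \<in> I \<Longrightarrow> f (\<alpha> m) = f m"
  using assms unfolding UC_def by simp_all

lemma UC_mono: "A \<subseteq> B \<Longrightarrow> UC B \<subseteq> UC A"
  unfolding UC_def by blast

lemma UC_comp_lipschitz:
  assumes f: "f \<in> UC A" and L: "\<And>x y. \<bar>\<phi> x - \<phi> y\<bar> \<le> L * \<bar>x - y :: real\<bar>"
  shows "(\<lambda>m. \<phi> (f m)) \<in> UC A"
proof (rule UC_I)
  have "L \<ge> 0" using L[of 1 0] by simp
  then have "L-lipschitz_on UNIV \<phi>"
    by (intro lipschitz_onI) (use L in \<open>auto simp: dist_real_def\<close>)
  then have "continuous_on UNIV \<phi>" by (rule lipschitz_on_continuous_on)
  then have "continuous_map euclideanreal euclideanreal \<phi>" by (simp add: continuous_map_iff_continuous2)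
  from continuous_map_compose[OF UC_D(1)[OF f] this]
  show "continuous_map K euclideanreal (\<lambda>m. \<phi> (f m))" by (simp add: o_def)
  fix \<epsilon> :: real assume "\<epsilon> > 0"
  then have "\<epsilon> / (L + 1) > 0" using \<open>L \<ge> 0\<close> by simp
  from UC_D(2)[OF f this] obtain N where N: "open N" "0 \<in> N"
    "\<And>s m. s \<in> N \<Longrightarrow> m \<in> I \<Longrightarrow> \<bar>f (act s m) - f m\<bar> < \<epsilon> / (L + 1)" by blast
  have "\<bar>\<phi> (f (act s m)) - \<phi> (f m)\<bar> < \<epsilon>" if "s \<in> N" "m \<in> I" for s m
  proof -
    have "\<bar>\<phi> (f (act s m)) - \<phi> (f m)\<bar> \<le> L * \<bar>f (act s m) - f m\<bar>" by (rule L)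
    also have "\<dots> \<le> (L + 1) * \<bar>f (act s m) - f m\<bar>" by (intro mult_right_mono) auto
    also have "\<dots> < \<epsilon>" using N(3)[OF that] \<open>L \<ge> 0\<close> by (simp add: field_simps)
    finally show ?thesis .
  qed
  then show "\<exists>N. open N \<and> 0 \<in> N \<and> (\<forall>s\<in>N. \<forall>m\<in>I. \<bar>\<phi> (f (act s m)) - \<phi> (f m)\<bar> < \<epsilon>)"
    using N(1,2) by blast
qed (simp add: UC_D(3)[OF f])

lemma UC_const: "(\<lambda>_. c) \<in> UC A"
  by (rule UC_I) (auto intro: exI[of _ UNIV])

lemma UC_add:
  assumes f: "f \<in> UC A" and g: "g \<in> UC A"
  shows "(\<lambda>m. f m + g m) \<in> UC A"
proof (rule UC_I)
  show "continuous_map K euclideanreal (\<lambda>m. f m + g m)"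
    by (rule continuous_map_add[OF UC_D(1)[OF f] UC_D(1)[OF g]])
  fix \<epsilon> :: real assume "\<epsilon> > 0"
  then have e2: "\<epsilon> / 2 > 0" by simp
  obtain N where N: "open N" "0 \<in> N" "\<And>s m. s \<in> N \<Longrightarrow> m \<in> I \<Longrightarrow> \<bar>f (act s m) - f m\<bar> < \<epsilon> / 2"
    using UC_D(2)[OF f e2] by blast
  obtain M where M: "open M" "0 \<in> M" "\<And>s m. s \<in> M \<Longrightarrow> m \<in> I \<Longrightarrow> \<bar>g (act s m) - g m\<bar> < \<epsilon> / 2"
    using UC_D(2)[OF g e2] by blast
  have "\<bar>f (act s m) + g (act s m) - (f m + g m)\<bar> < \<epsilon>" if "s \<in> N \<inter> M" "m \<in> I" for s m
    using N(3)[of s m] M(3)[of s m] that by (auto simp: abs_if split: if_splits)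
  then show "\<exists>N. open N \<and> 0 \<in> N \<and> (\<forall>s\<in>N. \<forall>m\<in>I. \<bar>f (act s m) + g (act s m) - (f m + g m)\<bar> < \<epsilon>)"
    using N(1,2) M(1,2) by (intro exI[of _ "N \<inter> M"]) auto
qed (simp add: UC_D(3)[OF f] UC_D(3)[OF g])

lemma UC_sum: "finite C \<Longrightarrow> (\<And>c. c \<in> C \<Longrightarrow> f c \<in> UC A) \<Longrightarrow> (\<lambda>m. \<Sum>c\<in>C. f c m) \<in> UC A"
proof (induction C rule: finite_induct)
  case (insert x F)
  then show ?case using UC_add[of "f x" A "\<lambda>m. \<Sum>c\<in>F. f c m"] by simp
qed (simp add: UC_const)

lemma UC_act:
  assumes f: "f \<in> UC A" and A: "A \<subseteq> Aut I"
  shows "(\<lambda>m. f (act t m)) \<in> UC A"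
proof (rule UC_I)
  show "continuous_map K euclideanreal (\<lambda>m. f (act t m))"
    using continuous_map_compose[OF continuous_act UC_D(1)[OF f]] by (simp add: o_def)
  show "f (act t (\<alpha> m)) = f (act t m)" if "\<alpha> \<in> A" "m \<in> I" for \<alpha> m
  proof -
    have "act t (\<alpha> m) = \<alpha> (act t m)" using Aut_act[of \<alpha> m t] A that by auto
    then show ?thesis using UC_D(3)[OF f that(1)] that(2) by simp
  qed
  fix \<epsilon> :: real assume "\<epsilon> > 0"
  from UC_D(2)[OF f this] obtain N where N: "open N" "0 \<in> N"
    "\<And>s m. s \<in> N \<Longrightarrow> m \<in> I \<Longrightarrow> \<bar>f (act s m) - f m\<bar> < \<epsilon>" by blast
  \<comment> \<open>The group need not be commutative: moving \<open>t\<close> past \<open>s\<close>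
    replaces \<open>s\<close> by the conjugate \<open>t + s - t\<close>, which is small when
    \<open>s\<close> is.\<close>
  have "open ((\<lambda>s. t + s - t) -` N)" by (intro open_vimage N(1) continuous_intros)
  moreover have "\<bar>f (act t (act s m)) - f (act t m)\<bar> < \<epsilon>" if "t + s - t \<in> N" "m \<in> I" for s m
  proof -
    have "t + s = (t + s - t) + t" by simp
    then have "act t (act s m) = act (t + s - t) (act t m)" by (metis betaT_act_add)
    then show ?thesis using N(3)[OF that(1), of "act t m"] that(2) by simp
  qed
  ultimately show "\<exists>N. open N \<and> 0 \<in> N \<and> (\<forall>s\<in>N. \<forall>m\<in>I. \<bar>f (act t (act s m)) - f (act t m)\<bar> < \<epsilon>)"
    using N(2) by (intro exI[of _ "(\<lambda>s. t + s - t) -` N"]) auto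
qed

lemma UC_bounded:
  assumes "f \<in> UC A"
  shows "\<exists>B. \<forall>m\<in>I. \<bar>f m\<bar> \<le> B"
proof -
  have "compactin euclideanreal (f ` topspace K)"
    by (rule image_compactin[OF compact_K[unfolded compact_space_def] UC_D(1)[OF assms]])
  then have "bounded (f ` I)" by (simp add: compact_imp_bounded)
  then show ?thesis unfolding bounded_iff by auto
qed

definition RV where
  "RV A = {(m, n) \<in> I \<times> I. \<forall>f\<in>UC A. f m = f n}"

lemma RV_iff: "(m, n) \<in> RV A \<longleftrightarrow> m \<in> I \<and> n \<in> I \<and> (\<forall>f\<in>UC A. f m = f n)"
  by (simp add: RV_def)

lemma RV_mono: "A \<subseteq> B \<Longrightarrow> RV A \<subseteq> RV B"
  unfolding RV_def using UC_mono by blast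

lemma icer_RV:
  assumes A: "A \<subseteq> Aut I"
  shows "icer (RV A)"
proof -
  have "closedin K2 {z \<in> topspace K2. f (fst z) = f (snd z)}" if "f \<in> UC A" for f
  proof (rule closedin_continuous_maps_eq)
    show "Hausdorff_space euclideanreal" by simp
    show "continuous_map K2 euclideanreal (\<lambda>z. f (fst z))"
      using continuous_map_compose[OF continuous_map_fst UC_D(1)[OF that]] by (simp add: o_def)
    show "continuous_map K2 euclideanreal (\<lambda>z. f (snd z))"
      using continuous_map_compose[OF continuous_map_snd UC_D(1)[OF that]] by (simp add: o_def)
  qed
  then have "closedin K2 (\<Inter>f\<in>UC A. {z \<in> topspace K2. f (fst z) = f (snd z)})"
    using UC_const[of 0 A] by (intro closedin_INT) auto
  moreover have "RV A = (\<Inter>f\<in>UC A. {z \<in> topspace K2. f (fst z) = f (snd z)})"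
    using UC_const[of 0 A] by (auto simp: RV_iff)
  ultimately have cl: "closedin K2 (RV A)" by simp
  have "(act t m, act t n) \<in> RV A" if "(m, n) \<in> RV A" for t m n
    unfolding RV_iff
  proof (intro conjI ballI)
    show "act t m \<in> I" "act t n \<in> I" using that by (simp_all add: RV_iff)
    fix f assume f: "f \<in> UC A"
    have all: "\<forall>f\<in>UC A. f m = f n" using that by (simp add: RV_iff)
    show "f (act t m) = f (act t n)" using bspec[OF all UC_act[OF f A, of t]] .
  qed
  moreover have "(n, m) \<in> RV A" if "(m, n) \<in> RV A" for m n using that by (auto simp: RV_iff)
  moreover have "(m, k) \<in> RV A" if "(m, n) \<in> RV A" "(n, k) \<in> RV A" for m n k
    using that by (auto simp: RV_iff)
  moreover have "(m, m) \<in> RV A" if "m \<in> I" for m using that by (simp add: RV_iff)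
  ultimately show ?thesis unfolding icer_def using cl by blast
qed

lemma grp_RV:
  assumes "A \<subseteq> Aut I"
  shows "A \<subseteq> grp (RV A)"
proof
  fix \<alpha> assume \<alpha>: "\<alpha> \<in> A"
  then have "\<alpha> \<in> Aut I" using assms by blast
  moreover have "(e, \<alpha> e) \<in> RV A"
    using \<open>\<alpha> \<in> Aut I\<close> UC_D(3)[OF _ \<alpha> e_in, symmetric] by (simp add: RV_iff)
  ultimately show "\<alpha> \<in> grp (RV A)" by (simp add: grp_def)
qed

text \<open>By compactness finitely many functions suffice, one of them exceeding 1 at each point of
  \<open>C\<close>. They are nonnegative and vanish at \<open>m\<close>, so their sum works without
  any lattice operation.\<close>

lemma UC_separate:
  assumes C: "closedin K C" and m: "m \<in> I" and sep: "\<And>c. c \<in> C \<Longrightarrow> (m, c) \<notin> RV A"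
  shows "\<exists>g\<in>UC A. (\<forall>n. g n \<ge> 0) \<and> g m = 0 \<and> (\<forall>c\<in>C. g c \<ge> 1)"
proof -
  have CI: "C \<subseteq> I" using closedin_subset[OF C] by simp
  have "\<exists>h\<in>UC A. (\<forall>n. h n \<ge> 0) \<and> h m = 0 \<and> h c > 1" if c: "c \<in> C" for c
  proof -
    obtain f where f: "f \<in> UC A" "f m \<noteq> f c" using sep[OF c] m CI c by (auto simp: RV_iff)
    \<comment> \<open>With this scaling the function takes the value 2 at \<open>c\<close>, so it
      exceeds 1 on a neighbourhood of \<open>c\<close>.\<close>
    define k where "k = 2 / \<bar>f c - f m\<bar>"
    have k: "k > 0" using f(2) by (simp add: k_def)
    have "(\<lambda>n. k * \<bar>f n - f m\<bar>) \<in> UC A"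
    proof (rule UC_comp_lipschitz[OF f(1), where L = k])
      fix x y :: real
      have "\<bar>k * \<bar>x - f m\<bar> - k * \<bar>y - f m\<bar>\<bar> = k * \<bar>\<bar>x - f m\<bar> - \<bar>y - f m\<bar>\<bar>"
        using k by (simp add: abs_mult flip: right_diff_distrib)
      also have "\<dots> \<le> k * \<bar>x - y\<bar>" using k by (intro mult_left_mono) auto
      finally show "\<bar>k * \<bar>x - f m\<bar> - k * \<bar>y - f m\<bar>\<bar> \<le> k * \<bar>x - y\<bar>" .
    qed
    moreover have "k * \<bar>f c - f m\<bar> > 1" using f(2) by (simp add: k_def)
    ultimately show ?thesis using k by (intro bexI[of _ "\<lambda>n. k * \<bar>f n - f m\<bar>"]) auto
  qed
  then obtain h where h: "\<And>c. c \<in> C \<Longrightarrow> h c \<in> UC A" "\<And>c n. c \<in> C \<Longrightarrow> h c n \<ge> 0"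
    "\<And>c. c \<in> C \<Longrightarrow> h c m = 0" "\<And>c. c \<in> C \<Longrightarrow> h c c > 1" by metis
  define U where "U c = {n \<in> topspace K. h c n \<in> {1<..}}" for c
  have "openin K (U c)" if "c \<in> C" for c
    unfolding U_def by (rule openin_continuous_map_preimage[OF UC_D(1)[OF h(1)[OF that]]]) simp
  moreover have "C \<subseteq> \<Union>(U ` C)" using h(4) CI by (auto simp: U_def)
  moreover have "compactin K C" by (rule closedin_compact_space[OF compact_K C])
  ultimately obtain \<F> where \<F>: "finite \<F>" "\<F> \<subseteq> U ` C" "C \<subseteq> \<Union>\<F>"
    using compactinD[of K C "U ` C"] by blast
  obtain D where D: "D \<subseteq> C" "finite D" "\<F> = U ` D" using finite_subset_image[OF \<F>(1,2)] by blast
  define g where "g n = (\<Sum>c\<in>D. h c n)" for n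
  have "g \<in> UC A" unfolding g_def using UC_sum[OF D(2), of h A] h(1) D(1) by blast
  moreover have "g n \<ge> 0" for n unfolding g_def using h(2) D(1) by (intro sum_nonneg) blast
  moreover have "g m = 0" unfolding g_def using h(3) D(1) by (intro sum.neutral) blast
  moreover have "g c \<ge> 1" if c: "c \<in> C" for c
  proof -
    obtain d where d: "d \<in> D" "c \<in> U d" using \<F>(3) D(3) c by blast
    have "1 \<le> h d c" using d(2) by (simp add: U_def)
    also have "\<dots> \<le> g c" unfolding g_def using h(2) D by (intro member_le_sum d) auto
    finally show ?thesis .
  qed
  ultimately show ?thesis by blast
qed

text \<open>A separating function \<open>g\<close> vanishes at the image point and is at least 1
  outside the target set. Half of this margin is spent on moving the point with the time fixed, half
  on moving the time, where uniformity over all points of \<open>I\<close> is essential.\<close>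

lemma tcont_RV:
  assumes A: "A \<subseteq> Aut I" and R: "icer R" and sub: "RV A \<subseteq> R"
  shows "tcont R"
  unfolding tcont_def continuous_map_def
proof (intro conjI allI impI)
  show "(\<lambda>(t, m). cls R (act t m)) \<in> topspace (prod_topology euclidean K) \<rightarrow> topspace (QT R)" by auto
  fix U assume U: "openin (QT R) U"
  let ?P = "{z \<in> topspace (prod_topology euclidean K). (case z of (t, m) \<Rightarrow> cls R (act t m)) \<in> U}"
  define C where "C = I - {m \<in> I. cls R m \<in> U}"
  have C: "closedin K C" unfolding C_def using U openin_QT[of R U] openin_subset
    by (metis closedin_def Diff_Diff_Int Diff_subset inf.absorb_iff2 topspace_K)
  show "openin (prod_topology euclidean K) ?P"
    unfolding openin_prod_topology_alt
  proof (intro allI impI)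
    fix t0 :: 'g and m0 assume "(t0, m0) \<in> ?P"
    then have m0: "m0 \<in> I" "cls R (act t0 m0) \<in> U" by auto
    have "(act t0 m0, c) \<notin> RV A" if c: "c \<in> C" for c
    proof
      assume "(act t0 m0, c) \<in> RV A"
      then have "cls R (act t0 m0) = cls R c" using sub m0 c cls_eq_iff[OF R] by (auto simp: C_def)
      then show False using m0 c by (simp add: C_def)
    qed
    then obtain g where g: "g \<in> UC A" "g (act t0 m0) = 0" "\<forall>c\<in>C. g c \<ge> 1"
      using UC_separate[OF C, of "act t0 m0" A] m0(1) by auto
    obtain N where N: "open N" "0 \<in> N" "\<And>s m. s \<in> N \<Longrightarrow> m \<in> I \<Longrightarrow> \<bar>g (act s m) - g m\<bar> < 1 / 2"
      using UC_D(2)[OF g(1), of "1 / 2"] by auto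
    define M where "M = (\<lambda>t. t - t0) -` N"
    define W where "W = {m \<in> topspace K. g (act t0 m) \<in> {..<1 / 2}}"
    have "open M" unfolding M_def by (intro open_vimage N(1) continuous_intros)
    moreover have "t0 \<in> M" using N(2) by (simp add: M_def)
    moreover have "openin K W"
      unfolding W_def by (rule openin_continuous_map_preimage[OF UC_D(1)[OF UC_act[OF g(1) A]]]) simp
    moreover have "m0 \<in> W" using m0 g(2) by (simp add: W_def)
    moreover have "M \<times> W \<subseteq> ?P"
    proof safe
      fix t m assume t: "t \<in> M" and m: "m \<in> W"
      have mI: "m \<in> I" using m by (simp add: W_def)
      have "t = (t - t0) + t0" by simp
      then have "act t m = act (t - t0) (act t0 m)" by (metis betaT_act_add)
      then have "\<bar>g (act t m) - g (act t0 m)\<bar> < 1 / 2"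
        using N(3)[of "t - t0" "act t0 m"] t mI by (simp add: M_def)
      moreover have "g (act t0 m) < 1 / 2" using m by (simp add: W_def)
      ultimately have "g (act t m) < 1" by (simp add: abs_if split: if_splits)
      then have "act t m \<notin> C" using g(3) by force
      then show "cls R (act t m) \<in> U" using mI by (simp add: C_def)
      show "(t, m) \<in> topspace (prod_topology euclidean K)" using mI by simp
    qed
    ultimately show "\<exists>M W. openin euclidean M \<and> openin K W \<and> t0 \<in> M \<and> m0 \<in> W \<and> M \<times> W \<subseteq> ?P"
      by auto
  qed
qed

section \<open>The maximal proximal extension\<close>

lemma ultrafilter_tendsto:
  fixes s :: "'i \<Rightarrow> real"
  assumes p: "is_ultrafilter p" and b: "\<And>t. \<bar>s t\<bar> \<le> B"
  shows "\<exists>l. (s \<longlongrightarrow> l) p"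
proof -
  have "filtermap s p \<noteq> bot" using ultrafilter_neq_bot[OF p] by (simp add: filtermap_bot_iff)
  moreover have "s t \<in> {-B..B}" for t using b[of t] by (auto simp: abs_le_iff)
  then have "eventually (\<lambda>x. x \<in> {-B..B}) (filtermap s p)"
    by (simp add: eventually_filtermap)
  ultimately obtain l where l: "inf (nhds l) (filtermap s p) \<noteq> bot"
    using compact_Icc[of "-B" B] unfolding compact_filter by blast
  have "(s \<longlongrightarrow> l) p"
  proof (rule topological_tendstoI)
    fix S assume S: "open S" "l \<in> S"
    show "eventually (\<lambda>x. s x \<in> S) p"
    proof (rule ccontr)
      assume "\<not> eventually (\<lambda>x. s x \<in> S) p"
      then have "eventually (\<lambda>x. x \<notin> S) (filtermap s p)"
        using ultrafilter_not_eventually[OF p, of "\<lambda>x. s x \<in> S"] by (simp add: eventually_filtermap)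
      moreover have "eventually (\<lambda>x. x \<in> S) (nhds l)" using S by (simp add: eventually_nhds_in_open)
      ultimately have "eventually (\<lambda>_. False) (inf (nhds l) (filtermap s p))"
        unfolding eventually_inf by blast
      then show False using l by (simp add: trivial_limit_def)
    qed
  qed
  then show ?thesis by blast
qed

text \<open>The supremum over \<open>H\<close> is formed on the orbit of \<open>e\<close> only and
  extended to ultrafilters by limits: a pointwise supremum over \<open>H\<close> on all of
  \<open>I\<close> could fail to be continuous, whereas the extension is continuous
  automatically.\<close>

definition supH where
  "supH H f t = (SUP \<alpha>\<in>H. f (\<alpha> (act t e)) :: real)"

definition limH where
  "limH H f p = Lim p (supH H f)"

context
  fixes H assumes H: "csub H"
begin

lemma supH_bounds:
  assumes B: "\<And>m. m \<in> I \<Longrightarrow> \<bar>f m\<bar> \<le> B"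
  shows "\<alpha> \<in> H \<Longrightarrow> f (\<alpha> (act t e)) \<le> supH H f t"
    and "(\<And>\<alpha>. \<alpha> \<in> H \<Longrightarrow> f (\<alpha> (act t e)) \<le> c) \<Longrightarrow> supH H f t \<le> c"
    and "\<bar>supH H f t\<bar> \<le> B"
proof -
  have bnd: "\<bar>f (\<alpha> (act t e))\<bar> \<le> B" if "\<alpha> \<in> H" for \<alpha>
    using B csubD(2)[OF H that] by simp
  then have bdd: "bdd_above ((\<lambda>\<alpha>. f (\<alpha> (act t e))) ` H)" by (intro bdd_aboveI2[of _ _ B]) (auto dest: bnd)
  show up: "f (\<alpha> (act t e)) \<le> supH H f t" if "\<alpha> \<in> H" for \<alpha>
    unfolding supH_def by (rule cSUP_upper[OF that bdd])
  have ne: "H \<noteq> {}" using csubD(3)[OF H] by blast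
  show least: "supH H f t \<le> c" if "\<And>\<alpha>. \<alpha> \<in> H \<Longrightarrow> f (\<alpha> (act t e)) \<le> c" for c
    unfolding supH_def by (rule cSUP_least[OF ne that])
  have "supH H f t \<le> B" by (rule least) (use bnd in \<open>auto dest: abs_le_D1\<close>)
  moreover have "- B \<le> supH H f t"
    using up[OF csubD(3)[OF H]] bnd[OF csubD(3)[OF H]] by simp
  ultimately show "\<bar>supH H f t\<bar> \<le> B" by simp
qed

lemma limH_tendsto:
  assumes "f \<in> UC A" "p \<in> betaT"
  shows "(supH H f \<longlongrightarrow> limH H f p) p"
proof -
  have p: "is_ultrafilter p" using assms(2) by (simp add: betaT_def)
  obtain B where B: "\<And>m. m \<in> I \<Longrightarrow> \<bar>f m\<bar> \<le> B" using UC_bounded[OF assms(1)] by blast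
  have b: "\<bar>supH H f t\<bar> \<le> B" for t by (rule supH_bounds(3)[where f = f, OF B])
  obtain l where l: "(supH H f \<longlongrightarrow> l) p" using ultrafilter_tendsto[where s = "supH H f", OF p b] by blast
  then have "limH H f p = l" unfolding limH_def by (intro tendsto_Lim ultrafilter_neq_bot[OF p])
  then show ?thesis using l by simp
qed

lemma limH_eqI:
  assumes "p \<in> betaT" "(supH H f \<longlongrightarrow> l) p"
  shows "limH H f p = l"
  unfolding limH_def using assms by (intro tendsto_Lim) (auto simp: betaT_def ultrafilter_neq_bot)

lemma supH_act: "A \<subseteq> Aut I \<Longrightarrow> supH H f (r + t) = supH H (\<lambda>m. f (act r m)) t"
  unfolding supH_def using csubD(2)[OF H]
  by (intro SUP_cong) (simp_all add: betaT_act_add Aut_act)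

lemma limH_act:
  assumes f: "f \<in> UC A" and A: "A \<subseteq> Aut I" and p: "p \<in> betaT"
  shows "limH H f (act r p) = limH H (\<lambda>m. f (act r m)) p"
proof (rule limH_eqI)
  show "act r p \<in> betaT" using p by simp
  have "(supH H (\<lambda>m. f (act r m)) \<longlongrightarrow> limH H (\<lambda>m. f (act r m)) p) p"
    by (rule limH_tendsto[OF UC_act[OF f A] p])
  then have "((\<lambda>t. supH H f (r + t)) \<longlongrightarrow> limH H (\<lambda>m. f (act r m)) p) p"
    using supH_act[OF A] by simp
  then show "(supH H f \<longlongrightarrow> limH H (\<lambda>m. f (act r m)) p) (act r p)"
    by (simp add: betaT_act_def filterlim_filtermap)
qed

lemma limH_diff:
  assumes f: "f \<in> UC A" and g: "g \<in> UC A'" and d: "\<And>m. m \<in> I \<Longrightarrow> f m \<le> g m + d" and p: "p \<in> betaT"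
  shows "limH H f p \<le> limH H g p + d"
proof -
  obtain B where B: "\<And>m. m \<in> I \<Longrightarrow> \<bar>f m\<bar> \<le> B" using UC_bounded[OF f] by blast
  obtain B' where B': "\<And>m. m \<in> I \<Longrightarrow> \<bar>g m\<bar> \<le> B'" using UC_bounded[OF g] by blast
  have "supH H f t \<le> supH H g t + d" for t
  proof (rule supH_bounds(2)[where f = f, OF B])
    fix \<alpha> assume \<alpha>: "\<alpha> \<in> H"
    have "f (\<alpha> (act t e)) \<le> g (\<alpha> (act t e)) + d" using d csubD(2)[OF H \<alpha>] by simp
    also have "\<dots> \<le> supH H g t + d" using supH_bounds(1)[where f = g, OF B' \<alpha>] by simp
    finally show "f (\<alpha> (act t e)) \<le> supH H g t + d" .
  qed
  moreover have "((\<lambda>t. supH H g t + d) \<longlongrightarrow> limH H g p + d) p"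
    by (intro tendsto_intros limH_tendsto[OF g p])
  ultimately show ?thesis
    using limH_tendsto[OF f p] p
    by (intro tendsto_le[of p "\<lambda>t. supH H g t + d" _ "supH H f"]) (auto simp: betaT_def ultrafilter_neq_bot)
qed

lemma limH_ge:
  assumes f: "f \<in> UC A" and p: "p \<in> betaT" and ev: "eventually (\<lambda>t. c t \<le> supH H f t) p" "(c \<longlongrightarrow> l) p"
  shows "l \<le> limH H f p"
  using limH_tendsto[OF f p] ev p
  by (intro tendsto_le[of p "supH H f" _ c]) (auto simp: betaT_def ultrafilter_neq_bot)

lemma tendsto_UC:
  assumes "f \<in> UC A" "p \<in> betaT" "m \<in> I"
  shows "((\<lambda>t. f (act t m)) \<longlongrightarrow> f (p \<odot> m)) p"
  using continuous_map_limit[OF UC_D(1)[OF assms(1)] limitin_act[OF assms(2,3)]] by (simp add: o_def)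

lemma limH_ge_self:
  assumes f: "f \<in> UC A" and p: "p \<in> betaT" and \<alpha>: "\<alpha> \<in> H"
  shows "f (\<alpha> (p \<odot> e)) \<le> limH H f p"
proof (rule limH_ge[OF f p])
  obtain B where B: "\<And>m. m \<in> I \<Longrightarrow> \<bar>f m\<bar> \<le> B" using UC_bounded[OF f] by blast
  show "eventually (\<lambda>t. f (\<alpha> (act t e)) \<le> supH H f t) p"
    using supH_bounds(1)[where f = f, OF B \<alpha>] by simp
  have \<alpha>A: "\<alpha> \<in> Aut I" by (rule csubD(2)[OF H \<alpha>])
  show "((\<lambda>t. f (\<alpha> (act t e))) \<longlongrightarrow> f (\<alpha> (p \<odot> e))) p"
    using tendsto_UC[OF f p, of "\<alpha> e"] \<alpha>A p by (simp add: Aut_act Aut_mul)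
qed

text \<open>The times at which \<open>supH H f\<close> is close to the value at \<open>p\<close>
  form a set belonging to \<open>p\<close>; the ultrafilters containing that set are a neighbourhood
  of \<open>p\<close>.\<close>

lemma limH_continuous:
  assumes f: "f \<in> UC A"
  shows "continuous_map K euclideanreal (limH H f)"
  unfolding continuous_map_def
proof (intro conjI allI impI)
  fix U :: "real set" assume "openin euclideanreal U"
  then have U: "open U" by simp
  show "openin K {p \<in> topspace K. limH H f p \<in> U}"
  proof (subst openin_subopen, intro ballI)
    fix p assume "p \<in> {p \<in> topspace K. limH H f p \<in> U}"
    then have p: "p \<in> I" "limH H f p \<in> U" by auto
    obtain \<epsilon> where \<epsilon>: "\<epsilon> > 0" "ball (limH H f p) \<epsilon> \<subseteq> U" using U p(2) by (meson open_contains_ball)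
    define T where "T = {t. \<bar>supH H f t - limH H f p\<bar> < \<epsilon> / 2}"
    have "eventually (\<lambda>t. t \<in> T) p"
      using tendstoD[OF limH_tendsto[OF f I_sub[OF p(1)]], of "\<epsilon> / 2"] \<epsilon>(1)
      by (simp add: T_def dist_real_def)
    moreover have "openin K ({q \<in> betaT. eventually (\<lambda>t. t \<in> T) q} \<inter> I)"
      by (rule openin_subtopology_Int[OF openin_betaT_basic])
    moreover have "limH H f q \<in> U" if "q \<in> betaT" "eventually (\<lambda>t. t \<in> T) q" for q
    proof -
      have lim: "(supH H f \<longlongrightarrow> limH H f q) q" by (rule limH_tendsto[OF f that(1)])
      have "((\<lambda>t. \<bar>supH H f t - limH H f p\<bar>) \<longlongrightarrow> \<bar>limH H f q - limH H f p\<bar>) q"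
        by (intro tendsto_intros lim)
      moreover have "eventually (\<lambda>t. \<bar>supH H f t - limH H f p\<bar> \<le> \<epsilon> / 2) q"
        using that(2) by eventually_elim (simp add: T_def)
      moreover have "q \<noteq> bot" using that(1) by (auto simp: betaT_def ultrafilter_neq_bot)
      ultimately have "\<bar>limH H f q - limH H f p\<bar> \<le> \<epsilon> / 2" by (intro tendsto_upperbound)
      then show ?thesis using \<epsilon> by (auto simp: dist_real_def subset_iff abs_minus_commute)
    qed
    ultimately show "\<exists>T. openin K T \<and> p \<in> T \<and> T \<subseteq> {p \<in> topspace K. limH H f p \<in> U}"
      using p(1) I_sub by (intro exI[of _ "{q \<in> betaT. eventually (\<lambda>t. t \<in> T) q} \<inter> I"]) auto
  qed
qed simp

text \<open>Since \<open>\<alpha> = (\<alpha> \<circ> inv \<gamma>) \<circ> \<gamma>\<close>, every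
  competitor for the supremum at time \<open>t\<close> is a competitor at the base point
  \<open>\<gamma> e\<close>. The inequality on the orbit passes to the limit along \<open>p\<close>;
  applying it to \<open>inv \<gamma>\<close> as well gives invariance.\<close>

lemma limH_invariant_le:
  assumes f: "f \<in> UC A" and A: "A \<subseteq> Aut I" and \<gamma>: "\<gamma> \<in> H" and p: "p \<in> I"
  shows "limH H f p \<le> limH H f (\<gamma> p)"
proof -
  have \<gamma>A: "\<gamma> \<in> Aut I" by (rule csubD(2)[OF H \<gamma>])
  have ge: "supH H f t \<le> limH H f (act t (\<gamma> e))" for t
  proof -
    have ft: "(\<lambda>m. f (act t m)) \<in> UC A" by (rule UC_act[OF f A])
    obtain B where B: "\<And>m. m \<in> I \<Longrightarrow> \<bar>f m\<bar> \<le> B" using UC_bounded[OF f] by blast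
    have "supH H f t \<le> limH H (\<lambda>m. f (act t m)) (\<gamma> e)"
    proof (rule supH_bounds(2)[where f = f, OF B])
      fix \<alpha> assume \<alpha>: "\<alpha> \<in> H"
      have \<alpha>A: "\<alpha> \<in> Aut I" by (rule csubD(2)[OF H \<alpha>])
      have "\<alpha> \<circ> inv \<gamma> \<in> H" using csubD(4,5)[OF H] \<alpha> \<gamma> by blast
      from limH_ge_self[OF ft I_sub this, of "\<gamma> e"]
      show "f (\<alpha> (act t e)) \<le> limH H (\<lambda>m. f (act t m)) (\<gamma> e)"
        using \<gamma>A \<alpha>A by (simp add: Aut_act)
    qed
    then show ?thesis using limH_act[OF f A I_sub, of "\<gamma> e" t] \<gamma>A by simp
  qed
  have pb: "p \<in> betaT" using p by (rule I_sub)
  have "((\<lambda>t. limH H f (act t (\<gamma> e))) \<longlongrightarrow> limH H f (p \<odot> \<gamma> e)) p"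
    using continuous_map_limit[OF limH_continuous[OF f] limitin_act[OF pb, of "\<gamma> e"]] \<gamma>A by (simp add: o_def)
  then have "limH H f p \<le> limH H f (p \<odot> \<gamma> e)"
    using limH_tendsto[OF f pb] ge pb
    by (intro tendsto_le[of p "\<lambda>t. limH H f (act t (\<gamma> e))" _ "supH H f"]) (auto simp: betaT_def ultrafilter_neq_bot)
  then show ?thesis using Aut_eq_mul[OF \<gamma>A p] by simp
qed

lemma limH_UC:
  assumes f: "f \<in> UC A" and A: "A \<subseteq> Aut I"
  shows "limH H f \<in> UC H"
proof (rule UC_I[OF limH_continuous[OF f]])
  show "limH H f (\<gamma> p) = limH H f p" if "\<gamma> \<in> H" "p \<in> I" for \<gamma> p
    using limH_invariant_le[OF f A that] limH_invariant_le[OF f A csubD(5)[OF H that(1)], of "\<gamma> p"]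
      csubD(2)[OF H that(1)] that(2) by simp
  fix \<epsilon> :: real assume "\<epsilon> > 0"
  then have "\<epsilon> / 2 > 0" by simp
  from UC_D(2)[OF f this] obtain N where N: "open N" "0 \<in> N"
    "\<And>s m. s \<in> N \<Longrightarrow> m \<in> I \<Longrightarrow> \<bar>f (act s m) - f m\<bar> < \<epsilon> / 2" by blast
  have "\<bar>limH H f (act s p) - limH H f p\<bar> < \<epsilon>" if s: "s \<in> N" and p: "p \<in> I" for s p
  proof -
    have fs: "(\<lambda>m. f (act s m)) \<in> UC A" by (rule UC_act[OF f A])
    have "f (act s m) \<le> f m + \<epsilon> / 2" "f m \<le> f (act s m) + \<epsilon> / 2" if "m \<in> I" for m
      using N(3)[OF s that] by (auto simp: abs_if split: if_splits)
    then have "limH H (\<lambda>m. f (act s m)) p \<le> limH H f p + \<epsilon> / 2"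
      "limH H f p \<le> limH H (\<lambda>m. f (act s m)) p + \<epsilon> / 2"
      using limH_diff[OF fs f _ I_sub[OF p]] limH_diff[OF f fs _ I_sub[OF p]] by blast+
    then show ?thesis using limH_act[OF f A I_sub[OF p], of s] \<open>\<epsilon> > 0\<close> by (simp add: abs_if)
  qed
  then show "\<exists>N. open N \<and> 0 \<in> N \<and> (\<forall>s\<in>N. \<forall>m\<in>I. \<bar>limH H f (act s m) - limH H f m\<bar> < \<epsilon>)"
    using N(1,2) by blast
qed

text \<open>Automorphisms that attain the supremum up to \<open>\<epsilon>\<close> at each time
  \<open>t\<close> give points of graphs over \<open>act t e\<close>. Along \<open>m\<close> they
  converge to a pair \<open>(m, n)\<close> in the closure of the graphs.\<close>

lemma limH_le:
  assumes f: "f \<in> UC A" and m: "m \<in> I" and le: "\<And>n. (m, n) \<in> Qcl H \<Longrightarrow> f n \<le> c"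
  shows "limH H f m \<le> c"
proof (rule field_le_epsilon)
  fix \<epsilon> :: real assume \<epsilon>: "\<epsilon> > 0"
  have mb: "is_ultrafilter m" "m \<in> betaT" using I_sub[OF m] by (auto simp: betaT_def)
  obtain B where B: "\<And>m. m \<in> I \<Longrightarrow> \<bar>f m\<bar> \<le> B" using UC_bounded[OF f] by blast
  have "\<exists>\<alpha>\<in>H. supH H f t - \<epsilon> \<le> f (\<alpha> (act t e))" for t
  proof (rule ccontr)
    assume "\<not> ?thesis"
    then have "supH H f t \<le> supH H f t - \<epsilon>" by (intro supH_bounds(2)[where f = f, OF B]) (auto simp: not_le)
    then show False using \<epsilon> by simp
  qed
  then obtain \<alpha> where \<alpha>: "\<And>t. \<alpha> t \<in> H" "\<And>t. supH H f t - \<epsilon> \<le> f (\<alpha> t (act t e))" by metis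
  have "eventually (\<lambda>t. \<alpha> t (act t e) \<in> I) m" using \<alpha>(1) csubD(2)[OF H] by simp
  then have lim: "limitin K (\<lambda>t. \<alpha> t (act t e)) (ulim m (\<lambda>t. \<alpha> t (act t e))) m"
    by (rule limitin_K[OF mb(1)])
  have "limitin K2 (\<lambda>t. (act t e, \<alpha> t (act t e))) (m \<odot> e, ulim m (\<lambda>t. \<alpha> t (act t e))) m"
    by (rule limitin_pair[OF limitin_act[OF mb(2) e_in] lim])
  then have "(m \<odot> e, ulim m (\<lambda>t. \<alpha> t (act t e))) \<in> Qcl H"
    by (rule closedin_limit[OF _ closedin_Qcl mb(1)])
      (use Qcl_graph[OF csubD(1)[OF H] \<alpha>(1)] in simp)
  then have "f (ulim m (\<lambda>t. \<alpha> t (act t e))) \<le> c" using le m by simp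
  moreover have "((\<lambda>t. f (\<alpha> t (act t e))) \<longlongrightarrow> f (ulim m (\<lambda>t. \<alpha> t (act t e)))) m"
    using continuous_map_limit[OF UC_D(1)[OF f] lim] by (simp add: o_def)
  moreover have "((\<lambda>t. supH H f t - \<epsilon>) \<longlongrightarrow> limH H f m - \<epsilon>) m"
    by (intro tendsto_intros limH_tendsto[OF f mb(2)])
  ultimately show "limH H f m \<le> c + \<epsilon>"
    using tendsto_le[OF ultrafilter_neq_bot[OF mb(1)], of "\<lambda>t. f (\<alpha> t (act t e))" _ "\<lambda>t. supH H f t - \<epsilon>"] \<alpha>(2)
    by fastforce
qed

text \<open>Otherwise a nonnegative \<open>g\<close> vanishes at \<open>n\<close> and is at least 1
  at all points paired with \<open>m\<close> in the closure of the graphs. Then \<open>limH\<close>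
  of \<open>- g\<close> is at most \<open>- 1\<close> at \<open>m\<close> and at least 0 at
  \<open>n\<close>, although it is a function in \<open>UC H\<close> and cannot separate the
  two.\<close>

lemma RV_dense_graphs:
  assumes A: "A \<subseteq> Aut I" and mn: "(m, n) \<in> RV H"
  shows "\<exists>n'. (m, n') \<in> Qcl H \<and> (n', n) \<in> RV A"
proof (rule ccontr)
  assume no: "\<not> ?thesis"
  have mI: "m \<in> I" "n \<in> I" using mn by (auto simp: RV_iff)
  define C where "C = {x \<in> topspace K. (m, x) \<in> Qcl H}"
  have "continuous_map K K2 (\<lambda>x. (m, x))" using mI by (simp add: continuous_map_pairwise o_def)
  then have "closedin K C" unfolding C_def by (rule closedin_continuous_map_preimage[OF _ closedin_Qcl])
  moreover have "(n, c) \<notin> RV A" if "c \<in> C" for c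
    using no that icerD(3)[OF icer_RV[OF A]] unfolding C_def by blast
  ultimately obtain g where g: "g \<in> UC A" "\<forall>x. g x \<ge> 0" "g n = 0" "\<forall>c\<in>C. g c \<ge> 1"
    using UC_separate[OF _ mI(2)] by blast
  have f: "(\<lambda>x. - g x) \<in> UC A" by (rule UC_comp_lipschitz[OF g(1), where L = 1]) auto
  have "limH H (\<lambda>x. - g x) m \<le> - 1"
    by (rule limH_le[OF f mI(1)]) (use g(4) Qcl_sub[of H] in \<open>auto simp: C_def\<close>)
  moreover have "0 \<le> limH H (\<lambda>x. - g x) n"
    using limH_ge_self[OF f I_sub[OF mI(2)] csubD(3)[OF H]] g(3) mI by simp
  moreover have "limH H (\<lambda>x. - g x) m = limH H (\<lambda>x. - g x) n"
    using mn limH_UC[OF f A] by (simp add: RV_iff)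
  ultimately show False by simp
qed

end

section \<open>The almost periodic extension\<close>

abbreviation K4 where "K4 \<equiv> prod_topology K2 K2"

lemma compact_K4: "compact_space K4"
  by (simp add: compact_space_prod_topology compact_K)

text \<open>Two pairs are linked when they are approximated simultaneously by points on the graph of
  a single automorphism of \<open>H\<close>.\<close>

definition Omega where
  "Omega H = K4 closure_of {((m, \<alpha> m), (n, \<alpha> n)) | m n \<alpha>. m \<in> I \<and> n \<in> I \<and> \<alpha> \<in> H}"

lemma closedin_Omega: "closedin K4 (Omega H)"
  unfolding Omega_def by (rule closedin_closure_of)

lemma Omega_graph:
  assumes "H \<subseteq> Aut I" "\<alpha> \<in> H" "m \<in> I" "n \<in> I"
  shows "((m, \<alpha> m), (n, \<alpha> n)) \<in> Omega H"
  unfolding Omega_def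
  by (rule subsetD[OF closure_of_subset]) (use assms in auto)

lemma Omega_minimal:
  assumes "closedin K4 C" "\<And>\<alpha> m n. \<alpha> \<in> H \<Longrightarrow> m \<in> I \<Longrightarrow> n \<in> I \<Longrightarrow> ((m, \<alpha> m), (n, \<alpha> n)) \<in> C"
  shows "Omega H \<subseteq> C"
  unfolding Omega_def by (rule closure_of_minimal[OF _ assms(1)]) (use assms(2) in blast)

lemma Omega_in: "((m, n), (m', n')) \<in> Omega H \<Longrightarrow> m \<in> I \<and> n \<in> I \<and> m' \<in> I \<and> n' \<in> I"
  using closedin_subset[OF closedin_Omega, of H] by auto

text \<open>The differences of both pairs are limits of the same net of automorphisms, so
  \<open>TC_derived\<close> applies.\<close>

lemma Omega_kap:
  assumes H: "csub H" and z: "((m, n), (m', n')) \<in> Omega H"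
  shows "kap m n \<in> H" "kap m' n' \<in> H" "inv (kap m n) \<circ> kap m' n' \<in> derived I H"
proof -
  let ?S = "{((m, \<alpha> m), (n, \<alpha> n)) | m n \<alpha>. m \<in> I \<and> n \<in> I \<and> \<alpha> \<in> H}"
  obtain F where F: "is_ultrafilter F" "eventually (\<lambda>x. x \<in> ?S) F" "limitin K4 id ((m, n), (m', n')) F"
    using ex_ultrafilter_closure_of[OF z[unfolded Omega_def]] by blast
  define P where "P x \<alpha> \<longleftrightarrow> \<alpha> \<in> H \<and> snd (fst x) = \<alpha> (fst (fst x)) \<and> snd (snd x) = \<alpha> (fst (snd x))"
    for x :: "('g filter \<times> 'g filter) \<times> ('g filter \<times> 'g filter)" and \<alpha>
  define \<alpha> where "\<alpha> x = (SOME \<alpha>. P x \<alpha>)" for x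
  have \<alpha>: "P x (\<alpha> x)" if x: "x \<in> ?S" for x
  proof -
    obtain a b \<beta> where "x = ((a, \<beta> a), (b, \<beta> b))" "\<beta> \<in> H" using x by blast
    then have "P x \<beta>" by (simp add: P_def)
    then show ?thesis unfolding \<alpha>_def by (rule someI[of "P x"])
  qed
  have ev: "eventually (\<lambda>x. \<alpha> x \<in> H) F" "eventually (\<lambda>x. snd (fst x) = \<alpha> x (fst (fst x))) F"
    "eventually (\<lambda>x. snd (snd x) = \<alpha> x (fst (snd x))) F"
    using F(2) by (eventually_elim, use \<alpha> in \<open>simp only: P_def\<close>)+
  have lim: "limitin K (\<lambda>x. fst (fst x)) m F" "limitin K (\<lambda>x. snd (fst x)) n F"
    "limitin K (\<lambda>x. fst (snd x)) m' F" "limitin K (\<lambda>x. snd (snd x)) n' F"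
    using F(3) by (simp_all add: limitin_pairwise o_def)
  have lim2: "limitin K (\<lambda>x. \<alpha> x (fst (fst x))) n F"
    by (rule limitin_transform_eventually[OF ev(2) lim(2)])
  have lim4: "limitin K (\<lambda>x. \<alpha> x (fst (snd x))) n' F"
    by (rule limitin_transform_eventually[OF ev(3) lim(4)])
  show mem: "kap m n \<in> H" "kap m' n' \<in> H"
    by (rule kap_csub[OF H F(1) ev(1) lim(1) lim2], rule kap_csub[OF H F(1) ev(1) lim(3) lim4])
  have Aut: "eventually (\<lambda>x. \<alpha> x \<in> Aut I) F"
    using ev(1) by eventually_elim (rule csubD(2)[OF H])
  show "inv (kap m n) \<circ> kap m' n' \<in> derived I H"
    by (rule TC_derived[OF H ultrafilter_neq_bot[OF F(1)] ev(1)
        TC_limit[OF Aut lim(3) lim4] TC_limit[OF Aut lim(1) lim2] mem(2,1)])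
qed

lemma Omega_diag:
  assumes H: "csub H" and z: "(m, n) \<in> Qcl H"
  shows "((m, n), (m, n)) \<in> Omega H"
proof -
  have cont: "continuous_map K2 K4 (\<lambda>z. (z, z))" by (simp add: continuous_map_pairwise o_def)
  have "Qcl H \<subseteq> {z \<in> topspace K2. (z, z) \<in> Omega H}"
  proof (rule Qcl_minimal)
    show "closedin K2 {z \<in> topspace K2. (z, z) \<in> Omega H}"
      by (rule closedin_continuous_map_preimage[OF cont closedin_Omega])
    fix \<alpha> m assume "\<alpha> \<in> H" "m \<in> I"
    then show "(m, \<alpha> m) \<in> {z \<in> topspace K2. (z, z) \<in> Omega H}"
      using Omega_graph[OF csubD(1)[OF H]] csubD(2)[OF H] by simp
  qed
  then show ?thesis using z by blast
qed

text \<open>The two points on a common graph are independent of each other, so the second may be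
  translated along the graph while the first stays.\<close>

lemma Omega_act:
  assumes H: "csub H" and z: "((m, n), (m', n')) \<in> Omega H"
  shows "((m, n), (act t m', act t n')) \<in> Omega H"
proof -
  have "continuous_map K2 K2 (\<lambda>(x, y). (act t x, act t y))"
    by (intro continuous_map_prod_top[THEN iffD2] disjI2 conjI continuous_act)
  then have cont: "continuous_map K4 K4 (\<lambda>(x, y). (id x, (\<lambda>(x, y). (act t x, act t y)) y))"
    by (intro continuous_map_prod_top[THEN iffD2] disjI2 conjI continuous_map_id continuous_act)
  let ?C = "{z \<in> topspace K4. (\<lambda>(x, y). (id x, (\<lambda>(x, y). (act t x, act t y)) y)) z \<in> Omega H}"
  have "Omega H \<subseteq> ?C"
  proof (rule Omega_minimal)
    show "closedin K4 ?C" by (rule closedin_continuous_map_preimage[OF cont closedin_Omega])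
    fix \<alpha> m n assume a: "\<alpha> \<in> H" "m \<in> I" "n \<in> I"
    then have "((m, \<alpha> m), (act t n, \<alpha> (act t n))) \<in> Omega H"
      by (intro Omega_graph csubD(1)[OF H]) auto
    then show "((m, \<alpha> m), (n, \<alpha> n)) \<in> ?C"
      using a csubD(2)[OF H a(1)] by (simp add: Aut_act)
  qed
  then have "((m, n), (m', n')) \<in> ?C" using z by blast
  then show ?thesis by simp
qed

lemma Omega_mul:
  assumes H: "csub H" and z: "((m, n), (m', n')) \<in> Omega H" and p: "p \<in> betaT"
  shows "((m, n), (p \<odot> m', p \<odot> n')) \<in> Omega H"
proof -
  note i = Omega_in[OF z]
  have "limitin K2 (\<lambda>t. (m, n)) (m, n) p" using i by simp
  then have "limitin K4 (\<lambda>t. ((m, n), (act t m', act t n'))) ((m, n), (p \<odot> m', p \<odot> n')) p"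
    using limitin_act2[OF p, of m' n'] i by (simp add: limitin_pairwise o_def)
  then show ?thesis
    by (rule closedin_limit[OF _ closedin_Omega])
      (use p Omega_act[OF H z] in \<open>simp_all add: betaT_def\<close>)
qed

lemma closedin_relcomp:
  assumes P: "closedin K2 P" and V: "closedin K2 V"
  shows "closedin K2 (P O V)"
proof -
  let ?Z = "{z \<in> topspace (prod_topology K2 K). (fst (fst z), snd (fst z)) \<in> P} \<inter>
    {z \<in> topspace (prod_topology K2 K). (snd (fst z), snd z) \<in> V}"
  have f: "continuous_map (prod_topology K2 K) K (\<lambda>z. fst (fst z))"
    "continuous_map (prod_topology K2 K) K (\<lambda>z. snd (fst z))"
    "continuous_map (prod_topology K2 K) K (\<lambda>z. snd z)"
    using continuous_map_compose[OF continuous_map_fst[of K2 K] continuous_map_fst[of K K]]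
      continuous_map_compose[OF continuous_map_fst[of K2 K] continuous_map_snd[of K K]]
      continuous_map_snd[of K2 K] by (simp_all add: o_def)
  have "closedin (prod_topology K2 K) ?Z"
    by (intro closedin_Int closedin_continuous_map_preimage[OF _ P] closedin_continuous_map_preimage[OF _ V])
      (simp_all add: continuous_map_pairwise o_def f)
  moreover have g: "continuous_map (prod_topology K2 K) K2 (\<lambda>z. (fst (fst z), snd z))"
    by (simp add: continuous_map_pairwise o_def f)
  moreover have "compact_space (prod_topology K2 K)"
    by (simp add: compact_space_prod_topology compact_K2 compact_K)
  ultimately have "closedin K2 ((\<lambda>z. (fst (fst z), snd z)) ` ?Z)"
    using continuous_imp_closed_map[OF g _ Hausdorff_K2] unfolding closed_map_def by blast
  moreover have "(\<lambda>z. (fst (fst z), snd z)) ` ?Z = P O V"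
  proof (intro equalityI subsetI)
    fix z assume "z \<in> P O V"
    then obtain a b c where abc: "z = (a, c)" "(a, b) \<in> P" "(b, c) \<in> V" by auto
    have "((a, b), c) \<in> ?Z" using abc closedin_subset[OF P] closedin_subset[OF V] by auto
    then show "z \<in> (\<lambda>z. (fst (fst z), snd z)) ` ?Z" using abc(1) by force
  qed auto
  ultimately show ?thesis by simp
qed

text \<open>The assumption \<open>dense\<close> is what remains of the absence of proximal extensions of \<open>I / R\<close> below
  \<open>I / V\<close>.  Under it a net of graphs over \<open>R\<close> determines \<open>kap\<close> of its limit points up to the
  derived group, so that membership of \<open>kap m n\<close> in \<open>B\<close> is a closed and invariant condition.\<close>

context
  fixes R V B E
  assumes R: "icer R" and V: "icer V" and VR: "V \<subseteq> R"
    and dense: "\<And>m n. (m, n) \<in> R \<Longrightarrow> \<exists>n'. (m, n') \<in> Qcl (grp R) \<and> (n', n) \<in> V"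
    and B: "csub B" "derived I (grp R) \<subseteq> B" "grp V \<subseteq> B"
    and E: "E = {(m, n) \<in> R. kap m n \<in> B}"
begin

lemma kap_B_iff:
  assumes "((m, n), (m', n')) \<in> Omega (grp R)"
  shows "kap m n \<in> B \<longleftrightarrow> kap m' n' \<in> B"
proof -
  note k = Omega_kap[OF csub_grp[OF R] assms]
  have A: "kap m n \<in> Aut I" "kap m' n' \<in> Aut I" using k csubD(2)[OF csub_grp[OF R]] by blast+
  define \<phi> where "\<phi> = inv (kap m n) \<circ> kap m' n'"
  have \<phi>: "\<phi> \<in> B" using k(3) B(2) by (auto simp: \<phi>_def)
  have "kap m' n' = kap m n \<circ> \<phi>" using A by (simp add: \<phi>_def fun_eq_iff)
  moreover have "kap m n = kap m' n' \<circ> inv \<phi>"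
    using A by (simp add: \<phi>_def fun_eq_iff inv_comp)
  ultimately show ?thesis using csubD(4,5)[OF B(1)] \<phi> by metis
qed

lemma kap_V_iff:
  assumes "m \<in> I" "(n', n) \<in> V"
  shows "kap m n' \<in> B \<longleftrightarrow> kap m n \<in> B"
proof -
  have n: "n' \<in> I" "n \<in> I" using icerD(6,7)[OF V assms(2)] .
  have "kap n' n \<in> B" "kap n n' \<in> B"
    using kap_grp[OF V assms(2)] kap_grp[OF V icerD(3)[OF V assms(2)]] B(3) by blast+
  then show ?thesis using kap_trans[OF assms(1) n] kap_trans[OF assms(1) n(2,1)] csubD(4)[OF B(1)] by metis
qed

lemma E_iff: "(m, n) \<in> E \<longleftrightarrow> (m, n) \<in> R \<and> kap m n \<in> B"
  by (simp add: E)

text \<open>Up to \<open>V\<close>, every pair of \<open>R\<close> is linked by \<open>Omega\<close>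
  to one whose first entry is \<open>e\<close>. There membership in \<open>B\<close> can be read
  from the second entry, and compactness makes both the projection and the composition with
  \<open>V\<close> closed.\<close>

lemma closedin_E: "closedin K2 E"
proof -
  \<comment> \<open>The orbit of \<open>e\<close> under \<open>B\<close> need not be closed in
    \<open>I\<close>. Passing to its closure does no harm, because a limit \<open>b'\<close> still
    satisfies \<open>kap e b' \<in> B\<close>.\<close>
  define Cl where "Cl = K closure_of {b e | b. b \<in> B}"
  define E0 where "E0 = fst ` (Omega (grp R) \<inter> (I \<times> I) \<times> ({e} \<times> Cl))"
  have Bsub: "{b e | b. b \<in> B} \<subseteq> I" using csubD(2)[OF B(1)] by auto
  have "closedin K4 ((I \<times> I) \<times> ({e} \<times> Cl))"
    using closedin_topspace[of K] closedin_Hausdorff_singleton[OF Hausdorff_K, of e]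
    by (simp add: closedin_prod_Times_iff Cl_def)
  then have "closedin K4 (Omega (grp R) \<inter> (I \<times> I) \<times> ({e} \<times> Cl))"
    by (rule closedin_Int[OF closedin_Omega])
  then have "closedin K2 E0"
    unfolding E0_def using continuous_imp_closed_map[OF continuous_map_fst compact_K4 Hausdorff_K2]
    unfolding closed_map_def by blast
  then have "closedin K2 (E0 O V)" by (rule closedin_relcomp[OF _ icerD(1)[OF V]])
  moreover have "E0 O V = E"
  proof (intro equalityI subsetI)
    fix z assume "z \<in> E0 O V"
    then obtain m n' n where z: "z = (m, n)" "(m, n') \<in> E0" "(n', n) \<in> V" by auto
    then obtain b' where b': "((m, n'), (e, b')) \<in> Omega (grp R)" "b' \<in> Cl" by (auto simp: E0_def)
    have "kap e b' \<in> B"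
    proof -
      obtain F where F: "is_ultrafilter F" "eventually (\<lambda>x. x \<in> {b e | b. b \<in> B}) F" "limitin K id b' F"
        using ex_ultrafilter_closure_of[OF b'(2)[unfolded Cl_def]] by blast
      define P where "P x b \<longleftrightarrow> b \<in> B \<and> x = b e" for x b
      define b where "b x = (SOME b. P x b)" for x
      have b: "b x \<in> B \<and> x = b x e" if x: "x \<in> {b e | b. b \<in> B}" for x
      proof -
        obtain c where "P x c" using x unfolding P_def by blast
        then have "P x (b x)" unfolding b_def by (rule someI[of "P x"])
        then show ?thesis by (simp only: P_def)
      qed
      have ev: "eventually (\<lambda>x. b x \<in> B) F" "eventually (\<lambda>x. id x = b x e) F"
        using F(2) by (eventually_elim, use b in \<open>simp only: id_apply\<close>)+
      have "limitin K (\<lambda>_. e) e F" by simp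
      then show ?thesis
        by (rule kap_csub[OF B(1) F(1) ev(1)]) (rule limitin_transform_eventually[OF ev(2) F(3)])
    qed
    then have k: "kap m n' \<in> B" using kap_B_iff[OF b'(1)] by simp
    have "Omega (grp R) \<subseteq> {z \<in> topspace K4. fst z \<in> R}"
    proof (rule Omega_minimal)
      show "closedin K4 {z \<in> topspace K4. fst z \<in> R}"
        by (rule closedin_continuous_map_preimage[OF continuous_map_fst icerD(1)[OF R]])
      show "((m, \<alpha> m), (n, \<alpha> n)) \<in> {z \<in> topspace K4. fst z \<in> R}"
        if "\<alpha> \<in> grp R" "m \<in> I" "n \<in> I" for \<alpha> m n
        using that grp_iff[OF R, of m] csubD(2)[OF csub_grp[OF R]] by auto
    qed
    then have "(m, n') \<in> R" using b'(1) by auto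
    then have "(m, n) \<in> R" using icerD(4)[OF R] z(3) VR by blast
    moreover have "kap m n \<in> B" using k kap_V_iff[OF _ z(3)] icerD(6)[OF R \<open>(m, n') \<in> R\<close>] by blast
    ultimately show "z \<in> E" by (simp add: E_iff z(1))
  next
    fix z assume "z \<in> E"
    then obtain m n where z: "z = (m, n)" "(m, n) \<in> R" "kap m n \<in> B" by (cases z) (auto simp: E_iff)
    obtain n' where n': "(m, n') \<in> Qcl (grp R)" "(n', n) \<in> V" using dense[OF z(2)] by blast
    have mI: "m \<in> I" "n' \<in> I" using n' icerD(6,7)[OF V] Qcl_sub by blast+
    obtain r where r: "r \<in> I" "r \<odot> m = e" using ex_left_factor[OF e_in mI(1)] by metis
    have "((m, n'), (r \<odot> m, r \<odot> n')) \<in> Omega (grp R)"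
      by (rule Omega_mul[OF csub_grp[OF R] Omega_diag[OF csub_grp[OF R] n'(1)] I_sub[OF r(1)]])
    moreover have "r \<odot> n' = kap m n' e" using kap_mul[OF mI r(1)] r(2) by simp
    moreover have "kap m n' e \<in> Cl"
      unfolding Cl_def
    proof (rule subsetD[OF closure_of_subset])
      show "kap m n' e \<in> {b e | b. b \<in> B}" using kap_V_iff[OF mI(1) n'(2)] z(3) by blast
    qed (use Bsub in simp)
    ultimately have "((m, n'), (e, kap m n' e)) \<in> Omega (grp R) \<inter> (I \<times> I) \<times> ({e} \<times> Cl)"
      using r(2) mI by simp
    then have "(m, n') \<in> E0" unfolding E0_def by force
    then show "z \<in> E0 O V" using n'(2) z(1) by blast
  qed
  ultimately show ?thesis by simp
qed

lemma V_E: "V \<subseteq> E"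
proof
  fix z assume z: "z \<in> V"
  obtain m n where mn: "z = (m, n)" by (cases z)
  then show "z \<in> E" using z VR kap_grp[OF V] B(3) by (auto simp: E_iff)
qed

lemma Omega_orbit:
  assumes "(m, n) \<in> R"
  shows "\<exists>n'. (n', n) \<in> V \<and> ((m, n'), (act t m, act t n')) \<in> Omega (grp R)"
  using dense[OF assms] Omega_act[OF csub_grp[OF R] Omega_diag[OF csub_grp[OF R]]] by blast

text \<open>Only invariance under the group needs the hypothesis \<open>dense\<close>: after
  changing the second point within its \<open>V\<close>-class, the pair is linked by
  \<open>Omega\<close> to its translates, and \<open>kap_B_iff\<close> carries membership in
  \<open>B\<close> over.\<close>

lemma icer_E: "icer E"
  unfolding icer_def
proof (intro conjI ballI allI impI closedin_E)
  show "(m, m) \<in> E" if "m \<in> I" for m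
    using icerD(2)[OF R that] csubD(3)[OF B(1)] that by (simp add: E_iff)
  show "(y, x) \<in> E" if "(x, y) \<in> E" for x y
  proof -
    have xy: "(x, y) \<in> R" "kap x y \<in> B" using that by (auto simp: E_iff)
    have "kap y x = inv (kap x y)" by (rule kap_sym[OF icerD(6,7)[OF R xy(1)]])
    then show ?thesis using icerD(3)[OF R xy(1)] csubD(5)[OF B(1) xy(2)] by (simp add: E_iff)
  qed
  show "(x, z) \<in> E" if "(x, y) \<in> E" "(y, z) \<in> E" for x y z
  proof -
    have xy: "(x, y) \<in> R" "kap x y \<in> B" "(y, z) \<in> R" "kap y z \<in> B" using that by (auto simp: E_iff)
    have "kap x z = kap y z \<circ> kap x y"
      by (rule kap_trans[OF icerD(6,7)[OF R xy(1)] icerD(7)[OF R xy(3)]])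
    then show ?thesis using icerD(4)[OF R xy(1,3)] csubD(4)[OF B(1) xy(4,2)] by (simp add: E_iff)
  qed
  show "(act t x, act t y) \<in> E" if "(x, y) \<in> E" for t x y
  proof -
    have xy: "(x, y) \<in> R" "kap x y \<in> B" using that by (auto simp: E_iff)
    have xI: "x \<in> I" by (rule icerD(6)[OF R xy(1)])
    obtain y' where y': "(y', y) \<in> V" "((x, y'), (act t x, act t y')) \<in> Omega (grp R)"
      using Omega_orbit[OF xy(1)] by blast
    have "kap x y' \<in> B" using kap_V_iff[OF xI y'(1)] xy(2) by simp
    then have "kap (act t x) (act t y') \<in> B" using kap_B_iff[OF y'(2)] by simp
    then have "kap (act t x) (act t y) \<in> B"
      using kap_V_iff[OF act_I[OF xI] icerD(5)[OF V y'(1)]] by blast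
    then show ?thesis using icerD(5)[OF R xy(1)] by (simp add: E_iff)
  qed
qed

lemma E_R: "E \<subseteq> R"
  by (auto simp: E_iff)

lemma E_neq:
  assumes "\<not> grp R \<subseteq> B"
  shows "E \<noteq> R"
proof -
  obtain h where h: "h \<in> grp R" "h \<notin> B" using assms by blast
  then have "(e, h e) \<in> R" "kap e (h e) = h" by (auto simp: grp_def)
  then have "(e, h e) \<notin> E" using h(2) by (simp add: E_iff)
  then show ?thesis using \<open>(e, h e) \<in> R\<close> by blast
qed

section \<open>Regionally proximal pairs over the quotient by \<open>R\<close>\<close>

abbreviation QQ where "QQ \<equiv> prod_topology (QT E) (QT E)"

definition Theta where
  "Theta = (\<lambda>((a, b), (c, d)). ((cls E a, cls E b), (cls E c, cls E d))) ` Omega (grp R)"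

lemma Hausdorff_QQ: "Hausdorff_space QQ" and compact_QQ: "compact_space QQ"
  by (simp_all add: Hausdorff_space_prod_topology Hausdorff_QT[OF icer_E] compact_space_prod_topology compact_QT)

lemma closedin_Theta: "closedin (prod_topology QQ QQ) Theta"
proof -
  let ?q = "\<lambda>(x, y). (cls E x, cls E y)"
  have "continuous_map K2 QQ ?q"
    by (intro continuous_map_prod_top[THEN iffD2] disjI2 conjI continuous_cls)
  then have "continuous_map K4 (prod_topology QQ QQ) (\<lambda>(x, y). (?q x, ?q y))"
    by (intro continuous_map_prod_top[THEN iffD2] disjI2 conjI continuous_cls)
  moreover have "Hausdorff_space (prod_topology QQ QQ)"
    using Hausdorff_QQ by (simp only: Hausdorff_space_prod_topology[of QQ QQ] simp_thms)
  ultimately have "closed_map K4 (prod_topology QQ QQ) (\<lambda>(x, y). (?q x, ?q y))"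
    using continuous_imp_closed_map compact_K4 by blast
  then have "closedin (prod_topology QQ QQ) ((\<lambda>(x, y). (?q x, ?q y)) ` Omega (grp R))"
    using closedin_Omega by (simp add: closed_map_def)
  moreover have "(\<lambda>(x, y). (?q x, ?q y)) ` Omega (grp R) = Theta"
    unfolding Theta_def by (rule image_cong) auto
  ultimately show ?thesis by simp
qed

lemma Theta_orbit:
  assumes "m \<in> I" "n \<in> I" "(m, n) \<in> R"
  shows "((cls E m, cls E n), act2 (qact E) t (cls E m, cls E n)) \<in> Theta"
proof -
  obtain n' where n': "(n', n) \<in> V" "((m, n'), (act t m, act t n')) \<in> Omega (grp R)"
    using Omega_orbit[OF assms(3)] by blast
  have I': "n' \<in> I" using icerD(6)[OF V n'(1)] .
  have "cls E n' = cls E n" using n'(1) V_E cls_eq_iff[OF icer_E I' assms(2)] by blast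
  moreover have "cls E (act t n') = cls E (act t n)"
    using icerD(5)[OF V n'(1)] V_E cls_eq_iff[OF icer_E] I' assms(2) by blast
  moreover have "((cls E m, cls E n'), (cls E (act t m), cls E (act t n'))) \<in> Theta"
    unfolding Theta_def using n'(2) by force
  ultimately show ?thesis using assms icer_E by (simp add: act2_def)
qed

text \<open>A pair linked by \<open>Theta\<close> to a diagonal pair is diagonal, as
  \<open>kap_B_iff\<close> shows. Closedness of \<open>Theta\<close> makes this uniform: pairs near
  an off-diagonal pair cannot have orbits that accumulate at the diagonal.\<close>

lemma ap_E: "is_ap_ext (QT E) (qact E) (QT R) (qact R) (qmap R)"
  unfolding is_ap_ext_def
proof (intro conjI notI extension_QT[OF icer_E R E_R])
  let ?rel = "rel_of (topspace (QT E)) (qmap R)"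
  let ?D = "diag (topspace (QT E))"
  assume "\<exists>x x'. (x, x') \<in> ?rel - ?D \<and>
    (\<forall>U V. openin (QT E) U \<and> x \<in> U \<and> openin (QT E) V \<and> x' \<in> V \<longrightarrow>
      QQ closure_of (\<Union>t. act2 (qact E) t ` (U \<times> V \<inter> ?rel)) \<inter> ?D \<noteq> {})"
  then obtain x x' where x: "(x, x') \<in> ?rel" "(x, x') \<notin> ?D"
    and reg: "\<And>U V. openin (QT E) U \<Longrightarrow> x \<in> U \<Longrightarrow> openin (QT E) V \<Longrightarrow> x' \<in> V \<Longrightarrow>
      QQ closure_of (\<Union>t. act2 (qact E) t ` (U \<times> V \<inter> ?rel)) \<inter> ?D \<noteq> {}" by blast
  have rel: "\<exists>m n. z = (cls E m, cls E n) \<and> m \<in> I \<and> n \<in> I \<and> (m, n) \<in> R" if "z \<in> ?rel" for z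
    using that qmap_cls[OF icer_E R E_R] cls_eq_iff[OF R] by (auto simp: rel_of_def) blast
  obtain m n where mn: "x = cls E m" "x' = cls E n" "m \<in> I" "n \<in> I" "(m, n) \<in> R"
    using rel[OF x(1)] by auto
  \<comment> \<open>The pairs linked to some point of the diagonal; this closed set is to be
    separated from \<open>(x, x')\<close>.\<close>
  define P where "P = fst ` (Theta \<inter> (topspace QQ \<times> ?D))"
  have D: "closedin QQ ?D"
  proof -
    have eq: "?D = (\<lambda>x. (x, x)) ` topspace (QT E)" by (auto simp: diag_def)
    show ?thesis unfolding eq by (rule Hausdorff_QT[OF icer_E, unfolded Hausdorff_space_closedin_diagonal])
  qed
  have comp: "compact_space (prod_topology QQ QQ)"
    using compact_QQ by (simp only: compact_space_prod_topology[of QQ QQ] simp_thms)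
  have fst: "closed_map (prod_topology QQ QQ) QQ fst" and snd: "closed_map (prod_topology QQ QQ) QQ snd"
    by (rule continuous_imp_closed_map[OF continuous_map_fst comp Hausdorff_QQ],
        rule continuous_imp_closed_map[OF continuous_map_snd comp Hausdorff_QQ])
  have "closedin QQ P"
    unfolding P_def
    by (rule fst[unfolded closed_map_def, rule_format], rule closedin_Int[OF closedin_Theta])
      (simp only: closedin_prod_Times_iff[of QQ QQ] closedin_topspace D simp_thms)
  moreover have "(x, x') \<notin> P"
  proof
    assume "(x, x') \<in> P"
    then obtain d where "((x, x'), (d, d)) \<in> Theta" by (auto simp: P_def diag_def)
    then obtain a b a' b' where ab: "((a, b), (a', b')) \<in> Omega (grp R)"
      "x = cls E a" "x' = cls E b" "d = cls E a'" "d = cls E b'" by (auto simp: Theta_def)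
    note i = Omega_in[OF ab(1)]
    have "cls E a' = cls E b'" using ab(4,5) by (rule subst)
    then have "(a', b') \<in> E" using cls_eq_iff[OF icer_E, of a' b'] i by simp
    then have "kap a b \<in> B" using kap_B_iff[OF ab(1)] by (simp add: E_iff)
    moreover have "(a, b) \<in> R"
    proof -
      have "cls E a = cls E m" "cls E n = cls E b" using ab(2,3) mn(1,2) by simp_all
      then have "(a, m) \<in> R" "(n, b) \<in> R"
        using cls_eq_iff[OF icer_E, of a m] cls_eq_iff[OF icer_E, of n b] i mn(3,4) E_R by blast+
      then show ?thesis using icerD(4)[OF R] mn(5) by blast
    qed
    ultimately have "(a, b) \<in> E" by (simp add: E_iff)
    then have "x = x'" using ab(2,3) cls_eq_iff[OF icer_E, of a b] i by simp
    then show False using x mn by (simp add: diag_def)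
  qed
  moreover have "(x, x') \<in> topspace QQ" using mn by simp
  moreover have "regular_space QQ"
    using compact_Hausdorff_imp_regular_space[OF compact_QQ Hausdorff_QQ] .
  ultimately obtain O1 O2 where O: "openin QQ O1" "openin QQ O2" "(x, x') \<in> O1" "P \<subseteq> O2" "disjnt O1 O2"
    unfolding regular_space_def by (metis DiffI)
  obtain U W where UW: "openin (QT E) U" "openin (QT E) W" "x \<in> U" "x' \<in> W" "U \<times> W \<subseteq> O1"
    using O(1,3) unfolding openin_prod_topology_alt by metis
  \<comment> \<open>The pairs linked to something away from \<open>P\<close>. This closed set
    contains the orbits of all \<open>R\<close>-pairs near \<open>(x, x')\<close>, and a diagonal
    point in it would be linked to a pair of \<open>P\<close> outside \<open>O2\<close>.\<close>
  define M where "M = snd ` (Theta \<inter> ((topspace QQ - O2) \<times> topspace QQ))"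
  have "closedin QQ M"
    unfolding M_def
    by (rule snd[unfolded closed_map_def, rule_format], rule closedin_Int[OF closedin_Theta])
      (simp only: closedin_prod_Times_iff[of QQ QQ] closedin_topspace closedin_diff[OF closedin_topspace O(2)] simp_thms)
  moreover have "(\<Union>t. act2 (qact E) t ` (U \<times> W \<inter> ?rel)) \<subseteq> M"
  proof
    fix z assume "z \<in> (\<Union>t. act2 (qact E) t ` (U \<times> W \<inter> ?rel))"
    then obtain t y where y: "z = act2 (qact E) t y" "y \<in> U \<times> W" "y \<in> ?rel" by blast
    obtain a b where ab: "y = (cls E a, cls E b)" "a \<in> I" "b \<in> I" "(a, b) \<in> R" using rel[OF y(3)] by blast
    have "(y, z) \<in> Theta" using Theta_orbit[OF ab(2-4)] y(1) ab(1) by simp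
    moreover have "y \<in> topspace QQ - O2" using UW(5) y(2) O(5) ab by (auto simp: disjnt_iff)
    moreover have "z \<in> topspace QQ" using closedin_subset[OF closedin_Theta] \<open>(y, z) \<in> Theta\<close> by auto
    ultimately show "z \<in> M" unfolding M_def by force
  qed
  ultimately have "QQ closure_of (\<Union>t. act2 (qact E) t ` (U \<times> W \<inter> ?rel)) \<subseteq> M"
    by (intro closure_of_minimal)
  then obtain z where z: "z \<in> M" "z \<in> ?D" using reg[OF UW(1,3,2,4)] by blast
  then obtain w where w: "(w, z) \<in> Theta" "w \<in> topspace QQ" "w \<notin> O2" by (auto simp: M_def)
  then have "w \<in> P" unfolding P_def using z(2) by force
  then show False using O(4) w(3) by blast
qed

end

end

section \<open>Towers of quotient flows\<close>

lemma descent_fixpoint_least: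
  assumes f: "\<And>S. f S \<subseteq> S" and R: "R \<in> descent f a" "f R = R" and x: "x \<in> descent f a"
  shows "R \<subseteq> x"
  using x
proof induction
  case base
  then show ?case by (rule descent_subset[OF f R(1)])
next
  case (step S)
  have "R \<subseteq> f S \<or> S \<subseteq> R" by (rule descent_compare[OF f step(1) R(1)])
  then show ?case using step(2) R(2) by (metis order_refl subset_antisym)
next
  case (lim C)
  then show ?case by blast
qed

text \<open>The least upper bound \<open>\<Inter>U\<close> of \<open>Q\<close> in the descent
  belongs to \<open>Q\<close>: otherwise \<open>f (\<Inter>U)\<close> is still an upper bound, so
  \<open>\<Inter>U\<close> is a fixed point. Fixed points are least in the descent, which forces
  \<open>\<Inter>U\<close> to equal a member of \<open>Q\<close> after all.\<close>

lemma descent_largest: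
  assumes f: "\<And>S. f S \<subseteq> S" and Q: "Q \<subseteq> descent f a" "Q \<noteq> {}"
  shows "\<exists>L\<in>Q. \<forall>S\<in>Q. S \<subseteq> L"
proof -
  define U where "U = {R \<in> descent f a. \<forall>S\<in>Q. S \<subseteq> R}"
  have "a \<in> U" using Q(1) descent_subset[OF f] descent.base by (auto simp: U_def)
  then have L: "\<Inter>U \<in> descent f a" by (intro descent_Inter[OF f]) (auto simp: U_def)
  then have LU: "\<Inter>U \<in> U" by (auto simp: U_def)
  show ?thesis
  proof (cases "\<Inter>U \<in> Q")
    case True
    then show ?thesis using LU by (auto simp: U_def)
  next
    case False
    have "S \<subseteq> f (\<Inter>U)" if S: "S \<in> Q" for S
    proof -
      have "S \<subseteq> \<Inter>U" using LU S by (auto simp: U_def)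
      moreover have "S \<noteq> \<Inter>U" using False S by blast
      moreover have "S \<subseteq> f (\<Inter>U) \<or> \<Inter>U \<subseteq> S" using descent_compare[OF f L] Q(1) S by blast
      ultimately show ?thesis by blast
    qed
    then have "f (\<Inter>U) \<in> U" using descent.step[OF L] by (simp add: U_def)
    then have "\<Inter>U \<subseteq> f (\<Inter>U)" by (rule Inter_lower)
    then have fx: "f (\<Inter>U) = \<Inter>U" using f by blast
    obtain S where S: "S \<in> Q" using Q(2) by blast
    then have "\<Inter>U \<subseteq> S" using descent_fixpoint_least[OF f L fx] Q(1) by blast
    moreover have "S \<subseteq> \<Inter>U" using LU S by (auto simp: U_def)
    ultimately show ?thesis using False S by simp
  qed
qed

definition descent_order where
  "descent_order f a = {(R, S). R \<in> descent f a \<and> S \<in> descent f a \<and> S \<subseteq> R}"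

lemma Field_descent_order: "Field (descent_order f a) = descent f a"
  by (auto simp: Field_def descent_order_def)

lemma Well_order_descent:
  assumes f: "\<And>S. f S \<subseteq> S"
  shows "Well_order (descent_order f a)"
  unfolding well_order_on_def linear_order_on_def partial_order_on_def preorder_on_def Field_descent_order
proof (intro conjI)
  show "descent_order f a \<subseteq> descent f a \<times> descent f a" by (auto simp: descent_order_def)
  show "refl_on (descent f a) (descent_order f a)" by (auto simp: refl_on_def descent_order_def)
  show "trans (descent_order f a)" by (rule transI) (auto simp: descent_order_def)
  show "antisym (descent_order f a)" by (rule antisymI) (auto simp: descent_order_def)
  show "total_on (descent f a) (descent_order f a)"
    using descent_chain[of f a, OF f] by (auto simp: total_on_def descent_order_def chain_def)
  show "wf (descent_order f a - Id)"
    unfolding wf_eq_minimal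
  proof (intro allI impI)
    fix Q :: "'a set set" and R assume "R \<in> Q"
    show "\<exists>z\<in>Q. \<forall>y. (y, z) \<in> descent_order f a - Id \<longrightarrow> y \<notin> Q"
    proof (cases "Q \<inter> descent f a = {}")
      case True
      then show ?thesis using \<open>R \<in> Q\<close> by (intro bexI[of _ R]) (auto simp: descent_order_def)
    next
      case False
      from descent_largest[where f = f, OF f Int_lower2 False]
      obtain L where L: "L \<in> Q \<inter> descent f a" "\<forall>S\<in>Q \<inter> descent f a. S \<subseteq> L" by (elim bexE)
      then show ?thesis by (intro bexI[of _ L]) (auto simp: descent_order_def)
    qed
  qed
qed

context minimal_ideal_top
begin

text \<open>A refinement of an equivalence relation has more classes, hence more least representatives
  with respect to a fixed well-order: these sets index the tower.\<close>

definition wo :: "('g filter \<times> 'g filter) set" where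
  "wo = (SOME r. Well_order r \<and> Field r = UNIV)"

lemma wo: "Well_order wo" "Field wo = UNIV"
proof -
  have "Well_order wo \<and> Field wo = UNIV" unfolding wo_def by (rule someI_ex[OF well_ordering])
  then show "Well_order wo" "Field wo = UNIV" by auto
qed

lemma wo_total: "(x, y) \<in> wo \<or> (y, x) \<in> wo" and wo_antisym: "(x, y) \<in> wo \<Longrightarrow> (y, x) \<in> wo \<Longrightarrow> x = y"
  using wo unfolding well_order_on_def linear_order_on_def partial_order_on_def preorder_on_def
    total_on_def refl_on_def antisym_def by (metis UNIV_I)+

lemma wo_least: "Q \<noteq> {} \<Longrightarrow> \<exists>x\<in>Q. \<forall>y\<in>Q. (x, y) \<in> wo"
proof -
  assume "Q \<noteq> {}"
  moreover have "wf (wo - Id)" using wo(1) by (simp add: well_order_on_def)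
  ultimately obtain x where "x \<in> Q" "\<And>y. (y, x) \<in> wo - Id \<Longrightarrow> y \<notin> Q" by (metis ex_in_conv wfE_min)
  then show ?thesis using wo_total by (intro bexI[of _ x]) auto
qed

definition rset :: "('g filter \<times> 'g filter) set \<Rightarrow> 'g filter set" where
  "rset R = {m \<in> I. \<forall>n. (m, n) \<in> R \<longrightarrow> (m, n) \<in> wo}"

lemma rset_ex:
  assumes S: "icer S" and m: "m \<in> I"
  shows "\<exists>m'. (m, m') \<in> S \<and> m' \<in> rset S"
proof -
  have "{n. (m, n) \<in> S} \<noteq> {}" using icerD(2)[OF S m] by blast
  from wo_least[OF this] obtain m' where "m' \<in> {n. (m, n) \<in> S}" "\<forall>n\<in>{n. (m, n) \<in> S}. (m', n) \<in> wo"
    by (elim bexE)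
  then have m': "(m, m') \<in> S" "\<And>n. (m, n) \<in> S \<Longrightarrow> (m', n) \<in> wo" by simp_all
  have "(m', n) \<in> wo" if "(m', n) \<in> S" for n using m'(2) icerD(4)[OF S m'(1) that] by blast
  then show ?thesis using m'(1) icerD(7)[OF S m'(1)] by (auto simp: rset_def)
qed

text \<open>Two points that are \<open>R\<close>-related but not \<open>S\<close>-related have
  distinct least \<open>S\<close>-representatives. These are \<open>R\<close>-related to each other,
  so they cannot both be least in their common \<open>R\<close>-class.\<close>

lemma rset_strict:
  assumes R: "icer R" and S: "icer S" and sub: "S \<subset> R"
  shows "rset R \<noteq> rset S"
proof -
  obtain m n where mn: "(m, n) \<in> R" "(m, n) \<notin> S" using sub by auto
  obtain m' where m': "(m, m') \<in> S" "m' \<in> rset S" using rset_ex[OF S icerD(6)[OF R mn(1)]] by blast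
  obtain n' where n': "(n, n') \<in> S" "n' \<in> rset S" using rset_ex[OF S icerD(7)[OF R mn(1)]] by blast
  have "m' \<noteq> n'" using mn(2) icerD(4)[OF S m'(1)] icerD(3)[OF S n'(1)] by blast
  moreover have "(m', n) \<in> R" using icerD(4)[OF R icerD(3)[OF R] mn(1)] m'(1) sub by blast
  then have "(m', n') \<in> R" using icerD(4)[OF R] n'(1) sub by blast
  moreover from this have "(n', m') \<in> R" by (rule icerD(3)[OF R])
  ultimately have "m' \<notin> rset R \<or> n' \<notin> rset R" using wo_antisym by (auto simp: rset_def)
  then show ?thesis using m'(2) n'(2) by blast
qed

text \<open>The quotient by an intersection of a chain is the inverse limit of the quotients. Here
  \<open>c\<close> codes relations as indices of the tower and \<open>un\<close> decodes them. Being
  a continuous bijection from a compact to a Hausdorff space, the map needs no separate treatment of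
  its inverse.\<close>

lemma prod_QT_tower_homeo:
  assumes S: "icer S" and C: "\<And>R. R \<in> C \<Longrightarrow> icer R" "C \<noteq> {}" "Complete_Partial_Order.chain (\<subseteq>) C" "S = \<Inter>C"
    and code: "\<And>R. R \<in> C \<Longrightarrow> un (c R) = R"
    and W: "\<And>R R'. R \<in> C \<Longrightarrow> R' \<in> C \<Longrightarrow> (c R, c R') \<in> W \<longleftrightarrow> R' \<subseteq> R"
  shows "homeomorphic_map (QT S)
     (subtopology (product_topology (\<lambda>w. QT (un w)) (c ` C))
        {f. \<forall>g\<in>c ` C. \<forall>d\<in>c ` C. (g, d) \<in> W \<longrightarrow> qmap (un g) (f d) = f g})
     (\<lambda>y. restrict (\<lambda>g. qmap (un g) y) (c ` C))"
    (is "homeomorphic_map _ (subtopology ?P ?F) ?h")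
proof (rule continuous_imp_homeomorphic_map)
  have sub: "S \<subseteq> R" if "R \<in> C" for R using that C(4) by blast
  have h: "?h (cls S m) = restrict (\<lambda>g. cls (un g) m) (c ` C)" if "m \<in> I" for m
    using qmap_cls[OF S C(1) sub that] code by (auto simp: restrict_def fun_eq_iff)
  have F: "?h (cls S m) \<in> ?F" if m: "m \<in> I" for m
  proof -
    have "qmap R (cls R' m) = cls R m" if "R \<in> C" "R' \<in> C" "R' \<subseteq> R" for R R'
      using qmap_cls[OF C(1) C(1)] that m by blast
    then show ?thesis unfolding h[OF m] by (auto simp: code W)
  qed
  have cont: "continuous_map (QT S) ?P ?h"
    unfolding continuous_map_componentwise
  proof (intro conjI ballI)
    show "?h ` topspace (QT S) \<subseteq> extensional (c ` C)" by auto
    fix g assume g: "g \<in> c ` C"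
    then obtain R where R: "R \<in> C" "g = c R" by blast
    have "continuous_map (QT S) (QT (un g)) (qmap (un g))"
      unfolding R(2) code[OF R(1)] by (rule continuous_qmap[OF S C(1)[OF R(1)] sub[OF R(1)]])
    then show "continuous_map (QT S) (QT (un g)) (\<lambda>y. ?h y g)" using g by simp
  qed
  show "continuous_map (QT S) (subtopology ?P ?F) ?h"
    unfolding continuous_map_in_subtopology using cont F by auto
  show "compact_space (QT S)" by (rule compact_QT)
  have "Hausdorff_space ?P"
    unfolding Hausdorff_space_product_topology using Hausdorff_QT C(1) code by auto
  then show "Hausdorff_space (subtopology ?P ?F)" by (rule Hausdorff_space_subtopology)
  show "inj_on ?h (topspace (QT S))"
  proof (rule inj_onI)
    fix x y assume "x \<in> topspace (QT S)" "y \<in> topspace (QT S)" and eq: "?h x = ?h y"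
    then obtain m n where mn: "m \<in> I" "n \<in> I" "x = cls S m" "y = cls S n" by auto
    have "(m, n) \<in> R" if R: "R \<in> C" for R
    proof -
      have "?h x (c R) = ?h y (c R)" using eq by simp
      then have "cls R m = cls R n" unfolding mn(3,4) h[OF mn(1)] h[OF mn(2)] using R code[OF R] by simp
      then show ?thesis using cls_eq_iff[OF C(1)[OF R] mn(1,2)] by simp
    qed
    then have "(m, n) \<in> S" using C(4) by blast
    then show "x = y" using cls_eq_iff[OF S mn(1,2)] mn(3,4) by simp
  qed
  show "?h ` topspace (QT S) = topspace (subtopology ?P ?F)"
  proof
    show "?h ` topspace (QT S) \<subseteq> topspace (subtopology ?P ?F)"
      using continuous_map_image_subset_topspace[OF cont] F by auto
    show "topspace (subtopology ?P ?F) \<subseteq> ?h ` topspace (QT S)"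
    proof
      fix f assume f: "f \<in> topspace (subtopology ?P ?F)"
      then have fP: "f \<in> (\<Pi>\<^sub>E w\<in>c ` C. topspace (QT (un w)))" and fF: "f \<in> ?F" by auto
      have fC: "f (c R) \<in> cls R ` I" if "R \<in> C" for R
        using PiE_mem[OF fP, of "c R"] that code[OF that] by simp
      \<comment> \<open>A thread selects one class in each quotient. Regarded as subsets of
        \<open>I\<close>, these classes are a chain of nonempty closed sets, and a common point
        represents the whole thread.\<close>
      define T where "T R = {m \<in> topspace K. cls R m \<in> {f (c R)}}" for R
      have mono: "T R' \<subseteq> T R" if R: "R \<in> C" "R' \<in> C" "R' \<subseteq> R" for R R'
      proof
        fix m assume "m \<in> T R'"
        then have m: "m \<in> I" "cls R' m = f (c R')" by (auto simp: T_def)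
        have "qmap (un (c R)) (f (c R')) = f (c R)" using fF W R by blast
        then have "f (c R) = qmap R (cls R' m)" using m(2) code[OF R(1)] by simp
        also have "\<dots> = cls R m" by (rule qmap_cls[OF C(1)[OF R(2)] C(1)[OF R(1)] R(3) m(1)])
        finally show "m \<in> T R" using m(1) by (simp add: T_def)
      qed
      have "\<Inter>(T ` C) \<noteq> {}"
      proof (rule chain_Inter_nonempty[OF compact_K])
        show "T ` C \<noteq> {}" using C(2) by blast
        fix A B assume "A \<in> T ` C" "B \<in> T ` C"
        then obtain R R' where "R \<in> C" "R' \<in> C" "A = T R" "B = T R'" by blast
        moreover have "R \<subseteq> R' \<or> R' \<subseteq> R" using C(3) \<open>R \<in> C\<close> \<open>R' \<in> C\<close> by (simp add: chain_def)
        ultimately show "A \<subseteq> B \<or> B \<subseteq> A" using mono by blast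
      next
        fix A assume "A \<in> T ` C"
        then obtain R where R: "R \<in> C" "A = T R" by blast
        have "closedin (QT R) {f (c R)}"
          by (rule closedin_Hausdorff_singleton[OF Hausdorff_QT[OF C(1)[OF R(1)]]]) (use fC R in simp)
        then have "closedin K A"
          unfolding R(2) T_def by (rule closedin_continuous_map_preimage[OF continuous_cls])
        moreover have "A \<noteq> {}" using fC[OF R(1)] by (auto simp: R(2) T_def)
        ultimately show "closedin K A \<and> A \<noteq> {}" by blast
      qed
      then obtain m where m: "\<And>R. R \<in> C \<Longrightarrow> m \<in> T R" by blast
      have mI: "m \<in> I" using m C(2) by (auto simp: T_def)
      have "f = ?h (cls S m)"
        unfolding h[OF mI]
      proof (rule extensionalityI[where A = "c ` C"])
        show "f \<in> extensional (c ` C)" using fP by (simp add: PiE_def)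
        fix w assume "w \<in> c ` C"
        then obtain R where R: "R \<in> C" "w = c R" by blast
        then show "f w = restrict (\<lambda>g. cls (un g) m) (c ` C) w" using m[OF R(1)] code by (simp add: T_def)
      qed simp
      then show "f \<in> ?h ` topspace (QT S)" using mI by simp
    qed
  qed
qed

lemma quotient_homeo:
  assumes V: "icer V" and R: "icer R" and VR: "V \<subseteq> R" and Y: "Hausdorff_space Yt"
    and ext: "is_extension (QT V) (qact V) Yt actY \<phi>"
    and ker: "\<And>m n. m \<in> I \<Longrightarrow> n \<in> I \<Longrightarrow> \<phi> (cls V m) = \<phi> (cls V n) \<longleftrightarrow> (m, n) \<in> R"
  shows "\<exists>h. is_flow_iso Yt actY (QT R) (qact R) h \<and> (\<forall>m\<in>I. h (\<phi> (cls V m)) = cls R m)"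
proof -
  define k where "k c = \<phi> (cls V (rep c))" for c
  have k: "k (cls R m) = \<phi> (cls V m)" if "m \<in> I" for m
    unfolding k_def using rep_cls[OF R that] icerD(3,7)[OF R] ker that by metis
  have \<phi>: "continuous_map (QT V) Yt \<phi>" "\<phi> ` topspace (QT V) = topspace Yt"
    "\<And>t x. x \<in> topspace (QT V) \<Longrightarrow> \<phi> (qact V t x) = actY t (\<phi> x)"
    using ext by (auto simp: is_extension_def is_hom_def)
  have "homeomorphic_map (QT R) Yt k"
  proof (rule continuous_imp_homeomorphic_map[OF _ compact_QT Y])
    have "continuous_map K Yt (\<phi> \<circ> cls V)" by (rule continuous_map_compose[OF continuous_cls \<phi>(1)])
    then have "continuous_map K Yt (k \<circ> cls R)" by (rule continuous_map_eq) (simp add: k)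
    then show "continuous_map (QT R) Yt k" by (rule continuous_compose_quotient_map[OF quotient_cls])
    have "k ` cls R ` I = \<phi> ` cls V ` I" unfolding image_image using k by simp
    then show "k ` topspace (QT R) = topspace Yt" using \<phi>(2) by simp
    show "inj_on k (topspace (QT R))"
    proof (rule inj_onI)
      fix x y assume "x \<in> topspace (QT R)" "y \<in> topspace (QT R)" and eq: "k x = k y"
      then obtain m n where mn: "m \<in> I" "n \<in> I" "x = cls R m" "y = cls R n" by auto
      then have "(m, n) \<in> R" using eq k ker[OF mn(1,2)] by simp
      then show "x = y" using mn(3,4) cls_eq_iff[OF R mn(1,2)] by simp
    qed
  qed
  then obtain h where "homeomorphic_maps (QT R) Yt k h" unfolding homeomorphic_map_maps by blast
  then have h: "homeomorphic_map Yt (QT R) h" "\<And>c. c \<in> topspace (QT R) \<Longrightarrow> h (k c) = c"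
    by (auto simp: homeomorphic_maps_map)
  have h\<phi>: "h (\<phi> (cls V m)) = cls R m" if "m \<in> I" for m
    using h(2)[of "cls R m"] k[OF that] that by simp
  have "h (actY t y) = qact R t (h y)" if y: "y \<in> topspace Yt" for t y
  proof -
    obtain m where m: "m \<in> I" "y = \<phi> (cls V m)" using y \<phi>(2) by auto
    have "actY t y = \<phi> (cls V (act t m))" using \<phi>(3)[of "cls V m" t] m V by simp
    then show ?thesis using h\<phi> m R by simp
  qed
  then show ?thesis using h(1) h\<phi> by (auto simp: is_flow_iso_def)
qed

context
  fixes V RY N and Yt :: "'y topology" and actY :: "'g \<Rightarrow> 'y \<Rightarrow> 'y" and \<phi>
  assumes V: "icer V" "tcont V" and RY: "icer RY" "V \<subseteq> RY"
    and N: "\<And>R. N R \<subseteq> R" "\<And>R. icer R \<Longrightarrow> V \<subseteq> R \<Longrightarrow> icer (N R) \<and> V \<subseteq> N R"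
    and step: "\<And>R. N R \<noteq> R \<Longrightarrow> is_proximal_ext (QT (N R)) (qact (N R)) (QT R) (qact R) (qmap R) \<or>
        is_ap_ext (QT (N R)) (qact (N R)) (QT R) (qact R) (qmap R)"
    and bottom: "V \<in> descent N RY"
    and Yt: "Hausdorff_space Yt"
    and ext: "is_extension (QT V) (qact V) Yt actY \<phi>"
    and ker: "\<And>m n. m \<in> I \<Longrightarrow> n \<in> I \<Longrightarrow> \<phi> (cls V m) = \<phi> (cls V n) \<longleftrightarrow> (m, n) \<in> RY"
begin

lemma tower_icer: "R \<in> descent N RY \<Longrightarrow> icer R \<and> V \<subseteq> R"
proof (induction rule: descent.induct)
  case base
  then show ?case using RY by blast
next
  case (step S)
  then show ?case using N(2) by blast
next
  case (lim C)
  have "icer (\<Inter>C)" by (rule icer_Inter) (use lim in blast)+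
  then show ?case using lim by blast
qed

lemma inj_rset: "inj_on rset (descent N RY)"
proof (rule inj_onI)
  fix R S assume RS: "R \<in> descent N RY" "S \<in> descent N RY" "rset R = rset S"
  have "R \<subseteq> S \<or> S \<subseteq> R" using descent_chain[of N RY, OF N(1)] RS(1,2) by (simp add: chain_def)
  then show "R = S" using rset_strict tower_icer RS by (metis psubsetI)
qed

text \<open>The index order is the descent under reverse inclusion, transported along the injection
  \<open>rset\<close> into the prescribed type. Immediate successors in it are exactly values of
  \<open>N\<close>, and limit indices are intersections.\<close>

lemma tower: "\<exists>(W :: ('g filter set \<times> 'g filter set) set) (Ys :: 'g filter set \<Rightarrow> 'g filter set topology) actYs pr psi.
    has_PI_tower (QT V) (qact V) Yt actY \<phi> W Ys actYs pr psi"
proof -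
  let ?D = "descent N RY"
  define W where "W = dir_image (descent_order N RY) rset"
  define un where "un = the_inv_into ?D rset"
  have un [simp]: "un (rset R) = R" if "R \<in> ?D" for R
    unfolding un_def by (rule the_inv_into_f_f[OF inj_rset that])
  have inj: "rset R = rset S \<longleftrightarrow> R = S" if "R \<in> ?D" "S \<in> ?D" for R S
    using inj_onD[OF inj_rset _ that] by blast
  have Field: "Field W = rset ` ?D"
    by (simp add: W_def dir_image_Field Field_descent_order)
  have W_iff: "(rset R, rset S) \<in> W \<longleftrightarrow> S \<subseteq> R" if "R \<in> ?D" "S \<in> ?D" for R S
    using that inj by (auto simp: W_def dir_image_def descent_order_def)
  have W_ex: "\<exists>R S. R \<in> ?D \<and> S \<in> ?D \<and> g = rset R \<and> d = rset S \<and> S \<subseteq> R" if "(g, d) \<in> W" for g d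
    using that by (auto simp: W_def dir_image_def descent_order_def)
  have below: "strict_below W (rset S) = rset ` {R \<in> ?D. S \<subset> R}" if S: "S \<in> ?D" for S
  proof (intro equalityI subsetI)
    fix g assume "g \<in> strict_below W (rset S)"
    then have g: "(g, rset S) \<in> W" "g \<noteq> rset S" by (auto simp: strict_below_def)
    then obtain R S' where "R \<in> ?D" "S' \<in> ?D" "g = rset R" "rset S = rset S'" "S' \<subseteq> R" using W_ex by metis
    then show "g \<in> rset ` {R \<in> ?D. S \<subset> R}" using inj[OF S] g(2) by blast
  next
    fix g assume "g \<in> rset ` {R \<in> ?D. S \<subset> R}"
    then obtain R where "R \<in> ?D" "S \<subset> R" "g = rset R" by blast
    then show "g \<in> strict_below W (rset S)" using W_iff[of R S] inj[of R S] S by (auto simp: strict_below_def)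
  qed
  have "has_PI_tower (QT V) (qact V) Yt actY \<phi> W (\<lambda>w. QT (un w)) (\<lambda>w. qact (un w)) (\<lambda>w. qmap (un w))
      (\<lambda>g d. qmap (un g))"
    unfolding has_PI_tower_def
  proof (intro conjI)
    show "Well_order W"
      unfolding W_def
      by (rule Well_order_dir_image[OF Well_order_descent[OF N(1)]]) (simp add: Field_descent_order inj_rset)
    show "\<exists>z0 th h. z0 \<in> Field W \<and> th \<in> Field W \<and> (\<forall>g\<in>Field W. (z0, g) \<in> W \<and> (g, th) \<in> W) \<and>
       is_flow_iso Yt actY (QT (un z0)) (qact (un z0)) h \<and>
       (\<forall>x\<in>topspace (QT V). qmap (un z0) x = h (\<phi> x)) \<and>
       is_flow_iso (QT V) (qact V) (QT (un th)) (qact (un th)) (qmap (un th))"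
    proof -
      have RYD: "RY \<in> ?D" by (rule descent.base)
      obtain h where h: "is_flow_iso Yt actY (QT RY) (qact RY) h" "\<forall>m\<in>I. h (\<phi> (cls V m)) = cls RY m"
        using quotient_homeo[OF V(1) RY Yt ext ker] by blast
      have "\<forall>g\<in>Field W. (rset RY, g) \<in> W \<and> (g, rset V) \<in> W"
        unfolding Field using W_iff RYD bottom descent_subset[of N, OF N(1)] tower_icer by blast
      moreover have "\<forall>x\<in>topspace (QT V). qmap (un (rset RY)) x = h (\<phi> x)"
        using h(2) qmap_cls[OF V(1) RY] RYD by auto
      moreover have "is_flow_iso (QT V) (qact V) (QT V) (qact V) (qmap V)"
      proof -
        have id: "qmap V x = x" if "x \<in> topspace (QT V)" for x
          using that qmap_cls[OF V(1) V(1)] by auto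
        have "homeomorphic_map (QT V) (QT V) (qmap V)"
          by (rule homeomorphic_map_eq[of _ _ id]) (simp_all add: id)
        moreover have "qmap V (qact V t x) = qact V t (qmap V x)" if x: "x \<in> topspace (QT V)" for t x
        proof -
          have "qact V t x \<in> topspace (QT V)" using x V(1) by auto
          then show ?thesis using id x by metis
        qed
        ultimately show ?thesis by (simp add: is_flow_iso_def)
      qed
      ultimately show ?thesis
        using h(1) RYD bottom Field by (intro exI[of _ "rset RY"] exI[of _ "rset V"] exI[of _ h]) simp
    qed
    show "\<forall>g\<in>Field W. is_minimal_compact_flow (QT (un g)) (qact (un g)) \<and>
       is_extension (QT V) (qact V) (QT (un g)) (qact (un g)) (qmap (un g))"
    proof
      fix g assume "g \<in> Field W"
      then obtain R where R: "R \<in> ?D" "g = rset R" unfolding Field by blast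
      note RV = tower_icer[OF R(1)]
      show "is_minimal_compact_flow (QT (un g)) (qact (un g)) \<and>
        is_extension (QT V) (qact V) (QT (un g)) (qact (un g)) (qmap (un g))"
        using minimal_QT[of R] tcont_mono[OF V(1) _ _ V(2)] extension_QT[OF V(1)] RV R by simp
    qed
    show "\<forall>g d. (g, d) \<in> W \<longrightarrow> is_extension (QT (un d)) (qact (un d)) (QT (un g)) (qact (un g)) (qmap (un g)) \<and>
       (\<forall>x\<in>topspace (QT V). qmap (un g) (qmap (un d) x) = qmap (un g) x)"
    proof (intro allI impI)
      fix g d assume "(g, d) \<in> W"
      then obtain R S where RS: "R \<in> ?D" "S \<in> ?D" "g = rset R" "d = rset S" "S \<subseteq> R" using W_ex by blast
      note i = tower_icer[OF RS(1)] tower_icer[OF RS(2)]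
      have "qmap R (qmap S x) = qmap R x" if "x \<in> topspace (QT V)" for x
        using that qmap_cls[of V S] qmap_cls[of V R] qmap_cls[of S R] V(1) i RS(5) by auto
      then show "is_extension (QT (un d)) (qact (un d)) (QT (un g)) (qact (un g)) (qmap (un g)) \<and>
        (\<forall>x\<in>topspace (QT V). qmap (un g) (qmap (un d) x) = qmap (un g) x)"
        using RS extension_QT[of S R] i by simp
    qed
    show "\<forall>g d. (g, d) \<in> W \<and> g \<noteq> d \<and> (\<nexists>e. e \<in> strict_below W d \<and> g \<in> strict_below W e) \<longrightarrow>
       is_proximal_ext (QT (un d)) (qact (un d)) (QT (un g)) (qact (un g)) (qmap (un g)) \<or>
       is_ap_ext (QT (un d)) (qact (un d)) (QT (un g)) (qact (un g)) (qmap (un g))"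
    proof (intro allI impI, elim conjE)
      fix g d assume gd: "(g, d) \<in> W" "g \<noteq> d" and no: "\<nexists>e. e \<in> strict_below W d \<and> g \<in> strict_below W e"
      obtain R S where RS: "R \<in> ?D" "S \<in> ?D" "g = rset R" "d = rset S" "S \<subseteq> R"
        using W_ex[OF gd(1)] by blast
      have SR: "S \<subset> R" using RS gd(2) by blast
      \<comment> \<open>A fixed point of \<open>N\<close> would be contained in every member of the
        descent, but \<open>S\<close> is strictly smaller than \<open>R\<close>.\<close>
      have NR: "N R \<noteq> R" using descent_fixpoint_least[OF N(1) RS(1) _ RS(2)] SR by blast
      have ND: "N R \<in> ?D" by (rule descent.step[OF RS(1)])
      have "S \<subseteq> N R" using descent_compare[OF N(1) RS(1,2)] SR by blast
      have "S = N R"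
      proof (rule ccontr)
        assume "S \<noteq> N R"
        then have "rset (N R) \<in> strict_below W d" "g \<in> strict_below W (rset (N R))"
          using \<open>S \<subseteq> N R\<close> N(1)[of R] NR RS ND by (auto simp: below)
        then show False using no by blast
      qed
      then show "is_proximal_ext (QT (un d)) (qact (un d)) (QT (un g)) (qact (un g)) (qmap (un g)) \<or>
        is_ap_ext (QT (un d)) (qact (un d)) (QT (un g)) (qact (un g)) (qmap (un g))"
        using step[OF NR] RS ND by simp
    qed
    show "\<forall>l\<in>Field W. strict_below W l \<noteq> {} \<and>
        (\<forall>g\<in>strict_below W l. \<exists>e. e \<in> strict_below W l \<and> g \<in> strict_below W e) \<longrightarrow>
        homeomorphic_map (QT (un l))
          (subtopology (product_topology (\<lambda>w. QT (un w)) (strict_below W l))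
             {f. \<forall>g\<in>strict_below W l. \<forall>d\<in>strict_below W l. (g, d) \<in> W \<longrightarrow> qmap (un g) (f d) = f g})
          (\<lambda>y. restrict (\<lambda>g. qmap (un g) y) (strict_below W l))"
    proof (intro ballI impI, elim conjE)
      fix l assume "l \<in> Field W" and ne: "strict_below W l \<noteq> {}"
        and nomax: "\<forall>g\<in>strict_below W l. \<exists>e. e \<in> strict_below W l \<and> g \<in> strict_below W e"
      then obtain S where S: "S \<in> ?D" "l = rset S" unfolding Field by blast
      define C where "C = {R \<in> ?D. S \<subset> R}"
      have bel: "strict_below W l = rset ` C" unfolding S(2) C_def by (rule below[OF S(1)])
      have C: "C \<subseteq> ?D" "C \<noteq> {}" using ne bel by (auto simp: C_def)
      have CD: "\<Inter>C \<in> ?D" by (rule descent_Inter[OF N(1) C])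
      \<comment> \<open>If \<open>\<Inter>C\<close> were strictly larger than \<open>S\<close>, it
        would itself belong to \<open>C\<close> and give a last index below
        \<open>l\<close>.\<close>
      have SC: "S = \<Inter>C"
      proof (rule ccontr)
        assume "S \<noteq> \<Inter>C"
        then have "\<Inter>C \<in> C" using CD by (auto simp: C_def)
        then have "rset (\<Inter>C) \<in> strict_below W l" unfolding bel by (rule imageI)
        from bspec[OF nomax this] obtain g where g: "g \<in> strict_below W l" "rset (\<Inter>C) \<in> strict_below W g"
          by (elim exE conjE)
        from g(1) obtain R where R: "R \<in> C" "g = rset R" unfolding bel by (elim imageE)
        have RD: "R \<in> ?D" using R(1) C(1) by blast
        from g(2) obtain R' where R': "R' \<in> ?D" "R \<subset> R'" "rset (\<Inter>C) = rset R'"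
          unfolding R(2) below[OF RD] by blast
        then have "R \<subset> \<Inter>C" using inj[OF CD R'(1)] by simp
        then show False using R(1) by blast
      qed
      show "homeomorphic_map (QT (un l))
          (subtopology (product_topology (\<lambda>w. QT (un w)) (strict_below W l))
             {f. \<forall>g\<in>strict_below W l. \<forall>d\<in>strict_below W l. (g, d) \<in> W \<longrightarrow> qmap (un g) (f d) = f g})
          (\<lambda>y. restrict (\<lambda>g. qmap (un g) y) (strict_below W l))"
        unfolding S(2) bel[unfolded S(2)] un[OF S(1)]
      proof (rule prod_QT_tower_homeo[OF _ _ C(2) _ SC])
        show "icer S" using tower_icer[OF S(1)] by blast
        show "icer R" if "R \<in> C" for R using tower_icer C(1) that by blast
        show "Complete_Partial_Order.chain (\<subseteq>) C"
          by (rule chain_subset[OF descent_chain[of N RY, OF N(1)] C(1)])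
        show "un (rset R) = R" if "R \<in> C" for R using C(1) that by auto
        show "(rset R, rset R') \<in> W \<longleftrightarrow> R' \<subseteq> R" if "R \<in> C" "R' \<in> C" for R R'
          using W_iff C(1) that by blast
      qed
    qed
  qed
  then show ?thesis by blast
qed

end

section \<open>Triviality of the stable group gives a PI-tower\<close>

definition ker :: "('g filter \<Rightarrow> 'z) \<Rightarrow> ('g filter \<times> 'g filter) set" where
  "ker f = {(m, n). m \<in> I \<and> n \<in> I \<and> f m = f n}"

lemma icer_ker:
  assumes ext: "is_extension K act Z actZ f" and Z: "Hausdorff_space Z"
  shows "icer (ker f)"
proof -
  have f: "continuous_map K Z f" "\<And>t m. m \<in> I \<Longrightarrow> f (act t m) = actZ t (f m)"
    using ext by (auto simp: is_extension_def is_hom_def)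
  have "closedin K2 {z \<in> topspace K2. (f \<circ> fst) z = (f \<circ> snd) z}"
    by (rule closedin_continuous_maps_eq[OF Z])
      (rule continuous_map_compose[OF continuous_map_fst f(1)], rule continuous_map_compose[OF continuous_map_snd f(1)])
  moreover have "{z \<in> topspace K2. (f \<circ> fst) z = (f \<circ> snd) z} = ker f" by (auto simp: ker_def)
  ultimately have "closedin K2 (ker f)" by simp
  then show ?thesis by (simp add: icer_def ker_def f(2))
qed

lemma grp_ker:
  assumes "icer (ker f)"
  shows "grp (ker f) = FF_of I f"
proof (intro equalityI subsetI)
  fix \<alpha> assume \<alpha>: "\<alpha> \<in> grp (ker f)"
  then have "f (\<alpha> m) = f m" if "m \<in> I" for m
    using grp_iff[OF assms that, of \<alpha>] by (simp add: ker_def)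
  then show "\<alpha> \<in> FF_of I f" using \<alpha> by (simp add: FF_of_def grp_def)
next
  fix \<alpha> assume "\<alpha> \<in> FF_of I f"
  then show "\<alpha> \<in> grp (ker f)" by (simp add: FF_of_def grp_def ker_def)
qed

lemma extension_comp:
  assumes "is_extension K act Z actZ f" "is_extension Z actZ Y actY g"
  shows "is_extension K act Y actY (g \<circ> f)"
proof -
  have f: "continuous_map K Z f" "\<And>t m. m \<in> I \<Longrightarrow> f (act t m) = actZ t (f m)" "f ` I = topspace Z"
    using assms(1) by (auto simp: is_extension_def is_hom_def)
  have g: "continuous_map Z Y g" "\<And>t z. z \<in> topspace Z \<Longrightarrow> g (actZ t z) = actY t (g z)" "g ` topspace Z = topspace Y"
    using assms(2) by (auto simp: is_extension_def is_hom_def)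
  have "g (f (act t m)) = actY t (g (f m))" if "m \<in> I" for t m
    using f(2)[OF that] g(2)[of "f m"] f(3) that by auto
  moreover have "(g \<circ> f) ` I = topspace Y" unfolding image_comp[symmetric] f(3) g(3) ..
  ultimately show ?thesis
    using continuous_map_compose[OF f(1) g(1)] by (simp add: is_extension_def is_hom_def)
qed

text \<open>Joint continuity at the points \<open>(0, x)\<close>, made uniform by compactness of
  \<open>X\<close>. Here the topology of the group acting on \<open>X\<close> enters the study of
  \<open>UC\<close>.\<close>

lemma flow_uniform:
  fixes actX :: "'g \<Rightarrow> 'x::metric_space \<Rightarrow> 'x"
  assumes X: "compact X" and flow: "is_flow euclidean (top_of_set X) actX" and \<epsilon>: "\<epsilon> > 0"
  shows "\<exists>N. open N \<and> 0 \<in> N \<and> (\<forall>s\<in>N. \<forall>x\<in>X. dist (actX s x) x < \<epsilon>)"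
proof -
  have cont: "continuous_map (prod_topology euclidean (top_of_set X)) (top_of_set X) (\<lambda>(t, x). actX t x)"
    and zero: "\<And>x. x \<in> X \<Longrightarrow> actX 0 x = x"
    using flow by (auto simp: is_flow_def)
  have "\<exists>N U. open N \<and> 0 \<in> N \<and> open U \<and> x \<in> U \<and> (\<forall>s\<in>N. \<forall>y\<in>U \<inter> X. dist (actX s y) y < \<epsilon>)" if x: "x \<in> X" for x
  proof -
    define P where "P = {z \<in> topspace (prod_topology euclidean (top_of_set X)).
      (case z of (t, y) \<Rightarrow> actX t y) \<in> X \<inter> ball x (\<epsilon> / 2)}"
    have "openin (top_of_set X) (X \<inter> ball x (\<epsilon> / 2))" by (simp add: openin_open_Int)
    then have P: "openin (prod_topology euclidean (top_of_set X)) P"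
      unfolding P_def by (rule openin_continuous_map_preimage[OF cont])
    have "(0, x) \<in> P" using x zero \<epsilon> by (simp add: P_def)
    from P[unfolded openin_prod_topology_alt, rule_format, OF this]
    obtain N U where NU: "openin euclidean N" "openin (top_of_set X) U" "0 \<in> N" "x \<in> U" "N \<times> U \<subseteq> P"
      by (elim exE conjE)
    obtain U' where U': "open U'" "U = X \<inter> U'" using NU(2) by (auto simp: openin_open)
    have "dist (actX s y) y < \<epsilon>" if s: "s \<in> N" and y: "y \<in> (U' \<inter> ball x (\<epsilon> / 2)) \<inter> X" for s y
    proof -
      have "(s, y) \<in> P" using NU(5) s y U'(2) by blast
      then have "dist x (actX s y) < \<epsilon> / 2" by (simp add: P_def)
      moreover have "dist x y < \<epsilon> / 2" using y by simp
      ultimately show ?thesis using dist_triangle3[of "actX s y" y x] by simp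
    qed
    then show ?thesis using NU(1,3,4) U' \<epsilon>
      by (intro exI[of _ N] exI[of _ "U' \<inter> ball x (\<epsilon> / 2)"]) auto
  qed
  then obtain N U where NU: "\<And>x. x \<in> X \<Longrightarrow> open (N x) \<and> 0 \<in> N x \<and> open (U x) \<and> x \<in> U x \<and>
      (\<forall>s\<in>N x. \<forall>y\<in>U x \<inter> X. dist (actX s y) y < \<epsilon>)" by metis
  obtain D where D: "D \<subseteq> X" "finite D" "X \<subseteq> (\<Union>x\<in>D. U x)"
    using compactE_image[OF X, of X U] NU by blast
  have "open (\<Inter>x\<in>D. N x)" using D NU by (intro open_INT) auto
  moreover have "0 \<in> (\<Inter>x\<in>D. N x)" using D NU by blast
  moreover have "dist (actX s y) y < \<epsilon>" if sy: "s \<in> (\<Inter>x\<in>D. N x)" "y \<in> X" for s y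
  proof -
    obtain x where "x \<in> D" "y \<in> U x" using D(3) sy(2) by blast
    then show ?thesis using NU[of x] D(1) sy by blast
  qed
  ultimately show ?thesis by blast
qed

text \<open>The distance from \<open>f m\<close>, pulled back to \<open>I\<close>, is a function in
  \<open>UC\<close>, so the metric of \<open>X\<close> separates any two points that
  \<open>f\<close> separates.\<close>

lemma RV_subset_ker:
  fixes actX :: "'g \<Rightarrow> 'x::metric_space \<Rightarrow> 'x"
  assumes X: "compact X" "is_flow euclidean (top_of_set X) actX"
    and ext: "is_extension K act (top_of_set X) actX f"
  shows "RV (FF_of I f) \<subseteq> ker f"
proof
  fix z assume z: "z \<in> RV (FF_of I f)"
  obtain m n where mn: "z = (m, n)" by (cases z)
  have mI: "m \<in> I" "n \<in> I" using z by (auto simp: mn RV_iff)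
  have f: "continuous_map K (top_of_set X) f" "\<And>t m. m \<in> I \<Longrightarrow> f (act t m) = actX t (f m)" "f ` I = X"
    using ext by (auto simp: is_extension_def is_hom_def)
  define g where "g k = dist (f m) (f k)" for k
  have "g \<in> UC (FF_of I f)"
  proof (rule UC_I)
    have "continuous_map (top_of_set X) euclideanreal (\<lambda>x. dist (f m) x)"
      by (simp add: continuous_map_iff_continuous continuous_intros)
    from continuous_map_compose[OF f(1) this] show "continuous_map K euclideanreal g"
      unfolding o_def g_def .
    show "g (\<alpha> k) = g k" if "\<alpha> \<in> FF_of I f" "k \<in> I" for \<alpha> k
      using that by (simp add: FF_of_def g_def)
    fix \<epsilon> :: real assume "\<epsilon> > 0"
    from flow_uniform[OF X this] obtain N where N: "open N" "0 \<in> N"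
      "\<And>s x. s \<in> N \<Longrightarrow> x \<in> X \<Longrightarrow> dist (actX s x) x < \<epsilon>" by blast
    have "\<bar>g (act s k) - g k\<bar> < \<epsilon>" if "s \<in> N" "k \<in> I" for s k
    proof -
      have "\<bar>g (act s k) - g k\<bar> \<le> dist (f (act s k)) (f k)"
        unfolding g_def using abs_dist_diff_le[of "f (act s k)" "f m" "f k"] by (simp add: dist_commute)
      also have "\<dots> < \<epsilon>" using N(3)[OF that(1), of "f k"] f(2,3) that(2) by auto
      finally show ?thesis .
    qed
    then show "\<exists>N. open N \<and> 0 \<in> N \<and> (\<forall>s\<in>N. \<forall>m\<in>I. \<bar>g (act s m) - g m\<bar> < \<epsilon>)"
      using N(1,2) by blast
  qed
  then have "g m = g n" using z by (simp add: mn RV_iff)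
  then have "f m = f n" by (simp add: g_def)
  then show "z \<in> ker f" using mI by (simp add: mn ker_def)
qed

definition refines where
  "refines V R S \<longleftrightarrow> icer R \<and> icer S \<and> V \<subseteq> S \<and> S \<subset> R \<and>
     (is_proximal_ext (QT S) (qact S) (QT R) (qact R) (qmap R) \<or>
      is_ap_ext (QT S) (qact S) (QT R) (qact R) (qmap R))"

text \<open>Returning \<open>R\<close> itself when no refinement exists makes the map decreasing on
  all relations, and makes its fixed points exactly the relations that admit no further
  step.\<close>

definition refinement where
  "refinement V R = (if \<exists>S. refines V R S then SOME S. refines V R S else R)"

lemma refinement: "refines V R (refinement V R) \<or> refinement V R = R \<and> (\<nexists>S. refines V R S)"
  unfolding refinement_def by (auto intro: someI)

text \<open>Two refinements are tried in turn and must both be trivial: intersecting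
  \<open>R\<close> with \<open>RV H\<close> yields the density of graphs, and the relation
  \<open>E\<close> for \<open>B = H' A\<close>, with \<open>H'\<close> the derived group, then
  yields \<open>H \<subseteq> B\<close>. A third, \<open>V\<close> itself, finishes once
  \<open>H\<close> is known to lie in the group of \<open>V\<close>.\<close>

lemma unrefinable_eq:
  assumes A: "csub A" and V: "V = RV A" "grp V = A" and R: "icer R" "V \<subseteq> R"
    and F: "csub F" "grp R \<subseteq> F" and trivial: "F_infty I F \<subseteq> A"
    and no: "\<nexists>S. refines V R S"
  shows "R = V"
proof -
  have AA: "A \<subseteq> Aut I" using csubD(1)[OF A] .
  have iV: "icer V" unfolding V(1) by (rule icer_RV[OF AA])
  define H where "H = grp R"
  have H: "csub H" unfolding H_def by (rule csub_grp[OF R(1)])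
  have HA: "H \<subseteq> Aut I" using csubD(1)[OF H] .
  have AH: "A \<subseteq> H" using V(2) R(2) by (auto simp: grp_def H_def)
  have prox: "S = R" if S: "icer S" "V \<subseteq> S" "S \<subseteq> R" "H \<subseteq> grp S" for S
  proof (rule ccontr)
    assume "S \<noteq> R"
    moreover have "is_proximal_ext (QT S) (qact S) (QT R) (qact R) (qmap R)"
      by (rule proximal_qmap[OF S(1) R(1) S(3)]) (use S(4) in \<open>simp add: H_def\<close>)
    ultimately have "refines V R S" using S R(1) by (auto simp: refines_def)
    then show False using no by blast
  qed
  \<comment> \<open>\<open>RV H\<close> contains the graphs of \<open>H\<close>, so intersecting
    with it does not shrink the group below \<open>H\<close>, and the extension so obtained would be
    proximal.\<close>
  have "R \<inter> RV H = R"
  proof (rule prox)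
    have "icer (\<Inter>{R, RV H})" by (rule icer_Inter) (use R(1) icer_RV[OF HA] in auto)
    then show "icer (R \<inter> RV H)" by simp
    show "V \<subseteq> R \<inter> RV H" using R(2) RV_mono[OF AH] V(1) by blast
    show "H \<subseteq> grp (R \<inter> RV H)" using grp_RV[OF HA] by (auto simp: grp_def H_def)
  qed simp
  then have RH: "R \<subseteq> RV H" by blast
  have dense: "\<exists>n'. (m, n') \<in> Qcl (grp R) \<and> (n', n) \<in> V" if "(m, n) \<in> R" for m n
    using RV_dense_graphs[OF H AA, of m n] RH that unfolding V(1) H_def by blast
  define B where "B = gprod (derived I H) A"
  have "normalizes A H"
    using descent_csub[OF H A AH descent.base] by blast
  then have norm: "normalizes A (derived I H)" by (rule normalizes_derived[OF H AA])
  have B: "csub B" unfolding B_def by (rule csub_gprod[OF csub_derived[OF H] A norm])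
  have dB: "derived I (grp R) \<subseteq> B" unfolding B_def H_def[symmetric] by (rule gprod_left[OF A])
  have VB: "grp V \<subseteq> B" unfolding B_def V(2) by (rule gprod_right[OF csub_derived[OF H]])
  have HB: "H \<subseteq> B"
  proof (rule ccontr)
    assume nHB: "\<not> H \<subseteq> B"
    define E where "E = {(m, n) \<in> R. kap m n \<in> B}"
    note hyps = R(1) iV R(2) dense B dB VB E_def
    have "E \<noteq> R" by (rule E_neq[OF hyps nHB[unfolded H_def]])
    moreover have "E \<subseteq> R" by (rule E_R[OF hyps])
    moreover have "icer E" by (rule icer_E[OF hyps])
    moreover have "V \<subseteq> E" by (rule V_E[OF hyps])
    moreover have "is_ap_ext (QT E) (qact E) (QT R) (qact R) (qmap R)" by (rule ap_E[OF hyps])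
    ultimately have "refines V R E" using R(1) by (auto simp: refines_def)
    then show False using no by blast
  qed
  have "H \<subseteq> gprod (F_infty I F) A"
    by (rule subgroup_F_infty[OF F(1) A]) (use AH F(2) HB in \<open>auto simp: H_def B_def\<close>)
  also have "\<dots> \<subseteq> A" using trivial csubD(4)[OF A] by (auto simp: gprod_def)
  finally have "H \<subseteq> grp V" using V(2) by simp
  then show ?thesis using prox[OF iV order_refl R(2)] by simp
qed

theorem PI_of_trivial_F_infty:
  fixes actX :: "'g \<Rightarrow> 'x::metric_space \<Rightarrow> 'x"
  assumes X: "compact X" "is_minimal_compact_flow (top_of_set X) actX"
    and Y: "is_minimal_compact_flow Yt actY"
    and \<pi>: "is_extension (top_of_set X) actX Yt actY \<pi>"
    and piX: "is_extension K act (top_of_set X) actX piX"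
    and trivial: "F_infty I (FF_of I (\<pi> \<circ> piX)) \<subseteq> FF_of I piX"
  shows "is_PI (top_of_set X) actX Yt actY \<pi>"
proof -
  have flowX: "is_flow euclidean (top_of_set X) actX" and HX: "Hausdorff_space (top_of_set X)"
    and HY: "Hausdorff_space Yt"
    using X(2) Y by (auto simp: is_minimal_compact_flow_def is_minimal_flow_def)
  define A where "A = FF_of I piX"
  define F where "F = FF_of I (\<pi> \<circ> piX)"
  define V where "V = RV A"
  define RY where "RY = ker (\<pi> \<circ> piX)"
  have piY: "is_extension K act Yt actY (\<pi> \<circ> piX)" by (rule extension_comp[OF piX \<pi>])
  have kX: "icer (ker piX)" by (rule icer_ker[OF piX HX])
  have RY: "icer RY" unfolding RY_def by (rule icer_ker[OF piY HY])
  have A: "csub A" unfolding A_def using csub_grp[OF kX] grp_ker[OF kX] by simp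
  have "grp RY = F" unfolding F_def RY_def by (rule grp_ker[OF RY[unfolded RY_def]])
  then have F: "csub F" "grp RY = F" using csub_grp[OF RY] by simp_all
  have AA: "A \<subseteq> Aut I" using csubD(1)[OF A] .
  have V: "icer V" unfolding V_def by (rule icer_RV[OF AA])
  have Vker: "V \<subseteq> ker piX" unfolding V_def A_def by (rule RV_subset_ker[OF X(1) flowX piX])
  have grpV: "grp V = A"
  proof
    show "grp V \<subseteq> A" using Vker grp_ker[OF kX] unfolding A_def by (auto simp: grp_def)
    show "A \<subseteq> grp V" unfolding V_def by (rule grp_RV[OF AA])
  qed
  have VRY: "V \<subseteq> RY" using Vker by (auto simp: RY_def ker_def)
  have tV: "tcont V" unfolding V_def by (rule tcont_RV[OF AA icer_RV[OF AA] order_refl])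
  \<comment> \<open>The choice of representative is harmless because \<open>V\<close> is contained
    in the kernel of \<open>piX\<close>.\<close>
  define \<rho> where "\<rho> c = piX (rep c)" for c
  have \<rho>: "\<rho> (cls V m) = piX m" if "m \<in> I" for m
  proof -
    have "(m, rep (cls V m)) \<in> ker piX" using rep_cls[OF V that] Vker by blast
    then show ?thesis by (simp add: ker_def \<rho>_def)
  qed
  have pX: "continuous_map K (top_of_set X) piX" "\<And>t m. m \<in> I \<Longrightarrow> piX (act t m) = actX t (piX m)" "piX ` I = X"
    using piX by (auto simp: is_extension_def is_hom_def)
  have ext\<rho>: "is_extension (QT V) (qact V) (top_of_set X) actX \<rho>"
    unfolding is_extension_def is_hom_def
  proof (intro conjI allI ballI)
    have "continuous_map K (top_of_set X) (\<rho> \<circ> cls V)" by (rule continuous_map_eq[OF pX(1)]) (simp add: \<rho>)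
    then show "continuous_map (QT V) (top_of_set X) \<rho>" by (rule continuous_compose_quotient_map[OF quotient_cls])
    show "\<rho> (qact V t x) = actX t (\<rho> x)" if "x \<in> topspace (QT V)" for t x
      using that V pX(2) \<rho> by auto
    have "\<rho> ` cls V ` I = piX ` I" unfolding image_image using \<rho> by simp
    then show "\<rho> ` topspace (QT V) = topspace (top_of_set X)" using pX(3) by simp
  qed
  have prox: "is_proximal_ext (QT V) (qact V) (top_of_set X) actX \<rho>"
  proof (rule proximal_QT[OF V ext\<rho>])
    fix m n assume mn: "m \<in> I" "n \<in> I" and "\<rho> (cls V m) = \<rho> (cls V n)"
    then have "(m, n) \<in> ker piX" using \<rho> by (simp add: ker_def)
    then have "kap m n \<in> grp V" using kap_grp[OF kX] grp_ker[OF kX] grpV A_def by simp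
    then have "(e \<odot> m, kap m n (e \<odot> m)) \<in> V" using grp_iff[OF V, of "e \<odot> m"] mn by simp
    then show "(e \<odot> m, e \<odot> n) \<in> V" using kap_eq[OF mn] by simp
  qed
  have ext\<phi>: "is_extension (QT V) (qact V) Yt actY (\<pi> \<circ> \<rho>)"
    unfolding is_extension_def is_hom_def
  proof (intro conjI allI ballI)
    have \<rho>': "continuous_map (QT V) (top_of_set X) \<rho>" "\<rho> ` topspace (QT V) = X"
      "\<And>t x. x \<in> topspace (QT V) \<Longrightarrow> \<rho> (qact V t x) = actX t (\<rho> x)"
      using ext\<rho> by (auto simp: is_extension_def is_hom_def)
    have \<pi>': "continuous_map (top_of_set X) Yt \<pi>" "\<pi> ` X = topspace Yt"
      "\<And>t x. x \<in> X \<Longrightarrow> \<pi> (actX t x) = actY t (\<pi> x)"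
      using \<pi> by (auto simp: is_extension_def is_hom_def)
    show "continuous_map (QT V) Yt (\<pi> \<circ> \<rho>)" by (rule continuous_map_compose[OF \<rho>'(1) \<pi>'(1)])
    show "(\<pi> \<circ> \<rho>) (qact V t x) = actY t ((\<pi> \<circ> \<rho>) x)" if x: "x \<in> topspace (QT V)" for t x
    proof -
      have "\<rho> x \<in> X" using \<rho>'(2) x by blast
      then show ?thesis using \<rho>'(3)[OF x] \<pi>'(3) by simp
    qed
    show "(\<pi> \<circ> \<rho>) ` topspace (QT V) = topspace Yt"
      unfolding image_comp[symmetric] \<rho>'(2) \<pi>'(2) ..
  qed
  define N where "N = refinement V"
  have N1: "N R \<subseteq> R" for R using refinement[of V R] by (auto simp: N_def refines_def)
  have N2: "icer (N R) \<and> V \<subseteq> N R" if "icer R" "V \<subseteq> R" for R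
    using refinement[of V R] that by (auto simp: N_def refines_def)
  have N3: "is_proximal_ext (QT (N R)) (qact (N R)) (QT R) (qact R) (qmap R) \<or>
      is_ap_ext (QT (N R)) (qact (N R)) (QT R) (qact R) (qmap R)" if "N R \<noteq> R" for R
    using refinement[of V R] that by (auto simp: N_def refines_def)
  define L where "L = \<Inter>(descent N RY)"
  have L: "L \<in> descent N RY" "N L = L"
    unfolding L_def using descent_fixpoint[of N RY, OF N1] by auto
  have "icer S \<and> V \<subseteq> S" if "S \<in> descent N RY" for S
    using that
  proof induction
    case base
    then show ?case using RY VRY by blast
  next
    case (step S)
    then show ?case using N2 by blast
  next
    case (lim C)
    have "icer (\<Inter>C)" by (rule icer_Inter) (use lim in blast)+
    then show ?case using lim by blast
  qed
  then have iL: "icer L" "V \<subseteq> L" using L(1) by auto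
  have "L \<subseteq> RY" using descent_subset[OF N1 L(1)] .
  then have "grp L \<subseteq> F" unfolding F(2)[symmetric] by (auto simp: grp_def)
  moreover have "\<nexists>S. refines V L S" using refinement[of V L] L(2) by (auto simp: N_def refines_def)
  ultimately have "L = V"
    using unrefinable_eq[OF A V_def grpV iL F(1)] trivial unfolding A_def F_def by blast
  then have bottom: "V \<in> descent N RY" using L(1) by simp
  have kerY: "(\<pi> \<circ> \<rho>) (cls V m) = (\<pi> \<circ> \<rho>) (cls V n) \<longleftrightarrow> (m, n) \<in> RY" if "m \<in> I" "n \<in> I" for m n
    using that \<rho> by (simp add: RY_def ker_def)
  have "\<exists>(W :: ('g filter set \<times> 'g filter set) set) (Ys :: 'g filter set \<Rightarrow> 'g filter set topology) actYs pr psi.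
    has_PI_tower (QT V) (qact V) Yt actY (\<pi> \<circ> \<rho>) W Ys actYs pr psi"
    by (rule tower[where N = N, OF V tV RY VRY N1 N2 N3 bottom HY ext\<phi> kerY])
  then show ?thesis
    unfolding is_PI_def using minimal_QT[OF V tV] prox by blast
qed

end

section \<open>Residual sets and fibres\<close>

lemma closure_meets: "x \<in> closure S \<Longrightarrow> open Q \<Longrightarrow> x \<in> Q \<Longrightarrow> S \<inter> Q \<noteq> {}"
  using open_Int_closure_eq_empty[of Q S] by blast

lemma residual_inI:
  fixes U :: "nat \<Rightarrow> 'a::topological_space set"
  assumes "\<And>n. openin (top_of_set S) (U n)" "\<And>n. S \<subseteq> closure (U n)" "(\<Inter>n. U n) \<subseteq> A" "A \<subseteq> S"
  shows "residual_in S A"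
  unfolding residual_in_def by (intro conjI exI[where x = U] allI) (rule assms)+

lemma residual_in_countable:
  assumes \<U>: "countable \<U>" "\<And>U. U \<in> \<U> \<Longrightarrow> openin (top_of_set S) U \<and> S \<subseteq> closure U"
    and A: "A \<subseteq> S" "\<And>x. x \<in> S \<Longrightarrow> (\<And>U. U \<in> \<U> \<Longrightarrow> x \<in> U) \<Longrightarrow> x \<in> A"
  shows "residual_in S A"
proof -
  \<comment> \<open>Adding \<open>S\<close> makes the family nonempty, so that it can be enumerated
    by the naturals, and changes no intersection within \<open>S\<close>.\<close>
  let ?\<V> = "insert S \<U>"
  have range: "range (from_nat_into ?\<V>) = ?\<V>" by (rule range_from_nat_into) (use \<U>(1) in auto)
  have mem: "openin (top_of_set S) U \<and> S \<subseteq> closure U" if "U \<in> ?\<V>" for U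
    using that \<U>(2) closure_subset by auto
  have U: "openin (top_of_set S) (from_nat_into ?\<V> n) \<and> S \<subseteq> closure (from_nat_into ?\<V> n)" for n
    by (rule mem) (use range in blast)
  have "(\<Inter>n. from_nat_into ?\<V> n) \<subseteq> A"
  proof
    fix x assume "x \<in> (\<Inter>n. from_nat_into ?\<V> n)"
    then have "x \<in> U" if "U \<in> ?\<V>" for U using that range by (metis INT_D UNIV_I imageE)
    then show "x \<in> A" using A(2) by blast
  qed
  then show ?thesis by (rule residual_inI[OF conjunct1[OF U] conjunct2[OF U] _ A(1)])
qed

text \<open>A substitute for a countable base in which a smaller closed ball catches the point and
  the doubled open ball stays in the given set. The gap between the radii is what
  \<open>residual_fibres\<close> exploits.\<close>

lemma compact_countable_balls:
  fixes M :: "'m::metric_space set"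
  assumes "compact M"
  shows "\<exists>D. countable D \<and> (\<forall>z O'. z \<in> M \<longrightarrow> open O' \<longrightarrow> z \<in> O' \<longrightarrow>
    (\<exists>(c, r)\<in>D. r > 0 \<and> z \<in> cball c r \<and> ball c (2 * r) \<subseteq> O'))"
proof -
  define \<rho> :: "nat \<Rightarrow> real" where "\<rho> n = inverse (real (Suc n))" for n
  have \<rho>: "\<rho> n > 0" for n by (simp add: \<rho>_def)
  have "\<exists>C. C \<subseteq> M \<and> finite C \<and> M \<subseteq> (\<Union>c\<in>C. ball c (\<rho> n))" for n
    using compactE_image[OF assms, of M "\<lambda>c. ball c (\<rho> n)"] \<rho>[of n] by (metis UN_I centre_in_ball open_ball subsetI)
  then obtain C where C: "\<And>n. finite (C n)" "\<And>n. M \<subseteq> (\<Union>c\<in>C n. ball c (\<rho> n))" by metis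
  define D where "D = (\<Union>n. (\<lambda>c. (c, \<rho> n)) ` C n)"
  have "countable ((\<lambda>c. (c, \<rho> n)) ` C n)" for n by (rule countable_finite[OF finite_imageI[OF C(1)]])
  then have "countable D" unfolding D_def by (intro countable_UN) auto
  moreover have "\<exists>(c, r)\<in>D. r > 0 \<and> z \<in> cball c r \<and> ball c (2 * r) \<subseteq> O'" if "z \<in> M" "open O'" "z \<in> O'" for z O'
  proof -
    obtain \<epsilon> where \<epsilon>: "\<epsilon> > 0" "ball z \<epsilon> \<subseteq> O'" using \<open>open O'\<close> \<open>z \<in> O'\<close> by (meson open_contains_ball)
    \<comment> \<open>A point of the doubled ball is within \<open>2 * \<rho> n\<close> of the
      centre, which is within \<open>\<rho> n\<close> of \<open>z\<close>; hence the factor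
      3.\<close>
    obtain n where n: "\<rho> n < \<epsilon> / 3" using reals_Archimedean[of "\<epsilon> / 3"] \<epsilon>(1) unfolding \<rho>_def by auto
    obtain c where c: "c \<in> C n" "z \<in> ball c (\<rho> n)" using C(2) \<open>z \<in> M\<close> by blast
    have "ball c (2 * \<rho> n) \<subseteq> ball z \<epsilon>"
    proof
      fix w assume "w \<in> ball c (2 * \<rho> n)"
      then have "dist z w < 3 * \<rho> n" using c(2) dist_triangle[of z w c] by (simp add: dist_commute)
      then show "w \<in> ball z \<epsilon>" using n by simp
    qed
    then show ?thesis
      using c \<epsilon>(2) \<rho>[of n] by (intro bexI[of _ "(c, \<rho> n)"]) (auto simp: D_def)
  qed
  ultimately show ?thesis by blast
qed

text \<open>The Kuratowski--Ulam argument works for maps that are only semi-open: a dense open set \<open>U\<close> meets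
  the fibres over the points of \<open>f (U \<inter> W)\<^sup>\<circ> \<union> (N - f C)\<close> inside \<open>W \<supseteq> C\<close> as soon as these meet \<open>C\<close>.\<close>

lemma residual_fibres:
  fixes f :: "'m::metric_space \<Rightarrow> 'n::metric_space"
  assumes M: "compact M" and f: "continuous_on M f" "f ` M \<subseteq> N"
    and semi: "\<And>W. open W \<Longrightarrow> W \<inter> M \<noteq> {} \<Longrightarrow> \<exists>V. open V \<and> V \<inter> N \<noteq> {} \<and> V \<inter> N \<subseteq> f ` (M \<inter> W)"
    and G: "residual_in M G"
  shows "\<exists>N0. residual_in N N0 \<and> (\<forall>n\<in>N0. residual_in {m \<in> M. f m = n} {m \<in> G. f m = n})"
proof -
  obtain D where D: "countable D" "\<And>z O'. z \<in> M \<Longrightarrow> open O' \<Longrightarrow> z \<in> O' \<Longrightarrow>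
    \<exists>(c, r)\<in>D. r > 0 \<and> z \<in> cball c r \<and> ball c (2 * r) \<subseteq> O'"
    using compact_countable_balls[OF M] by blast
  obtain U :: "nat \<Rightarrow> 'm set" where GM: "G \<subseteq> M" and U: "\<And>k. openin (top_of_set M) (U k)" "\<And>k. M \<subseteq> closure (U k)" "(\<Inter>k. U k) \<subseteq> G"
    using G unfolding residual_in_def by blast
  have UM: "U k \<subseteq> M" for k using openin_imp_subset[OF U(1)] .
  define S where "S k c r = U k \<inter> ball c (2 * r)" for k :: nat and c :: 'm and r :: real
  \<comment> \<open>The relative interior in \<open>N\<close> of the image of
    \<open>S k c r\<close>, written as the trace of an open set of the ambient space.\<close>
  define B where "B k c r = \<Union>{V. open V \<and> V \<inter> N \<subseteq> f ` S k c r}" for k c r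
  define E where "E k c r = (N \<inter> B k c r) \<union> (N - f ` (M \<inter> cball c r))" for k c r
  define \<E> where "\<E> = (\<lambda>(k, c, r). E k c r) ` (UNIV \<times> {(c, r) \<in> D. r > 0})"
  have Eopen: "openin (top_of_set N) (E k c r)" for k c r
  proof -
    have "open (B k c r)" unfolding B_def by (intro open_Union) auto
    moreover have "compact (f ` (M \<inter> cball c r))"
      by (intro compact_continuous_image continuous_on_subset[OF f(1)] compact_Int_closed M) auto
    then have "closed (f ` (M \<inter> cball c r))" by (rule compact_imp_closed)
    then have "openin (top_of_set N) (N - f ` (M \<inter> cball c r))"
      unfolding Diff_eq by (intro openin_open_Int open_Compl)
    ultimately show ?thesis unfolding E_def by (intro openin_Un openin_open_Int)
  qed
  have Edense: "N \<subseteq> closure (E k c r)" if r: "r > 0" for k c r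
  proof
    fix n assume n: "n \<in> N"
    show "n \<in> closure (E k c r)"
      unfolding closure_iff_nhds_not_empty
    proof (intro allI impI)
      fix P Q assume PQ: "Q \<subseteq> P" "open Q" "n \<in> Q"
      show "E k c r \<inter> P \<noteq> {}"
      proof (cases "n \<in> f ` (M \<inter> cball c r)")
        case False
        then show ?thesis using n PQ by (auto simp: E_def)
      next
        case True
        then obtain z where z: "z \<in> M" "z \<in> cball c r" "f z = n" by blast
        obtain T where T: "open T" "T \<inter> M = f -` Q \<inter> M"
          using f(1) PQ(2) unfolding continuous_on_open_invariant by blast
        have "z \<in> T \<inter> ball c (2 * r)" using T(2) z PQ(3) r by auto
        moreover have "z \<in> closure (U k)" using U(2)[of k] z(1) by blast
        ultimately have "U k \<inter> (T \<inter> ball c (2 * r)) \<noteq> {}"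
          by (intro closure_meets[where x = z] open_Int T(1) open_ball)
        moreover obtain U' where U': "open U'" "U k = M \<inter> U'" using U(1)[of k] by (auto simp: openin_open)
        ultimately have "(U' \<inter> (T \<inter> ball c (2 * r))) \<inter> M \<noteq> {}" by blast
        then obtain V where V: "open V" "V \<inter> N \<noteq> {}" "V \<inter> N \<subseteq> f ` (M \<inter> (U' \<inter> (T \<inter> ball c (2 * r))))"
          using semi[of "U' \<inter> (T \<inter> ball c (2 * r))"] U'(1) T(1) by blast
        have "V \<inter> N \<subseteq> f ` S k c r" "V \<inter> N \<subseteq> Q" using V(3) U'(2) T(2) by (auto simp: S_def)
        then have "V \<subseteq> B k c r" using V(1) by (auto simp: B_def)
        then show ?thesis using V(2) \<open>V \<inter> N \<subseteq> Q\<close> PQ(1) by (auto simp: E_def)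
      qed
    qed
  qed
  define N0 where "N0 = {n \<in> N. \<forall>X\<in>\<E>. n \<in> X}"
  have "residual_in N N0"
  proof (rule residual_in_countable)
    have "countable {(c, r) \<in> D. r > 0}" by (rule countable_subset[OF _ D(1)]) auto
    then show "countable \<E>" unfolding \<E>_def by (intro countable_image countable_SIGMA) auto
    show "openin (top_of_set N) X \<and> N \<subseteq> closure X" if X: "X \<in> \<E>" for X
    proof -
      obtain k c r where "X = E k c r" "r > 0" using X unfolding \<E>_def by auto
      then show ?thesis using Eopen Edense by simp
    qed
  qed (auto simp: N0_def)
  moreover have "residual_in {m \<in> M. f m = n} {m \<in> G. f m = n}" if n: "n \<in> N0" for n
  proof -
    let ?\<Phi> = "{m \<in> M. f m = n}"
    have op: "openin (top_of_set ?\<Phi>) (U k \<inter> ?\<Phi>)" for k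
    proof -
      obtain U' where U': "open U'" "U k = M \<inter> U'" using U(1)[of k] by (auto simp: openin_open)
      then have "U k \<inter> ?\<Phi> = ?\<Phi> \<inter> U'" by auto
      then show ?thesis using U'(1) by (simp add: openin_open_Int)
    qed
    have dense: "?\<Phi> \<subseteq> closure (U k \<inter> ?\<Phi>)" for k
    proof
      fix z assume z: "z \<in> ?\<Phi>"
      show "z \<in> closure (U k \<inter> ?\<Phi>)"
        unfolding closure_iff_nhds_not_empty
      proof (intro allI impI)
        fix P Q assume PQ: "Q \<subseteq> P" "open Q" "z \<in> Q"
        obtain c r where cr: "(c, r) \<in> D" "r > 0" "z \<in> cball c r" "ball c (2 * r) \<subseteq> Q"
          using D(2)[of z Q] z PQ by blast
        have "E k c r \<in> \<E>" unfolding \<E>_def using cr(1,2) by force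
        then have "n \<in> E k c r" using n by (simp add: N0_def)
        moreover have "n \<in> f ` (M \<inter> cball c r)" using z cr(3) by blast
        ultimately have "n \<in> f ` S k c r" by (auto simp: E_def B_def)
        then obtain m where "m \<in> U k" "m \<in> ball c (2 * r)" "f m = n" by (auto simp: S_def)
        then show "U k \<inter> ?\<Phi> \<inter> P \<noteq> {}" using cr(4) PQ(1) UM by blast
      qed
    qed
    have "(\<Inter>k. U k \<inter> ?\<Phi>) \<subseteq> {m \<in> G. f m = n}" using U(3) by auto
    moreover have "{m \<in> G. f m = n} \<subseteq> ?\<Phi>" using GM by auto
    ultimately show ?thesis by (rule residual_inI[OF op dense])
  qed
  ultimately show ?thesis by blast
qed

lemma residual_in_section:
  fixes M G :: "('a::metric_space \<times> 'b::metric_space) set"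
  assumes "residual_in {z \<in> M. fst z = x} {z \<in> G. fst z = x}"
  shows "residual_in {x'. (x, x') \<in> M} {x'. (x, x') \<in> G}"
proof -
  obtain U :: "nat \<Rightarrow> ('a \<times> 'b) set" where GM: "{z \<in> G. fst z = x} \<subseteq> {z \<in> M. fst z = x}"
    and U: "\<And>k. openin (top_of_set {z \<in> M. fst z = x}) (U k)" "\<And>k. {z \<in> M. fst z = x} \<subseteq> closure (U k)"
      "(\<Inter>k. U k) \<subseteq> {z \<in> G. fst z = x}"
    using assms unfolding residual_in_def by blast
  have "openin (top_of_set {x'. (x, x') \<in> M}) {x'. (x, x') \<in> U k}" for k
  proof -
    obtain T where T: "open T" "U k = {z \<in> M. fst z = x} \<inter> T" using U(1)[of k] by (auto simp: openin_open)
    have "open (Pair x -` T)" by (intro open_vimage T(1) continuous_intros)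
    moreover have "{x'. (x, x') \<in> U k} = {x'. (x, x') \<in> M} \<inter> Pair x -` T" using T(2) by auto
    ultimately show ?thesis by (auto simp: openin_open)
  qed
  moreover have "{x'. (x, x') \<in> M} \<subseteq> closure {x'. (x, x') \<in> U k}" for k
  proof
    fix x' assume x': "x' \<in> {x'. (x, x') \<in> M}"
    show "x' \<in> closure {x'. (x, x') \<in> U k}"
      unfolding closure_iff_nhds_not_empty
    proof (intro allI impI)
      fix P Q assume PQ: "Q \<subseteq> P" "open Q" "x' \<in> Q"
      have "(x, x') \<in> closure (U k)" using U(2)[of k] x' by auto
      moreover have "open (UNIV \<times> Q)" using PQ(2) by (simp add: open_Times)
      ultimately have "U k \<inter> UNIV \<times> Q \<noteq> {}" by (rule closure_meets) (use PQ(3) in simp)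
      then obtain z where z: "z \<in> U k" "z \<in> UNIV \<times> Q" by blast
      moreover have "fst z = x" using openin_imp_subset[OF U(1)[of k]] z(1) by blast
      ultimately have "snd z \<in> {x'. (x, x') \<in> U k} \<inter> P" using PQ(1) by (cases z) auto
      then show "{x'. (x, x') \<in> U k} \<inter> P \<noteq> {}" by blast
    qed
  qed
  moreover have "(\<Inter>k. {x'. (x, x') \<in> U k}) \<subseteq> {x'. (x, x') \<in> G}" using U(3) by auto
  moreover have "{x'. (x, x') \<in> G} \<subseteq> {x'. (x, x') \<in> M}" using GM by auto
  ultimately show ?thesis by (rule residual_inI)
qed

text \<open>If the first set does not already contain \<open>V \<inter> N\<close>, removing it from
  \<open>V\<close> leaves a smaller nonempty open trace covered by the others; finiteness of the
  cover replaces Baire category.\<close>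

lemma finite_closed_cover_interior:
  assumes "finite \<C>" "\<And>C. C \<in> \<C> \<Longrightarrow> closedin (top_of_set N) C"
    and "open V" "V \<inter> N \<noteq> {}" "V \<inter> N \<subseteq> \<Union>\<C>"
  shows "\<exists>C\<in>\<C>. \<exists>V. open V \<and> V \<inter> N \<noteq> {} \<and> V \<inter> N \<subseteq> C"
  using assms
proof (induction \<C> arbitrary: V rule: finite_induct)
  case (insert C \<C>)
  show ?case
  proof (cases "V \<inter> N \<subseteq> C")
    case True
    then show ?thesis using insert.prems by blast
  next
    case False
    obtain C' where C': "closed C'" "C = N \<inter> C'" using insert.prems(1)[of C] by (auto simp: closedin_closed)
    have "\<exists>C\<in>\<C>. \<exists>V. open V \<and> V \<inter> N \<noteq> {} \<and> V \<inter> N \<subseteq> C"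
    proof (rule insert.IH)
      show "open (V - C')" using insert.prems(2) C'(1) by (rule open_Diff)
      show "(V - C') \<inter> N \<noteq> {}" "(V - C') \<inter> N \<subseteq> \<Union>\<C>" using False C'(2) insert.prems(4) by blast+
      show "closedin (top_of_set N) C" if "C \<in> \<C>" for C using insert.prems(1) that by blast
    qed
    then show ?thesis by blast
  qed
qed simp

lemma flow_continuous_on:
  assumes "is_flow euclidean (top_of_set X) actX"
  shows "continuous_on X (actX t)"
proof -
  have c: "continuous_map (prod_topology euclidean (top_of_set X)) (top_of_set X) (\<lambda>(t, x). actX t x)"
    using assms by (simp add: is_flow_def)
  have "continuous_map (top_of_set X) (prod_topology euclidean (top_of_set X)) (\<lambda>x. (t, x))"
    by (simp add: continuous_map_pairwise o_def)
  from continuous_map_compose[OF this c] have "continuous_map (top_of_set X) (top_of_set X) (actX t)"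
    by (simp add: o_def)
  then show ?thesis by (simp add: continuous_map_iff_continuous2 continuous_map_in_subtopology)
qed

text \<open>Finitely many translates of the image of an open set cover a minimal flow, so one of them,
  hence the image itself, has interior.\<close>

lemma semi_open_image:
  fixes actN :: "'g::topological_group_add \<Rightarrow> 'n::metric_space \<Rightarrow> 'n" and f :: "'m::metric_space \<Rightarrow> 'n"
  assumes M: "compact M" and f: "continuous_on M f" and N: "N \<noteq> {}" "is_flow euclidean (top_of_set N) actN"
    and cover: "\<And>W. open W \<Longrightarrow> W \<inter> M \<noteq> {} \<Longrightarrow> \<exists>T. finite T \<and> (\<forall>x\<in>N. \<exists>t\<in>T. actN t x \<in> f ` (M \<inter> W))"
    and W: "open W" "W \<inter> M \<noteq> {}"
  shows "\<exists>V. open V \<and> V \<inter> N \<noteq> {} \<and> V \<inter> N \<subseteq> f ` (M \<inter> W)"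
proof -
  obtain z where z: "z \<in> W" "z \<in> M" using W(2) by blast
  \<comment> \<open>Shrinking to a closed ball makes the image compact, so that the translates
    covering \<open>N\<close> are closed.\<close>
  obtain r where r: "r > 0" "cball z r \<subseteq> W" using W(1) z(1) by (meson open_contains_cball)
  define Z where "Z = f ` (M \<inter> cball z r)"
  have "compact Z" unfolding Z_def
    by (intro compact_continuous_image continuous_on_subset[OF f] compact_Int_closed M) auto
  then have Zc: "closed Z" by (rule compact_imp_closed)
  have "z \<in> ball z r \<inter> M" using z(2) r(1) by simp
  then have "ball z r \<inter> M \<noteq> {}" by blast
  then obtain T where T: "finite T" "\<And>x. x \<in> N \<Longrightarrow> \<exists>t\<in>T. actN t x \<in> f ` (M \<inter> ball z r)"
    using cover[of "ball z r"] by blast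
  have flow: "\<And>x. x \<in> N \<Longrightarrow> actN 0 x = x" "\<And>s t x. x \<in> N \<Longrightarrow> actN (s + t) x = actN s (actN t x)"
    "\<And>t x. x \<in> N \<Longrightarrow> actN t x \<in> N"
    using N(2) by (auto simp: is_flow_def)
  let ?\<C> = "(\<lambda>t. N \<inter> actN t -` Z) ` T"
  have "\<exists>C\<in>?\<C>. \<exists>V. open V \<and> V \<inter> N \<noteq> {} \<and> V \<inter> N \<subseteq> C"
  proof (rule finite_closed_cover_interior[where V = UNIV])
    show "closedin (top_of_set N) C" if "C \<in> ?\<C>" for C
      using that continuous_closedin_preimage[OF flow_continuous_on[OF N(2)] Zc] by auto
    show "UNIV \<inter> N \<subseteq> \<Union>?\<C>"
    proof
      fix x assume "x \<in> UNIV \<inter> N"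
      then obtain t where "t \<in> T" "actN t x \<in> f ` (M \<inter> ball z r)" using T(2) by blast
      moreover have "f ` (M \<inter> ball z r) \<subseteq> Z" unfolding Z_def by (intro image_mono) auto
      ultimately show "x \<in> \<Union>?\<C>" using \<open>x \<in> UNIV \<inter> N\<close> by blast
    qed
  qed (use T(1) N(1) in auto)
  then obtain t V where V: "t \<in> T" "open V" "V \<inter> N \<noteq> {}" "V \<inter> N \<subseteq> N \<inter> actN t -` Z" by blast
  \<comment> \<open>The interior was found in the preimage of \<open>Z\<close> under time
    \<open>t\<close>. Preimage under time \<open>- t\<close> moves it into \<open>Z\<close>.\<close>
  have "openin (top_of_set N) (N \<inter> actN (- t) -` V)"
    by (rule continuous_openin_preimage_gen[OF flow_continuous_on[OF N(2)] V(2)])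
  then obtain V' where V': "open V'" "N \<inter> actN (- t) -` V = N \<inter> V'" by (auto simp: openin_open)
  have inv: "actN (- t) (actN t x) = x" "actN t (actN (- t) x) = x" if "x \<in> N" for x
    using flow(2)[OF that, of "- t" t] flow(2)[OF that, of t "- t"] flow(1)[OF that] by simp_all
  have "V' \<inter> N \<noteq> {}"
  proof -
    obtain x where x: "x \<in> V" "x \<in> N" using V(3) by blast
    then have "actN t x \<in> N \<inter> actN (- t) -` V" using inv flow(3) by simp
    then show ?thesis using V'(2) by blast
  qed
  moreover have "V' \<inter> N \<subseteq> Z"
  proof
    fix y assume y: "y \<in> V' \<inter> N"
    then have "actN (- t) y \<in> V \<inter> N" using V'(2) flow(3) by blast
    then have "actN t (actN (- t) y) \<in> Z" using V(4) by blast
    then show "y \<in> Z" using inv y by simp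
  qed
  moreover have "Z \<subseteq> f ` (M \<inter> W)" unfolding Z_def using r(2) by (intro image_mono) auto
  ultimately show ?thesis using V'(1) by blast
qed

section \<open>Transitivity of the limit relation\<close>

context minimal_ideal_top
begin

context
  fixes actX :: "'g \<Rightarrow> 'x::metric_space \<Rightarrow> 'x" and X piX and H L
  assumes X: "compact X" "is_flow euclidean (top_of_set X) actX"
    and piX: "is_extension K act (top_of_set X) actX piX"
    and H: "csub H" "derived I H = H"
    and L: "L = (\<lambda>(m, n). (piX m, piX n)) ` Qcl H"
begin

lemma
  shows piX_cont: "continuous_map K euclidean piX" and piX_act: "m \<in> I \<Longrightarrow> piX (act t m) = actX t (piX m)"
    and piX_image: "piX ` I = X"
  using piX by (auto simp: is_extension_def is_hom_def continuous_map_in_subtopology)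

lemma piX2_cont: "continuous_map K2 euclidean (\<lambda>(m, n). (piX m, piX n))"
proof -
  have "continuous_map K2 (prod_topology euclidean euclidean) (\<lambda>(m, n). (piX m, piX n))"
    by (intro continuous_map_prod_top[THEN iffD2] disjI2 conjI piX_cont)
  then show ?thesis by simp
qed

lemma compact_L: "compact L"
proof -
  have "compactin K2 (Qcl H)" by (rule closedin_compact_space[OF compact_K2 closedin_Qcl])
  from image_compactin[OF this piX2_cont] show ?thesis by (simp add: L)
qed

lemma L_subset: "L \<subseteq> X \<times> X"
  using Qcl_sub[of H] piX_image by (auto simp: L)

lemma open_meets_graph:
  assumes "open W" "W \<inter> L \<noteq> {}"
  shows "\<exists>\<alpha>\<in>H. \<exists>m\<in>I. (piX m, piX (\<alpha> m)) \<in> W"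
    and "openin K2 {z \<in> topspace K2. (\<lambda>(m, n). (piX m, piX n)) z \<in> W}"
proof -
  show op: "openin K2 {z \<in> topspace K2. (\<lambda>(m, n). (piX m, piX n)) z \<in> W}" (is "openin K2 ?W")
    by (rule openin_continuous_map_preimage[OF piX2_cont]) (use assms(1) in simp)
  obtain z where z: "z \<in> Qcl H" "(\<lambda>(m, n). (piX m, piX n)) z \<in> W" using assms(2) by (auto simp: L)
  then have "z \<in> ?W" using Qcl_sub[of H] by auto
  then obtain \<alpha> where "\<alpha> \<in> H" "meets \<alpha> ?W"
    using z(1) op unfolding in_Qcl_iff[OF csubD(1)[OF H(1)]] by blast
  then show "\<exists>\<alpha>\<in>H. \<exists>m\<in>I. (piX m, piX (\<alpha> m)) \<in> W" by (auto simp: meets_def)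
qed

lemma L_graph: "\<alpha> \<in> H \<Longrightarrow> m \<in> I \<Longrightarrow> (piX m, piX (\<alpha> m)) \<in> L"
  using Qcl_graph[OF csubD(1)[OF H(1)]] by (force simp: L)

text \<open>Let the two open sets meet graphs of \<open>\<alpha>\<close> and \<open>\<beta>\<close>.
  Since \<open>inv \<beta> \<circ> \<alpha>\<close> lies in the derived group, some
  \<open>\<delta>\<close> is close both to it and to the identity, and the graph of
  \<open>\<beta> \<circ> \<delta>\<close> meets both sets; minimality of this graph gives the
  connecting time.\<close>

lemma L_transitive:
  assumes W: "open W" "W \<inter> L \<noteq> {}" "open W'" "W' \<inter> L \<noteq> {}"
  shows "\<exists>z\<in>W \<inter> L. \<exists>t. act2 actX t z \<in> W'"
proof -
  let ?p = "\<lambda>(m, n). (piX m, piX n)"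
  define P where "P = {z \<in> topspace K2. ?p z \<in> W}"
  define P' where "P' = {z \<in> topspace K2. ?p z \<in> W'}"
  have op: "openin K2 P" "openin K2 P'"
    unfolding P_def P'_def using open_meets_graph(2) W by blast+
  obtain \<alpha> m where \<alpha>: "\<alpha> \<in> H" "m \<in> I" "(piX m, piX (\<alpha> m)) \<in> W" using open_meets_graph(1)[OF W(1,2)] by blast
  obtain \<beta> n where \<beta>: "\<beta> \<in> H" "n \<in> I" "(piX n, piX (\<beta> n)) \<in> W'" using open_meets_graph(1)[OF W(3,4)] by blast
  have Aut: "\<alpha> \<in> Aut I" "\<beta> \<in> Aut I" using \<alpha>(1) \<beta>(1) csubD(2)[OF H(1)] by blast+
  have mem: "inv \<beta> \<circ> \<alpha> \<in> derived I H" unfolding H(2) using csubD(4,5)[OF H(1)] \<alpha>(1) \<beta>(1) by blast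
  have "\<exists>\<delta>\<in>H. meets \<delta> (pre2 id \<beta> P) \<and> meets \<delta> (pre2 id \<beta> P')"
  proof (rule derived_near[OF mem csubD(1)[OF H(1)] \<alpha>(2) \<beta>(2)])
    show "openin K2 (pre2 id \<beta> P)" "openin K2 (pre2 id \<beta> P')" by (simp_all add: openin_pre2_Aut Aut op)
    show "(m, (inv \<beta> \<circ> \<alpha>) m) \<in> pre2 id \<beta> P" "(n, n) \<in> pre2 id \<beta> P'"
      using \<alpha> \<beta> Aut by (simp_all add: P_def P'_def)
  qed
  then obtain \<delta> where \<delta>: "\<delta> \<in> H" "meets (\<beta> \<circ> \<delta>) P" "meets (\<beta> \<circ> \<delta>) P'" using meets_left by blast
  define \<eta> where "\<eta> = \<beta> \<circ> \<delta>"
  have \<eta>: "\<eta> \<in> H" "\<eta> \<in> Aut I" unfolding \<eta>_def using csubD(2,4)[OF H(1)] \<beta>(1) \<delta>(1) by blast+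
  obtain k where k: "k \<in> I" "(k, \<eta> k) \<in> P" using \<delta>(2) by (auto simp: meets_def \<eta>_def)
  obtain k' where k': "k' \<in> I" "(k', \<eta> k') \<in> P'" using \<delta>(3) by (auto simp: meets_def \<eta>_def)
  obtain t where t: "(act t k, \<eta> (act t k)) \<in> P'" using Gamma_orbit[OF \<eta>(2) k(1) k'(1) op(2) k'(2)] by blast
  have "act2 actX t (piX k, piX (\<eta> k)) \<in> W'"
    using t k(1) \<eta>(2) by (simp add: P'_def act2_def piX_act Aut_act)
  moreover have "(piX k, piX (\<eta> k)) \<in> W \<inter> L" using k L_graph[OF \<eta>(1) k(1)] by (simp add: P_def)
  ultimately show ?thesis by blast
qed

text \<open>The open set meets some graph, which is minimal and compact, so finitely many times
  bring every point of the graph into it. Projecting to the first coordinate reaches every point of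
  \<open>X\<close>.\<close>

lemma L_cover:
  assumes W: "open W" "W \<inter> L \<noteq> {}"
  shows "\<exists>T. finite T \<and> (\<forall>x\<in>X. \<exists>t\<in>T. actX t x \<in> fst ` (L \<inter> W))"
proof -
  let ?p = "\<lambda>(m, n). (piX m, piX n)"
  define P where "P = {z \<in> topspace K2. ?p z \<in> W}"
  have op: "openin K2 P" unfolding P_def by (rule open_meets_graph(2)[OF W])
  obtain \<alpha> m where \<alpha>: "\<alpha> \<in> H" "m \<in> I" "(piX m, piX (\<alpha> m)) \<in> W" using open_meets_graph(1)[OF W] by blast
  have Aut: "\<alpha> \<in> Aut I" using \<alpha>(1) csubD(2)[OF H(1)] by blast
  have mP: "(m, \<alpha> m) \<in> P" using \<alpha> Aut by (simp add: P_def)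
  define U where "U t = {n \<in> topspace K. (act t n, \<alpha> (act t n)) \<in> P}" for t
  have "openin K (U t)" for t
    unfolding U_def
  proof (rule openin_continuous_map_preimage[OF _ op])
    have "continuous_map K K (\<lambda>n. \<alpha> (act t n))"
      using continuous_map_compose[OF continuous_act Aut_continuous[OF Aut]] by (simp add: o_def)
    then show "continuous_map K K2 (\<lambda>n. (act t n, \<alpha> (act t n)))"
      using continuous_act[of t] by (simp add: continuous_map_pairwise o_def)
  qed
  moreover have "I \<subseteq> \<Union>(range U)"
  proof
    fix n assume n: "n \<in> I"
    obtain t where "(act t n, \<alpha> (act t n)) \<in> P" using Gamma_orbit[OF Aut n \<alpha>(2) op mP] by blast
    then show "n \<in> \<Union>(range U)" using n by (auto simp: U_def)
  qed
  ultimately obtain \<F> where \<F>: "finite \<F>" "\<F> \<subseteq> range U" "I \<subseteq> \<Union>\<F>"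
    using compactinD[of K I "range U"] compact_K unfolding compact_space_def topspace_K by blast
  obtain T where T: "finite T" "\<F> = U ` T" using finite_subset_image[OF \<F>(1,2)] by blast
  have "\<exists>t\<in>T. actX t x \<in> fst ` (L \<inter> W)" if x: "x \<in> X" for x
  proof -
    obtain n where n: "n \<in> I" "x = piX n" using x piX_image by blast
    obtain t where t: "t \<in> T" "n \<in> U t" using \<F>(3) T(2) n(1) by blast
    have "(piX (act t n), piX (\<alpha> (act t n))) \<in> L \<inter> W"
      using t(2) L_graph[OF \<alpha>(1), of "act t n"] n(1) by (simp add: U_def P_def)
    then have "actX t x \<in> fst ` (L \<inter> W)" using piX_act[OF n(1)] n(2) by force
    then show ?thesis using t(1) by blast
  qed
  then show ?thesis using T(1) by blast
qed

text \<open>For each ball of a countable family the points of \<open>L\<close> whose orbit visits it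
  form a relatively open set, dense by transitivity; the balls that meet \<open>L\<close> suffice to
  detect density of an orbit.\<close>

lemma residual_dense_orbit:
  "residual_in L {z \<in> L. L \<subseteq> closure (range (\<lambda>t. act2 actX t z))}"
proof -
  obtain D where D: "countable D" "\<And>z O'. z \<in> L \<Longrightarrow> open O' \<Longrightarrow> z \<in> O' \<Longrightarrow>
    \<exists>(c, r)\<in>D. r > 0 \<and> z \<in> cball c r \<and> ball c (2 * r) \<subseteq> O'"
    using compact_countable_balls[OF compact_L] by blast
  define U where "U c r = {z \<in> L. \<exists>t. act2 actX t z \<in> ball c (2 * r)}" for c r
  define \<U> where "\<U> = (\<lambda>(c, r). U c r) ` {(c, r) \<in> D. ball c (2 * r) \<inter> L \<noteq> {}}"
  show ?thesis
  proof (rule residual_in_countable)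
    have "countable {(c, r) \<in> D. ball c (2 * r) \<inter> L \<noteq> {}}" by (rule countable_subset[OF _ D(1)]) auto
    then show "countable \<U>" unfolding \<U>_def by (rule countable_image)
    fix V assume "V \<in> \<U>"
    then obtain c r where V: "V = U c r" "ball c (2 * r) \<inter> L \<noteq> {}" by (auto simp: \<U>_def)
    have "openin (top_of_set L) (L \<inter> act2 actX t -` ball c (2 * r))" for t
    proof (rule continuous_openin_preimage_gen)
      have "continuous_on (X \<times> X) (act2 actX t)"
        unfolding act2_def
        by (intro continuous_intros continuous_on_compose2[OF flow_continuous_on[OF X(2)]]) auto
      then show "continuous_on L (act2 actX t)" by (rule continuous_on_subset[OF _ L_subset])
    qed simp
    then have "openin (top_of_set L) (\<Union>t. L \<inter> act2 actX t -` ball c (2 * r))" by blast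
    moreover have "V = (\<Union>t. L \<inter> act2 actX t -` ball c (2 * r))" unfolding V(1) U_def by blast
    ultimately have "openin (top_of_set L) V" by simp
    moreover have "L \<subseteq> closure V"
    proof
      fix w assume w: "w \<in> L"
      show "w \<in> closure V"
        unfolding closure_iff_nhds_not_empty
      proof (intro allI impI)
        fix P Q assume PQ: "Q \<subseteq> P" "open Q" "w \<in> Q"
        obtain z t where "z \<in> Q \<inter> L" "act2 actX t z \<in> ball c (2 * r)"
          using L_transitive[OF PQ(2) _ open_ball V(2)] w PQ(3) by blast
        then show "V \<inter> P \<noteq> {}" using PQ(1) by (auto simp: V(1) U_def)
      qed
    qed
    ultimately show "openin (top_of_set L) V \<and> L \<subseteq> closure V" by blast
  next
    fix z assume z: "z \<in> L" "\<And>V. V \<in> \<U> \<Longrightarrow> z \<in> V"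
    have "w \<in> closure (range (\<lambda>t. act2 actX t z))" if w: "w \<in> L" for w
      unfolding closure_iff_nhds_not_empty
    proof (intro allI impI)
      fix P Q assume PQ: "Q \<subseteq> P" "open Q" "w \<in> Q"
      obtain c r where cr: "(c, r) \<in> D" "r > 0" "w \<in> cball c r" "ball c (2 * r) \<subseteq> Q"
        using D(2)[OF w PQ(2,3)] by blast
      have "w \<in> ball c (2 * r)" using cr(2,3) by simp
      then have "U c r \<in> \<U>" unfolding \<U>_def using cr(1) w by force
      then have "z \<in> U c r" by (rule z(2))
      then obtain t where "act2 actX t z \<in> ball c (2 * r)" by (auto simp: U_def)
      then show "range (\<lambda>t. act2 actX t z) \<inter> P \<noteq> {}" using cr(4) PQ(1) by blast
    qed
    then show "z \<in> {z \<in> L. L \<subseteq> closure (range (\<lambda>t. act2 actX t z))}" using z(1) by blast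
  qed auto
qed

end

end

section \<open>Semi-openness of \<pi> and the assembly of the residual sets\<close>

lemma minimal_flow_cover:
  fixes actX :: "'g::topological_group_add \<Rightarrow> 'x::metric_space \<Rightarrow> 'x" and actY :: "'g \<Rightarrow> 'y::metric_space \<Rightarrow> 'y"
  assumes X: "compact X" "is_minimal_compact_flow (top_of_set X) actX"
    and \<pi>: "is_extension (top_of_set X) actX (top_of_set Y) actY \<pi>"
    and W: "open W" "W \<inter> X \<noteq> {}"
  shows "\<exists>T. finite T \<and> (\<forall>y\<in>Y. \<exists>t\<in>T. actY t y \<in> \<pi> ` (X \<inter> W))"
proof -
  have flow: "is_flow euclidean (top_of_set X) actX"
    and dense: "\<And>x. x \<in> X \<Longrightarrow> top_of_set X closure_of orbit actX x = X"
    using X(2) by (auto simp: is_minimal_compact_flow_def is_minimal_flow_def)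
  have inX: "\<And>t x. x \<in> X \<Longrightarrow> actX t x \<in> X" using flow by (auto simp: is_flow_def)
  define U where "U t = X \<inter> actX t -` W" for t
  have op: "openin (top_of_set X) (U t)" for t
    unfolding U_def by (rule continuous_openin_preimage_gen[OF flow_continuous_on[OF flow] W(1)])
  have "X \<subseteq> \<Union>(range U)"
  proof
    fix x assume x: "x \<in> X"
    obtain w where w: "w \<in> W" "w \<in> X" using W(2) by blast
    have "w \<in> top_of_set X closure_of orbit actX x" using dense[OF x] w(2) by simp
    moreover have "openin (top_of_set X) (X \<inter> W)" using W(1) by (rule openin_open_Int)
    ultimately obtain y where "y \<in> orbit actX x" "y \<in> X \<inter> W" using w unfolding in_closure_of by blast
    then show "x \<in> \<Union>(range U)" using x by (auto simp: orbit_def U_def)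
  qed
  moreover have "compactin (top_of_set X) X" using X(1) by (simp add: compactin_subtopology)
  ultimately obtain \<F> where \<F>: "finite \<F>" "\<F> \<subseteq> range U" "X \<subseteq> \<Union>\<F>"
    using compactinD[of "top_of_set X" X "range U"] op by blast
  obtain T where T: "finite T" "\<F> = U ` T" using finite_subset_image[OF \<F>(1,2)] by blast
  have \<pi>': "\<pi> ` X = Y" "\<And>t x. x \<in> X \<Longrightarrow> \<pi> (actX t x) = actY t (\<pi> x)"
    using \<pi> by (auto simp: is_extension_def is_hom_def)
  have "\<exists>t\<in>T. actY t y \<in> \<pi> ` (X \<inter> W)" if "y \<in> Y" for y
  proof -
    obtain x where x: "x \<in> X" "y = \<pi> x" using \<pi>'(1) \<open>y \<in> Y\<close> by blast
    obtain t where t: "t \<in> T" "x \<in> U t" using \<F>(3) T(2) x(1) by blast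
    then have "actX t x \<in> X \<inter> W" using inX[OF x(1)] by (simp add: U_def)
    then show ?thesis using t(1) \<pi>'(2)[OF x(1), of t] x(2) by (metis imageI)
  qed
  then show ?thesis using T(1) by blast
qed

theorem theorem5p1:
  fixes actX :: "'g::topological_group_add \<Rightarrow> 'x::metric_space \<Rightarrow> 'x"
    and actY :: "'g \<Rightarrow> 'y::metric_space \<Rightarrow> 'y"
    and X :: "'x set" and Y :: "'y set" and \<pi> :: "'x \<Rightarrow> 'y"
    and I :: "'g filter set" and piX :: "'g filter \<Rightarrow> 'x"
  assumes "compact X" and "compact Y"
    and "is_minimal_compact_flow (top_of_set X) actX"
    and "is_minimal_compact_flow (top_of_set Y) actY"
    and "is_extension (top_of_set X) actX (top_of_set Y) actY \<pi>"
    and "\<not> is_PI (top_of_set X) actX (top_of_set Y) actY \<pi>"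
    and "is_minimal_left_ideal I"
    and "is_extension (subtopology betaT_top I) betaT_act (top_of_set X) actX piX"
  shows "\<exists>Y_LY. residual_in Y Y_LY \<and>
           (\<forall>y\<in>Y_LY. \<exists>G. residual_in {x\<in>X. \<pi> x = y} G \<and>
              (\<forall>x\<in>G. \<exists>S. residual_in {x'. (x, x') \<in> M_infty I piX \<pi>} S \<and>
                 (\<forall>x'\<in>S. LY_pair_rel actX X \<pi> (M_infty I piX \<pi>) x x')))"
proof -
  interpret minimal_ideal_top I by unfold_locales (rule assms(7))
  have flowX: "is_flow euclidean (top_of_set X) actX" "X \<noteq> {}" "Hausdorff_space (top_of_set X)"
    using assms(3) by (auto simp: is_minimal_compact_flow_def is_minimal_flow_def)
  have flowY: "is_flow euclidean (top_of_set Y) actY" "Y \<noteq> {}" "Hausdorff_space (top_of_set Y)"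
    using assms(4) by (auto simp: is_minimal_compact_flow_def is_minimal_flow_def)
  have \<pi>: "continuous_on X \<pi>" "\<pi> ` X = Y"
    using assms(5) by (auto simp: is_extension_def is_hom_def continuous_map_in_subtopology)
  define F where "F = FF_of I (\<pi> \<circ> piX)"
  define H where "H = F_infty I F"
  define L where "L = M_infty I piX \<pi>"
  have kY: "icer (ker (\<pi> \<circ> piX))" by (rule icer_ker[OF extension_comp[OF assms(8,5)] flowY(3)])
  have F: "csub F" unfolding F_def grp_ker[OF kY, symmetric] by (rule csub_grp[OF kY])
  have H: "csub H" "derived I H = H" unfolding H_def by (rule F_infty_csub[OF F], rule derived_F_infty)
  have L_eq: "L = (\<lambda>(m, n). (piX m, piX n)) ` Qcl H"
    unfolding L_def M_infty_def Qcl_def H_def F_def ..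
  note hyps = assms(1) flowX(1) assms(8) H L_eq
  have piX: "piX ` I = X" by (rule piX_image[OF hyps])
  have cL: "compact L" by (rule compact_L[OF hyps])
  have LX: "L \<subseteq> X \<times> X" by (rule L_subset[OF hyps])
  have Lrel: "L \<subseteq> rel_of X \<pi>"
  proof -
    have "Qcl H \<subseteq> ker (\<pi> \<circ> piX)"
    proof (rule Qcl_minimal[OF icerD(1)[OF kY]])
      fix \<alpha> m assume "\<alpha> \<in> H" "m \<in> I"
      then have "\<alpha> \<in> grp (ker (\<pi> \<circ> piX))"
        using F_infty_subset[of F] unfolding grp_ker[OF kY] H_def F_def by blast
      then show "(m, \<alpha> m) \<in> ker (\<pi> \<circ> piX)" using grp_iff[OF kY \<open>m \<in> I\<close>] by blast
    qed
    then show ?thesis using piX unfolding L_eq by (force simp: ker_def rel_of_def)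
  qed
  have diag: "diag X \<subseteq> L"
  proof
    fix z assume "z \<in> diag X"
    then obtain m where "m \<in> I" "z = (piX m, piX m)" using piX by (auto simp: diag_def)
    then show "z \<in> L" using L_graph[OF hyps csubD(3)[OF H(1)], of m] by simp
  qed
  moreover have "diag X \<noteq> L"
  proof
    \<comment> \<open>The graphs of the stable group are then mapped into the diagonal, so the group
      acts trivially over \<open>X\<close> and the PI criterion contradicts the hypothesis.\<close>
    assume eq: "diag X = L"
    have "F_infty I (FF_of I (\<pi> \<circ> piX)) \<subseteq> FF_of I piX"
    proof
      fix \<alpha> assume \<alpha>: "\<alpha> \<in> F_infty I (FF_of I (\<pi> \<circ> piX))"
      then have \<alpha>H: "\<alpha> \<in> H" by (simp add: H_def F_def)
      have "piX (\<alpha> m) = piX m" if "m \<in> I" for m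
        using L_graph[OF hyps \<alpha>H that] eq by (auto simp: diag_def)
      then show "\<alpha> \<in> FF_of I piX" using csubD(2)[OF H(1) \<alpha>H] by (simp add: FF_of_def)
    qed
    from PI_of_trivial_F_infty[OF assms(1,3,4,5,8) this] show False using assms(6) by blast
  qed
  ultimately have diagL: "diag X \<subset> L" by blast
  define G where "G = {z \<in> L. L \<subseteq> closure (range (\<lambda>t. act2 actX t z))}"
  have G: "residual_in L G" unfolding G_def by (rule residual_dense_orbit[OF hyps])
  \<comment> \<open>The fibre theorem is applied along \<open>L \<rightarrow> X\<close> here and
    along \<open>\<pi>\<close> below: the base set of the one application is the residual set of the
    other.\<close>
  have "\<exists>X0. residual_in X X0 \<and> (\<forall>x\<in>X0. residual_in {z \<in> L. fst z = x} {z \<in> G. fst z = x})"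
  proof (rule residual_fibres[OF cL _ _ _ G])
    show f: "continuous_on L fst" by (intro continuous_intros)
    show "fst ` L \<subseteq> X" using LX by auto
    show "\<exists>V. open V \<and> V \<inter> X \<noteq> {} \<and> V \<inter> X \<subseteq> fst ` (L \<inter> W)" if "open W" "W \<inter> L \<noteq> {}" for W
      by (rule semi_open_image[OF cL f flowX(2,1) L_cover[OF hyps] that])
  qed
  then obtain X0 where X0: "residual_in X X0"
    "\<And>x. x \<in> X0 \<Longrightarrow> residual_in {z \<in> L. fst z = x} {z \<in> G. fst z = x}" by blast
  have "\<exists>Y0. residual_in Y Y0 \<and> (\<forall>y\<in>Y0. residual_in {x \<in> X. \<pi> x = y} {x \<in> X0. \<pi> x = y})"
  proof (rule residual_fibres[OF assms(1) \<pi>(1) _ _ X0(1)])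
    show "\<pi> ` X \<subseteq> Y" using \<pi>(2) by simp
    show "\<exists>V. open V \<and> V \<inter> Y \<noteq> {} \<and> V \<inter> Y \<subseteq> \<pi> ` (X \<inter> W)" if "open W" "W \<inter> X \<noteq> {}" for W
      by (rule semi_open_image[OF assms(1) \<pi>(1) flowY(2,1) minimal_flow_cover[OF assms(1,3,5)] that])
  qed
  then obtain Y0 where Y0: "residual_in Y Y0"
    "\<And>y. y \<in> Y0 \<Longrightarrow> residual_in {x \<in> X. \<pi> x = y} {x \<in> X0. \<pi> x = y}" by blast
  have "LY_pair_rel actX X \<pi> L x x'" if "(x, x') \<in> G" for x x'
    using that Lrel diagL compact_imp_closed[OF cL] unfolding LY_pair_rel_def G_def by auto
  then have pairs: "\<forall>x\<in>X0. \<exists>S. residual_in {x'. (x, x') \<in> L} S \<and> (\<forall>x'\<in>S. LY_pair_rel actX X \<pi> L x x')"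
    using residual_in_section[OF X0(2)] by blast
  show ?thesis
    unfolding L_def[symmetric]
  proof (intro exI[of _ Y0] conjI ballI Y0(1))
    fix y assume "y \<in> Y0"
    from Y0(2)[OF this] pairs
    show "\<exists>G. residual_in {x \<in> X. \<pi> x = y} G \<and>
      (\<forall>x\<in>G. \<exists>S. residual_in {x'. (x, x') \<in> L} S \<and> (\<forall>x'\<in>S. LY_pair_rel actX X \<pi> L x x'))"
      by blast
  qed
qed

end
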